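(* Let $(K,d,\mu)$ be a scale-irregular Vicsek set. For each $1<p<\infty$ there exist a normed vector space $(\mathcal{F}_p,\|\cdot\|_{\mathcal{F}_p})$ and a functional $\mathcal{E}_p:\mathcal{F}_p\to[0,\infty)$ such that $\mathcal{E}_p^{1/p}$ is a semi-norm on $\mathcal{F}_p$, namely the ones given explicitly in the context, with the following properties. (1) $(\mathcal{F}_p,\|\cdot\|_{\mathcal{F}_p})$ is a uniformly convex separable reflexive Banach space. (2) $\mathcal{F}_p$ is an algebra under the pointwise product, that is, $uv\in\mathcal{F}_p$ whenever $u,v\in\mathcal{F}_p$. Moreover, $$\mathcal{E}_p(uv)\le 2^{p-1}\left(\|u\|_{C(K)}^p\,\mathcal{E}_p(v)+\|v\|_{C(K)}^p\,\mathcal{E}_p(u)\right)\quad\text{for all }u,v\in\mathcal{F}_p .$$ (3) (Regularity) $\mathcal{F}_p\subset C(K)$ is a dense subspace of $(C(K),\|\cdot\|_\infty)$. (4) (Lipschitz contractivity) For every $u\in\mathcal{F}_p$ and every $1$-Lipschitz function $\varphi:\mathbb{R}\to\mathbb{R}$, we have $\varphi\circ u\in\mathcal{F}_p$ and $\mathcal{E}_p(\varphi\circ u)\le\mathcal{E}_p(u)$. (5) (Spectral gap) There is a constant $C\ge1$ such that, for every $u\in\mathcal{F}_p$, $$\int_K\left|u(x)-\frac{1}{\mu(K)}\int_K u\,d\mu\right|^p d\mu(x)\le C\,\mathrm{diam}(K)^{p-1}\,\mathcal{E}_p(u).$$ (6) (Strong locality) If $u,v\in\mathcal{F}_p$ satisfy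 $\mathrm{supp}(u)\cap\mathrm{supp}(v-a\mathbf{1}_K)=\emptyset$ for some $a\in\mathbb{R}$, then $\mathcal{E}_p(u+v)=\mathcal{E}_p(u)+\mathcal{E}_p(v)$.
   Context: Scale-irregular Vicsek set. Let $\mathbf{l}=(l_k)_{k\ge1}$ be a sequence of odd integers $l_k\ge3$, and set $l_0:=1$. In the complex plane put $q_0:=0$ and $q_j:=\exp((2j-1)\pi i/4)$ for $1\le j\le4$, and let $K_0$ be the closed (filled) square with vertices $q_1,q_2,q_3,q_4$. For an odd integer $l\ge3$ let $S_l:=\{2nl^{-1}q_j:\ 0\le n\le\frac12(l-1),\ n\in\mathbb{Z},\ 1\le j\le4\}$ (so $\#S_l=2l-1$), and for $w\in S_l$ let $F_w^l(z):=w+l^{-1}z$, $z\in\mathbb{C}$. Let $W_n:=\prod_{k=1}^nS_{l_k}$ for $n\ge1$, and for $w=w_1\cdots w_n\in W_n$ let $F_w:=F_{w_1}^{l_1}\circ\cdots\circ F_{w_n}^{l_n}$. The scale-irregular Vicsek set is the compact set $K=K^{\mathbf{l}}:=\bigcap_{n=1}^\infty\bigcup_{w\in W_n}F_w(K_0)$ with the Euclidean metric $d$. For $w\in W_n$ write $K_w:=F_w(K_0)\cap K$. The measure $\mu$ is the Borel probability measure on $K$ determined by $\mu(K_w)=(\#W_n)^{-1}=\prod_{k=1}^n(2l_k-1)^{-1}$ for all $n\ge1$, $w\in W_n$. Graphs. Let $V_0:=\{q_j\}_{j=0}^4$ and $V_n:=\bigcup_{w\in W_n}F_w(V_0)$ for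 $n\ge1$. For $x,y\in V_n$ write $x\sim y$ (adjacent in $V_n$) if $d(x,y)=\prod_{j=0}^nl_j^{-1}$. Energy. $C(K)$ is the space of real-valued continuous functions on $K$, with sup norm $\|\cdot\|_{C(K)}=\|\cdot\|_\infty$. For $1<p<\infty$, $n\ge0$, $u\in C(K)$ let $$\mathcal{E}_{p,n}(u):=\frac12\Big(\prod_{j=0}^nl_j^{p-1}\Big)\sum_{x,y\in V_n,\ x\sim y}|u(x)-u(y)|^p$$ (sum over ordered pairs). Define $\mathcal{F}_p:=\{u\in C(K):\sup_{n\ge0}\mathcal{E}_{p,n}(u)<\infty\}$, $\mathcal{E}_p(u):=\sup_{n\ge0}\mathcal{E}_{p,n}(u)$ and $\|u\|_{\mathcal{F}_p}:=\big(\|u\|_{L^p(K,\mu)}^p+\mathcal{E}_p(u)\big)^{1/p}$. *)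

theory Defs
  imports "HOL-Analysis.Analysis" "HOL-Library.Function_Algebras"
begin

section \<open>Real-valued functions as a real vector space\<close>

text \<open>The ring structure on functions is the pointwise one of
  \<^theory>\<open>HOL-Library.Function_Algebras\<close>. Since both function spaces and spaces of functionals on
  them are then subspaces of types of class \<^class>\<open>real_vector\<close>, the notions below can be
  iterated, as is needed for the bidual.\<close>

instantiation "fun" :: (type, real_vector) real_vector
begin

definition scaleR_fun :: "real \<Rightarrow> ('a \<Rightarrow> 'b) \<Rightarrow> 'a \<Rightarrow> 'b"
  where "scaleR_fun c f = (\<lambda>x. c *\<^sub>R f x)"

instance
  by standard (auto simp: scaleR_fun_def fun_eq_iff algebra_simps)

end


section \<open>Normed spaces with an explicit carrier\<close>

definition seminorm_on :: "'v::real_vector set \<Rightarrow> ('v \<Rightarrow> real) \<Rightarrow> bool" where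
  "seminorm_on X N \<longleftrightarrow> subspace X \<and>
     (\<forall>x\<in>X. 0 \<le> N x) \<and>
     (\<forall>x\<in>X. \<forall>c. N (c *\<^sub>R x) = \<bar>c\<bar> * N x) \<and>
     (\<forall>x\<in>X. \<forall>y\<in>X. N (x + y) \<le> N x + N y)"

definition normed_space_on :: "'v::real_vector set \<Rightarrow> ('v \<Rightarrow> real) \<Rightarrow> bool" where
  "normed_space_on X N \<longleftrightarrow> seminorm_on X N \<and> (\<forall>x\<in>X. N x = 0 \<longrightarrow> x = 0)"

text \<open>\<^locale>\<open>Metric_space\<close> asks for nonnegativity and symmetry on the whole type, whereas
  \<open>N\<close> is only meaningful on the carrier; hence the trivial value outside of it.\<close>

definition norm_dist :: "'v::real_vector set \<Rightarrow> ('v \<Rightarrow> real) \<Rightarrow> 'v \<Rightarrow> 'v \<Rightarrow> real" where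
  "norm_dist X N x y = (if x \<in> X \<and> y \<in> X then N (x - y) else 0)"

definition norm_topology :: "'v::real_vector set \<Rightarrow> ('v \<Rightarrow> real) \<Rightarrow> 'v topology" where
  "norm_topology X N = Metric_space.mtopology X (norm_dist X N)"

definition banach_space_on :: "'v::real_vector set \<Rightarrow> ('v \<Rightarrow> real) \<Rightarrow> bool" where
  "banach_space_on X N \<longleftrightarrow>
     normed_space_on X N \<and> Metric_space.mcomplete X (norm_dist X N)"

definition uniformly_convex_on :: "'v::real_vector set \<Rightarrow> ('v \<Rightarrow> real) \<Rightarrow> bool" where
  "uniformly_convex_on X N \<longleftrightarrow>
     (\<forall>\<epsilon>>0. \<exists>\<delta>>0. \<forall>x\<in>X. \<forall>y\<in>X. N x = 1 \<longrightarrow> N y = 1 \<longrightarrow> N (x - y) \<ge> \<epsilon> \<longrightarrow>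
        N ((1/2) *\<^sub>R (x + y)) \<le> 1 - \<delta>)"

text \<open>A functional on the carrier is represented by its extension by \<open>0\<close>.\<close>

definition dual_space :: "'v::real_vector set \<Rightarrow> ('v \<Rightarrow> real) \<Rightarrow> ('v \<Rightarrow> real) set" where
  "dual_space X N = {f.
     (\<forall>x\<in>X. \<forall>y\<in>X. f (x + y) = f x + f y) \<and>
     (\<forall>x\<in>X. \<forall>c. f (c *\<^sub>R x) = c * f x) \<and>
     (\<exists>B. \<forall>x\<in>X. \<bar>f x\<bar> \<le> B * N x) \<and>
     (\<forall>x. x \<notin> X \<longrightarrow> f x = 0)}"

definition dual_norm :: "'v::real_vector set \<Rightarrow> ('v \<Rightarrow> real) \<Rightarrow> ('v \<Rightarrow> real) \<Rightarrow> real" where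
  "dual_norm X N f = (SUP x\<in>{x\<in>X. N x \<le> 1}. \<bar>f x\<bar>)"

text \<open>Surjectivity of the canonical embedding into the bidual.\<close>

definition reflexive_on :: "'v::real_vector set \<Rightarrow> ('v \<Rightarrow> real) \<Rightarrow> bool" where
  "reflexive_on X N \<longleftrightarrow>
     (\<forall>\<Phi> \<in> dual_space (dual_space X N) (dual_norm X N).
        \<exists>x\<in>X. \<forall>f\<in>dual_space X N. \<Phi> f = f x)"


section \<open>The scale-irregular Vicsek set\<close>

definition scale_sequence :: "(nat \<Rightarrow> nat) \<Rightarrow> bool" where
  "scale_sequence l \<longleftrightarrow> l 0 = 1 \<and> (\<forall>k\<ge>1. odd (l k) \<and> 3 \<le> l k)"

definition vicsek_q :: "nat \<Rightarrow> complex" where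
  "vicsek_q j = (if j = 0 then 0 else exp ((2 * of_nat j - 1) * complex_of_real pi * \<i> / 4))"

definition vicsek_K0 :: "complex set" where
  "vicsek_K0 = convex hull (vicsek_q ` {1..4})"

definition vicsek_S :: "nat \<Rightarrow> complex set" where
  "vicsek_S l = {of_nat (2 * n) / of_nat l * vicsek_q j | n j. n \<le> (l - 1) div 2 \<and> j \<in> {1..4}}"

definition vicsek_F :: "nat \<Rightarrow> complex \<Rightarrow> complex \<Rightarrow> complex" where
  "vicsek_F l w z = w + z / of_nat l"

text \<open>A word \<open>w\<^sub>1\<dots>w\<^sub>n\<close> is a function on \<open>{1..n}\<close>; for \<open>n = 0\<close> there is just the empty word, whose
  map is the identity.\<close>

definition vicsek_words :: "(nat \<Rightarrow> nat) \<Rightarrow> nat \<Rightarrow> (nat \<Rightarrow> complex) set" where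
  "vicsek_words l n = PiE {1..n} (\<lambda>k. vicsek_S (l k))"

primrec vicsek_map :: "(nat \<Rightarrow> nat) \<Rightarrow> nat \<Rightarrow> (nat \<Rightarrow> complex) \<Rightarrow> complex \<Rightarrow> complex" where
  "vicsek_map l 0 w = id"
| "vicsek_map l (Suc n) w = vicsek_map l n w \<circ> vicsek_F (l (Suc n)) (w (Suc n))"

definition vicsek_set :: "(nat \<Rightarrow> nat) \<Rightarrow> complex set" where
  "vicsek_set l = (\<Inter>n\<in>{1..}. \<Union>w\<in>vicsek_words l n. vicsek_map l n w ` vicsek_K0)"

definition vicsek_cell :: "(nat \<Rightarrow> nat) \<Rightarrow> nat \<Rightarrow> (nat \<Rightarrow> complex) \<Rightarrow> complex set" where
  "vicsek_cell l n w = vicsek_map l n w ` vicsek_K0 \<inter> vicsek_set l"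

definition vicsek_measure :: "(nat \<Rightarrow> nat) \<Rightarrow> complex measure \<Rightarrow> bool" where
  "vicsek_measure l M \<longleftrightarrow>
     sets M = sets (restrict_space borel (vicsek_set l)) \<and>
     emeasure M (space M) = 1 \<and>
     (\<forall>n\<ge>1. \<forall>w\<in>vicsek_words l n.
        measure M (vicsek_cell l n w) = 1 / real (card (vicsek_words l n)))"


section \<open>Graphs, energies and function spaces\<close>

definition vicsek_V :: "(nat \<Rightarrow> nat) \<Rightarrow> nat \<Rightarrow> complex set" where
  "vicsek_V l n = (\<Union>w\<in>vicsek_words l n. vicsek_map l n w ` (vicsek_q ` {0..4}))"

definition vicsek_edges :: "(nat \<Rightarrow> nat) \<Rightarrow> nat \<Rightarrow> (complex \<times> complex) set" where
  "vicsek_edges l n =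
     {(x, y). x \<in> vicsek_V l n \<and> y \<in> vicsek_V l n \<and> dist x y = (\<Prod>j=0..n. 1 / real (l j))}"

text \<open>Functions on a subset of the plane are represented by their extension by \<open>0\<close>, so that the
  pointwise vector space operations and products are those of the function type.\<close>

definition cont_space :: "complex set \<Rightarrow> (complex \<Rightarrow> real) set" where
  "cont_space K = {u. continuous_on K u \<and> (\<forall>x. x \<notin> K \<longrightarrow> u x = 0)}"

definition sup_norm :: "complex set \<Rightarrow> (complex \<Rightarrow> real) \<Rightarrow> real" where
  "sup_norm K u = (SUP x\<in>K. \<bar>u x\<bar>)"

definition comp_on :: "complex set \<Rightarrow> (real \<Rightarrow> real) \<Rightarrow> (complex \<Rightarrow> real) \<Rightarrow> complex \<Rightarrow> real" where
  "comp_on K \<phi> u = (\<lambda>x. if x \<in> K then \<phi> (u x) else 0)"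

definition supp_on :: "complex set \<Rightarrow> (complex \<Rightarrow> real) \<Rightarrow> complex set" where
  "supp_on K u = top_of_set K closure_of {x\<in>K. u x \<noteq> 0}"

definition discrete_energy :: "(nat \<Rightarrow> nat) \<Rightarrow> real \<Rightarrow> nat \<Rightarrow> (complex \<Rightarrow> real) \<Rightarrow> real" where
  "discrete_energy l p n u =
     1/2 * (\<Prod>j=0..n. real (l j) powr (p - 1)) * (\<Sum>(x, y)\<in>vicsek_edges l n. \<bar>u x - u y\<bar> powr p)"

definition sobolev_space :: "(nat \<Rightarrow> nat) \<Rightarrow> real \<Rightarrow> (complex \<Rightarrow> real) set" where
  "sobolev_space l p =
     {u \<in> cont_space (vicsek_set l). bdd_above (range (\<lambda>n. discrete_energy l p n u))}"

definition energy :: "(nat \<Rightarrow> nat) \<Rightarrow> real \<Rightarrow> (complex \<Rightarrow> real) \<Rightarrow> real" where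
  "energy l p u = (SUP n. discrete_energy l p n u)"

definition sobolev_norm ::
    "(nat \<Rightarrow> nat) \<Rightarrow> complex measure \<Rightarrow> real \<Rightarrow> (complex \<Rightarrow> real) \<Rightarrow> real" where
  "sobolev_norm l M p u = ((\<integral>x. \<bar>u x\<bar> powr p \<partial>M) + energy l p u) powr (1 / p)"

end

theory Submission
  imports Defs
begin

text \<open>
  Removing the first scale from \<open>l\<close> gives a scale sequence \<open>l'\<close>, the Vicsek set of \<open>l\<close> is the union of
  the images of that of \<open>l'\<close> under the first-level maps, and
  \<open>E\<^sub>n\<^sub>+\<^sub>1 u = l\<^sub>1\<^bsup>p-1\<^esup> \<Sum>\<^sub>d E'\<^sub>n (u \<circ> F\<^sub>d)\<close>. Statements about level \<open>n\<close> thus follow by induction on \<open>n\<close> for all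
  sequences at once: monotonicity of \<open>E\<^sub>n\<close>, the bound \<open>\<bar>u x - u 0\<bar> \<le> C E(u)\<^bsup>1/p\<^esup>\<close> (a geometric series along
  the path from \<open>0\<close> to \<open>x\<close>), and the approximation of continuous functions by functions
  that interpolate harmonically inside the cells of level \<open>n\<close>. The oscillation bound gives completeness
  and the spectral gap.

  The \<open>p\<close>-th power of the norm is a limit of positive combinations of terms \<open>\<bar>f u\<bar>\<^sup>p\<close> with \<open>f\<close> linear.
  A scalar inequality that is linear in \<open>p\<close>-th powers therefore yields uniform convexity for all
  \<open>p > 1\<close> simultaneously, hence reflexivity, and also separability, since a function is determined up to
  small energy by finitely many of its values and a sharp bound on its energy.
\<close>

section \<open>Powers of real numbers\<close>

text \<open>Clarkson's inequalities differ for \<open>p\<close> below and above 2, and the one below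
  2 is not linear in \<open>p\<close>-th powers. The inequality used here pays with an extra
  \<open>\<epsilon>\<close> term, but the same constants then serve every discrete energy, the limit
  energy and the integral. The geometric obstacle is that edges are defined by Euclidean distance,
  not by cells, so the recursion for the energy is not immediate. In units of
  \<open>half_side * cell_radius l n\<close> vertices are integer points with even abscissa at
  centres and odd abscissa at corners; an edge is a diagonal unit step and therefore joins the
  centre of a cell to one of its corners. For density, the linear coordinate
  \<open>x \<bullet> vicsek_q j\<close> is useless: it varies on every cell, and its
  level-\<open>n\<close> energy is twice the product of the \<open>(2 * l k - 1) / l k\<close>,
  which is unbounded. Collapsing all cells off one diagonal leaves \<open>l k\<close> cells per step
  in place of \<open>2 * l k - 1\<close>, which is just what keeps the energy bounded.\<close>

lemma one_plus_mult_less_powr: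
  fixes y p :: real
  assumes "1 < p" "0 \<le> y" "y \<noteq> 1"
  shows "1 + p * (y - 1) < y powr p"
proof (cases "y = 0")
  case False
  then have y: "y > 0" using assms by simp
  have der: "((\<lambda>x. x powr p) has_real_derivative p * x powr (p - 1)) (at x)" if "x > 0" for x
    using that by (rule has_real_derivative_powr)
  show ?thesis
  proof (cases "1 < y")
    case True
    obtain z where z: "1 < z" "z < y" "y powr p - 1 powr p = (y - 1) * (p * z powr (p - 1))"
      using MVT2[OF True, of "\<lambda>x. x powr p" "\<lambda>x. p * x powr (p - 1)"] der by auto
    have "1 < z powr (p - 1)" using z assms by (simp add: gr_one_powr)
    then have "(y - 1) * (p * 1) < (y - 1) * (p * z powr (p - 1))"
      using True assms by (intro mult_strict_left_mono) auto
    then show ?thesis using z by (simp add: algebra_simps)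
  next
    case False
    then have "y < 1" using assms by simp
    obtain z where z: "y < z" "z < 1" "1 powr p - y powr p = (1 - y) * (p * z powr (p - 1))"
      using MVT2[OF \<open>y < 1\<close>, of "\<lambda>x. x powr p" "\<lambda>x. p * x powr (p - 1)"] der y by auto
    have "z powr (p - 1) < 1"
      using z assms y powr_less_mono2[of "p - 1" z 1] by simp
    then have "(1 - y) * (p * z powr (p - 1)) < (1 - y) * (p * 1)"
      using \<open>y < 1\<close> assms by (intro mult_strict_left_mono) auto
    then show ?thesis using z by (simp add: algebra_simps)
  qed
qed (use assms in auto)

text \<open>The Bernoulli inequality at \<open>y = x / m\<close>, multiplied by
  \<open>m powr p\<close>. Keeping it strict is what makes the midpoint inequality below
  strict.\<close>

lemma powr_above_tangent:
  fixes x m p :: real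
  assumes "1 < p" "0 \<le> x" "0 < m" "x \<noteq> m"
  shows "m powr p + p * m powr (p - 1) * (x - m) < x powr p"
proof -
  have "m powr p * (1 + p * (x / m - 1)) < m powr p * (x / m) powr p"
    using one_plus_mult_less_powr[of p "x / m"] assms by (intro mult_strict_left_mono) auto
  moreover have "m powr p * (x / m) powr p = x powr p"
    using assms by (simp add: powr_divide)
  moreover have "m powr p = m * m powr (p - 1)"
    using assms by (simp add: powr_mult_base)
  then have "m powr p * (1 + p * (x / m - 1)) = m powr p + p * m powr (p - 1) * (x - m)"
    using assms by (simp add: field_simps)
  ultimately show ?thesis by simp
qed

lemma powr_above_tangent_le:
  fixes x m p :: real
  assumes "1 < p" "0 \<le> x" "0 < m"
  shows "m powr p + p * m powr (p - 1) * (x - m) \<le> x powr p"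
  using powr_above_tangent[OF assms] by (cases "x = m") auto

text \<open>Tangent lines at the weighted mean \<open>m\<close> of the absolute values lie below
  both powers; in their weighted sum the linear terms cancel.\<close>

lemma abs_powr_convex:
  fixes a b t p :: real
  assumes "1 < p" "0 \<le> t" "t \<le> 1"
  shows "\<bar>(1 - t) * a + t * b\<bar> powr p \<le> (1 - t) * \<bar>a\<bar> powr p + t * \<bar>b\<bar> powr p"
proof -
  define m where "m = (1 - t) * \<bar>a\<bar> + t * \<bar>b\<bar>"
  have m: "\<bar>(1 - t) * a + t * b\<bar> \<le> m" "0 \<le> m"
    unfolding m_def using assms abs_triangle_ineq[of "(1 - t) * a" "t * b"] by (auto simp: abs_mult)
  have "m powr p \<le> (1 - t) * \<bar>a\<bar> powr p + t * \<bar>b\<bar> powr p"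
  proof (cases "m = 0")
    case False
    with m have "m > 0" by simp
    have "(1 - t) * (m powr p + p * m powr (p - 1) * (\<bar>a\<bar> - m)) \<le> (1 - t) * \<bar>a\<bar> powr p"
      "t * (m powr p + p * m powr (p - 1) * (\<bar>b\<bar> - m)) \<le> t * \<bar>b\<bar> powr p"
      using assms \<open>m > 0\<close> by (intro mult_left_mono powr_above_tangent_le; simp)+
    moreover have "(1 - t) * (m powr p + p * m powr (p - 1) * (\<bar>a\<bar> - m)) +
      t * (m powr p + p * m powr (p - 1) * (\<bar>b\<bar> - m)) = m powr p + p * m powr (p - 1) * ((1 - t) * \<bar>a\<bar> + t * \<bar>b\<bar> - m)"
      by algebra
    ultimately show ?thesis unfolding m_def by simp
  qed (use assms in auto)
  moreover have "\<bar>(1 - t) * a + t * b\<bar> powr p \<le> m powr p"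
    using m assms by (intro powr_mono2) auto
  ultimately show ?thesis by simp
qed

lemma convex_on_abs_powr:
  fixes p :: real
  assumes "1 < p"
  shows "convex_on UNIV (\<lambda>x. \<bar>x\<bar> powr p)"
  by (rule convex_onI) (use abs_powr_convex[OF assms] in auto)

text \<open>Strictness has two sources: if the absolute values agree, then \<open>a = - b\<close>
  and the midpoint is 0; otherwise the tangent at their mean is strictly below the power at both
  ends.\<close>

lemma abs_powr_midpoint_less:
  fixes a b p :: real
  assumes "1 < p" "a \<noteq> b"
  shows "\<bar>(a + b) / 2\<bar> powr p < (\<bar>a\<bar> powr p + \<bar>b\<bar> powr p) / 2"
proof (cases "\<bar>a\<bar> = \<bar>b\<bar>")
  case True
  with assms have "a = - b" "b \<noteq> 0" by linarith+
  then show ?thesis by simp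
next
  case False
  define m where "m = (\<bar>a\<bar> + \<bar>b\<bar>) / 2"
  have m: "\<bar>(a + b) / 2\<bar> \<le> m" "0 < m" "\<bar>a\<bar> \<noteq> m" "\<bar>b\<bar> \<noteq> m"
    unfolding m_def using False by (auto simp: abs_if field_simps)
  have "m powr p + p * m powr (p - 1) * (\<bar>a\<bar> - m) < \<bar>a\<bar> powr p"
    "m powr p + p * m powr (p - 1) * (\<bar>b\<bar> - m) < \<bar>b\<bar> powr p"
    using m assms by (intro powr_above_tangent; simp)+
  moreover have "p * m powr (p - 1) * (\<bar>a\<bar> - m) + p * m powr (p - 1) * (\<bar>b\<bar> - m) = 0"
    unfolding m_def by (simp add: field_simps)
  ultimately have "m powr p < (\<bar>a\<bar> powr p + \<bar>b\<bar> powr p) / 2" by simp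
  moreover have "\<bar>(a + b) / 2\<bar> powr p \<le> m powr p"
    using m assms by (intro powr_mono2) auto
  ultimately show ?thesis by simp
qed

text \<open>Jensen with equal weights \<open>1 / card A\<close>. For a chain of \<open>L\<close>
  edges the factor is \<open>L powr (p - 1)\<close>, exactly the weight that the energy gains at the
  next level.\<close>

lemma powr_sum_le:
  fixes a :: "'i \<Rightarrow> real"
  assumes "1 < p" "finite A"
  shows "\<bar>\<Sum>i\<in>A. a i\<bar> powr p \<le> real (card A) powr (p - 1) * (\<Sum>i\<in>A. \<bar>a i\<bar> powr p)"
proof (cases "A = {}")
  case False
  define n where "n = real (card A)"
  have n: "n > 0" using False assms by (simp add: n_def card_gt_0_iff)
  have "\<bar>\<Sum>i\<in>A. (1 / n) *\<^sub>R a i\<bar> powr p \<le> (\<Sum>i\<in>A. (1 / n) * \<bar>a i\<bar> powr p)"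
    by (rule convex_on_sum[OF _ _ convex_on_abs_powr]) (use assms False n in \<open>auto simp: n_def\<close>)
  then have "\<bar>\<Sum>i\<in>A. a i\<bar> powr p / n powr p \<le> (\<Sum>i\<in>A. \<bar>a i\<bar> powr p) / n"
    using n by (simp add: sum_divide_distrib[symmetric] powr_divide)
  moreover have "n powr p = n * n powr (p - 1)" using n by (simp add: powr_mult_base)
  ultimately show ?thesis using n by (simp add: field_simps n_def)
qed (use assms in auto)

lemma powr_add_le:
  fixes a b :: real
  assumes "1 < p"
  shows "\<bar>a + b\<bar> powr p \<le> 2 powr (p - 1) * (\<bar>a\<bar> powr p + \<bar>b\<bar> powr p)"
  using powr_sum_le[OF assms, of "{0,1::nat}" "\<lambda>i. if i = 0 then a else b"] by simp

text \<open>After normalising to \<open>\<bar>a\<bar>\<^sup>p + \<bar>b\<bar>\<^sup>p = 1\<close> the strict midpoint inequality has, by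
  compactness, a uniform gap where \<open>\<bar>a - b\<bar>\<^sup>p \<ge> \<epsilon>\<close>. The inequality is linear in \<open>p\<close>-th powers, so
  it is inherited by sums, integrals and limits.\<close>

lemma uniform_convexity_powr:
  fixes p \<epsilon> :: real
  assumes "1 < p" "0 < \<epsilon>"
  shows "\<exists>C\<ge>0. \<forall>a b. \<bar>a - b\<bar> powr p \<le> \<epsilon> * (\<bar>a\<bar> powr p + \<bar>b\<bar> powr p)
    + C * ((\<bar>a\<bar> powr p + \<bar>b\<bar> powr p) / 2 - \<bar>(a + b) / 2\<bar> powr p)"
proof -
  define s where "s = (\<lambda>(a::real, b::real). \<bar>a\<bar> powr p + \<bar>b\<bar> powr p)"
  define g where "g = (\<lambda>z. s z / 2 - \<bar>(fst z + snd z) / 2\<bar> powr p)"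
  define S where "S = {z. s z = 1 \<and> \<epsilon> \<le> \<bar>fst z - snd z\<bar> powr p}"
  have cont_s: "continuous_on UNIV s"
    unfolding s_def case_prod_unfold using assms
    by (intro continuous_intros continuous_on_powr') auto
  have cont_g: "continuous_on UNIV g"
    unfolding g_def using assms cont_s by (intro continuous_intros continuous_on_powr') auto
  have "closed S"
    unfolding S_def using assms cont_s
    by (intro closed_Collect_conj closed_Collect_eq closed_Collect_le continuous_intros continuous_on_powr') auto
  have le1: "\<bar>fst z\<bar> \<le> 1 \<and> \<bar>snd z\<bar> \<le> 1" if "s z = 1" for z
  proof -
    have "\<bar>fst z\<bar> powr p \<le> 1" "\<bar>snd z\<bar> powr p \<le> 1"
      using that powr_ge_zero[of "\<bar>fst z\<bar>" p] powr_ge_zero[of "\<bar>snd z\<bar>" p]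
      unfolding s_def case_prod_unfold by linarith+
    then show ?thesis using assms powr_less_mono2[of p 1 "\<bar>fst z\<bar>"] powr_less_mono2[of p 1 "\<bar>snd z\<bar>"]
      by (smt (verit) powr_one_eq_one)
  qed
  have "S \<subseteq> cbox (-1, -1) (1, 1)"
  proof
    fix z assume "z \<in> S"
    then have "\<bar>fst z\<bar> \<le> 1 \<and> \<bar>snd z\<bar> \<le> 1" using le1 by (simp add: S_def)
    then show "z \<in> cbox (-1, -1) (1, 1)" by (cases z) (auto simp: cbox_Pair_eq abs_le_iff)
  qed
  with \<open>closed S\<close> have "compact S" by (metis bounded_cbox bounded_subset compact_eq_bounded_closed)
  have g_nonneg: "0 \<le> g z" for z
    using abs_powr_midpoint_less[OF assms(1), of "fst z" "snd z"]
    unfolding g_def s_def case_prod_unfold by (cases "fst z = snd z") (auto simp: field_simps)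
  \<comment> \<open>On the compact set \<open>S\<close> the gap \<open>g\<close> attains its
    minimum, positive because the two components of a point of \<open>S\<close> differ. For empty
    \<open>S\<close> any positive \<open>m\<close> will do.\<close>
  obtain m where m: "m > 0" "\<And>z. z \<in> S \<Longrightarrow> m \<le> g z"
  proof (cases "S = {}")
    case False
    obtain z0 where z0: "z0 \<in> S" "\<forall>z\<in>S. g z0 \<le> g z"
      using continuous_attains_inf[OF \<open>compact S\<close> False] cont_g continuous_on_subset by blast
    have "fst z0 \<noteq> snd z0" using z0 assms by (auto simp: S_def)
    then have "0 < g z0" using abs_powr_midpoint_less[OF assms(1)]
      unfolding g_def s_def case_prod_unfold by force
    then show ?thesis using that z0 by blast
  qed (use that[of 1] in auto)
  \<comment> \<open>Where \<open>s z = 1\<close> the components differ by at most 2, so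
    \<open>C * g\<close> dominates the left side on \<open>S\<close>; off \<open>S\<close> the term
    \<open>\<epsilon>\<close> alone suffices.\<close>
  define C where "C = 2 powr p / m"
  have C: "C \<ge> 0" using m by (simp add: C_def)
  have unit: "\<bar>fst z - snd z\<bar> powr p \<le> \<epsilon> + C * g z" if "s z = 1" for z
  proof (cases "z \<in> S")
    case True
    have "\<bar>fst z - snd z\<bar> \<le> 2" using le1[OF that] by linarith
    then have "\<bar>fst z - snd z\<bar> powr p \<le> 2 powr p" using assms by (intro powr_mono2) auto
    also have "\<dots> = C * m" using m by (simp add: C_def)
    also have "\<dots> \<le> C * g z" using m True C by (intro mult_left_mono) auto
    finally show ?thesis using assms by simp
  next
    case False
    then have "\<bar>fst z - snd z\<bar> powr p \<le> \<epsilon>" using that by (simp add: S_def)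
    moreover have "0 \<le> C * g z" using g_nonneg C by simp
    ultimately show ?thesis by simp
  qed
  show ?thesis
  proof (intro exI[of _ C] conjI C allI)
    fix a b :: real
    define h where "h = s (a, b)"
    show "\<bar>a - b\<bar> powr p \<le> \<epsilon> * (\<bar>a\<bar> powr p + \<bar>b\<bar> powr p)
      + C * ((\<bar>a\<bar> powr p + \<bar>b\<bar> powr p) / 2 - \<bar>(a + b) / 2\<bar> powr p)"
    proof (cases "h = 0")
      case True
      then have "\<bar>a\<bar> powr p = 0" "\<bar>b\<bar> powr p = 0"
        using powr_ge_zero[of "\<bar>a\<bar>" p] powr_ge_zero[of "\<bar>b\<bar>" p]
        unfolding h_def s_def by (simp_all del: powr_ge_zero powr_eq_0_iff add: add_nonneg_eq_0_iff)
      then show ?thesis by simp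
    next
      case False
      have h: "h > 0"
        using False powr_ge_zero[of "\<bar>a\<bar>" p] powr_ge_zero[of "\<bar>b\<bar>" p] unfolding h_def s_def prod.case by linarith
      \<comment> \<open>All terms are homogeneous of degree \<open>p\<close>, so dividing by the
        \<open>p\<close>-th root of \<open>h\<close> reduces to the normalised case.\<close>
      define k where "k = h powr (1 / p)"
      have k: "k > 0" "k powr p = h" using h assms by (auto simp: k_def powr_powr)
      have "s (a / k, b / k) = 1"
        using h k unfolding s_def h_def by (simp add: powr_divide add_divide_distrib[symmetric])
      from unit[OF this] have "\<bar>a / k - b / k\<bar> powr p \<le> \<epsilon> + C * (1 / 2 - \<bar>(a / k + b / k) / 2\<bar> powr p)"
        using \<open>s (a / k, b / k) = 1\<close> by (simp add: g_def)
      moreover have "\<bar>a / k - b / k\<bar> powr p = \<bar>a - b\<bar> powr p / h"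
        using k by (simp add: diff_divide_distrib[symmetric] powr_divide)
      moreover have "\<bar>(a / k + b / k) / 2\<bar> powr p = \<bar>(a + b) / 2\<bar> powr p / h"
      proof -
        have "(a / k + b / k) / 2 = ((a + b) / 2) / k" using k by (simp add: field_simps)
        then show ?thesis using k by (simp only: abs_divide powr_divide) simp
      qed
      ultimately have "\<bar>a - b\<bar> powr p / h \<le> \<epsilon> + C * (1 / 2 - \<bar>(a + b) / 2\<bar> powr p / h)"
        by simp
      then have "\<bar>a - b\<bar> powr p / h * h \<le> (\<epsilon> + C * (1 / 2 - \<bar>(a + b) / 2\<bar> powr p / h)) * h"
        using h by (intro mult_right_mono) auto
      then have "\<bar>a - b\<bar> powr p \<le> \<epsilon> * h + C * (h / 2 - \<bar>(a + b) / 2\<bar> powr p)"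
        using h by (simp add: algebra_simps)
      then show ?thesis by (simp add: h_def s_def)
    qed
  qed
qed

section \<open>Uniformly convex functionals of power type\<close>

text \<open>The constant is chosen once and for all so that it survives limits of functionals.\<close>

definition convexity_const :: "real \<Rightarrow> real \<Rightarrow> real" where
  "convexity_const p \<epsilon> = (SOME C. 0 \<le> C \<and> (\<forall>a b. \<bar>a - b\<bar> powr p \<le> \<epsilon> * (\<bar>a\<bar> powr p + \<bar>b\<bar> powr p)
    + C * ((\<bar>a\<bar> powr p + \<bar>b\<bar> powr p) / 2 - \<bar>(a + b) / 2\<bar> powr p)))"

lemma convexity_const:
  assumes "1 < p" "0 < \<epsilon>"
  shows "0 \<le> convexity_const p \<epsilon>"
    and "\<bar>a - b\<bar> powr p \<le> \<epsilon> * (\<bar>a\<bar> powr p + \<bar>b\<bar> powr p)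
      + convexity_const p \<epsilon> * ((\<bar>a\<bar> powr p + \<bar>b\<bar> powr p) / 2 - \<bar>(a + b) / 2\<bar> powr p)"
  using someI_ex[OF uniform_convexity_powr[OF assms]] unfolding convexity_const_def by auto

text \<open>For fixed arguments each axiom is linear in \<open>\<Phi>\<close>, with constants common
  to all functionals, hence stable under nonnegative combinations, integrals and pointwise limits.
  This is the reason to work with the \<open>p\<close>-th power of a norm and not with the norm
  itself.\<close>

locale p_energy =
  fixes X :: "'v::real_vector set" and p :: real and \<Phi> :: "'v \<Rightarrow> real"
  assumes subspace: "subspace X"
    and p_gt_1: "1 < p"
    and nonneg: "x \<in> X \<Longrightarrow> 0 \<le> \<Phi> x"
    and homogeneous: "x \<in> X \<Longrightarrow> \<Phi> (c *\<^sub>R x) = \<bar>c\<bar> powr p * \<Phi> x"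
    and convex: "x \<in> X \<Longrightarrow> y \<in> X \<Longrightarrow> 0 \<le> t \<Longrightarrow> t \<le> 1 \<Longrightarrow>
      \<Phi> ((1 - t) *\<^sub>R x + t *\<^sub>R y) \<le> (1 - t) * \<Phi> x + t * \<Phi> y"
    and uniform: "x \<in> X \<Longrightarrow> y \<in> X \<Longrightarrow> 0 < \<epsilon> \<Longrightarrow>
      \<Phi> (x - y) \<le> \<epsilon> * (\<Phi> x + \<Phi> y)
        + convexity_const p \<epsilon> * ((\<Phi> x + \<Phi> y) / 2 - \<Phi> ((1/2) *\<^sub>R (x + y)))"
begin

lemmas mem_scale = subspace_scale[OF subspace]
lemmas mem_add = subspace_add[OF subspace]
lemmas mem_diff = subspace_diff[OF subspace]

definition root_norm :: "'v \<Rightarrow> real" where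
  "root_norm x = \<Phi> x powr (1 / p)"

lemma root_norm_powr: "x \<in> X \<Longrightarrow> root_norm x powr p = \<Phi> x"
  using nonneg p_gt_1 by (simp add: root_norm_def powr_powr)

lemma root_norm_le_iff: "x \<in> X \<Longrightarrow> 0 \<le> a \<Longrightarrow> root_norm x \<le> a \<longleftrightarrow> \<Phi> x \<le> a powr p"
proof -
  assume "x \<in> X" "0 \<le> a"
  have "root_norm x \<le> a \<longleftrightarrow> root_norm x powr p \<le> a powr p"
    using p_gt_1 \<open>0 \<le> a\<close> powr_mono2[of p "root_norm x" a] powr_less_mono2[of p a "root_norm x"]
    by (fastforce simp: root_norm_def not_le[symmetric])
  then show ?thesis using root_norm_powr \<open>x \<in> X\<close> by simp
qed

lemma root_norm_scale: "x \<in> X \<Longrightarrow> root_norm (c *\<^sub>R x) = \<bar>c\<bar> * root_norm x"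
  using p_gt_1 by (simp add: root_norm_def homogeneous powr_mult powr_powr)

text \<open>Minkowski's inequality from convexity of the unit ball: \<open>x + y\<close> divided by
  \<open>a + b\<close> is a convex combination of \<open>x / a\<close> and \<open>y / b\<close>,
  both in the ball.\<close>

lemma root_norm_triangle:
  assumes x: "x \<in> X" and y: "y \<in> X"
  shows "root_norm (x + y) \<le> root_norm x + root_norm y"
proof (rule field_le_epsilon)
  fix e :: real assume "e > 0"
  \<comment> \<open>The surplus \<open>e / 2\<close> keeps the divisors positive where the seminorm
    vanishes.\<close>
  define a b where "a = root_norm x + e / 2" and "b = root_norm y + e / 2"
  have ab: "a > 0" "b > 0" "root_norm x \<le> a" "root_norm y \<le> b"
    using \<open>e > 0\<close> by (auto simp: a_def b_def root_norm_def add_nonneg_pos)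
  define t where "t = b / (a + b)"
  have t: "0 \<le> t" "t \<le> 1" "1 - t = a / (a + b)"
    using ab by (auto simp: t_def field_simps)
  have unit: "\<Phi> ((1 / c) *\<^sub>R z) \<le> 1" if "z \<in> X" "c > 0" "root_norm z \<le> c" for z c
  proof -
    have "\<Phi> z \<le> c powr p" using that root_norm_le_iff[of z c] by simp
    then have "\<Phi> z / c powr p \<le> 1" using that by simp
    then show ?thesis using that by (simp add: homogeneous powr_divide)
  qed
  have eq: "(1 / (a + b)) *\<^sub>R (x + y) = (1 - t) *\<^sub>R ((1 / a) *\<^sub>R x) + t *\<^sub>R ((1 / b) *\<^sub>R y)"
    using ab unfolding t(3) by (simp add: t_def scaleR_add_right)
  have "\<Phi> ((1 / (a + b)) *\<^sub>R (x + y)) \<le> (1 - t) * \<Phi> ((1 / a) *\<^sub>R x) + t * \<Phi> ((1 / b) *\<^sub>R y)"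
    unfolding eq using t x y by (intro convex mem_scale) auto
  also have "\<dots> \<le> (1 - t) * 1 + t * 1"
    using unit ab x y t by (intro add_mono mult_left_mono) auto
  finally have "\<Phi> ((1 / (a + b)) *\<^sub>R (x + y)) \<le> 1" by simp
  then have "\<Phi> (x + y) / (a + b) powr p \<le> 1"
    using ab by (subst (asm) homogeneous[OF mem_add[OF x y]]) (simp add: powr_divide)
  then have "\<Phi> (x + y) \<le> (a + b) powr p"
    using ab by simp
  then have "root_norm (x + y) \<le> a + b"
    using root_norm_le_iff[OF mem_add[OF x y], of "a + b"] ab by simp
  then show "root_norm (x + y) \<le> root_norm x + root_norm y + e" by (simp add: a_def b_def)
qed

lemma seminorm_on_root_norm: "seminorm_on X root_norm"
  unfolding seminorm_on_def using subspace root_norm_scale root_norm_triangle by (auto simp: root_norm_def)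

text \<open>For unit vectors and a midpoint value \<open>m\<close>, the axiom \<open>uniform\<close>
  bounds \<open>\<Phi> (x - y)\<close> by twice its parameter plus a multiple of
  \<open>1 - m\<close>. With parameter \<open>\<epsilon> powr p / 4\<close>, half of the separation
  is left to push \<open>m\<close> away from 1.\<close>

lemma root_norm_small_diff:
  assumes "0 < \<epsilon>"
  shows "\<exists>\<delta>>0. \<forall>x\<in>X. \<forall>y\<in>X. root_norm x = 1 \<longrightarrow> root_norm y = 1 \<longrightarrow> \<epsilon> \<le> root_norm (x - y) \<longrightarrow>
    root_norm ((1/2) *\<^sub>R (x + y)) \<le> 1 - \<delta>"
proof -
  define C where "C = convexity_const p (\<epsilon> powr p / 4) + 1"
  have C: "C > 0" using convexity_const(1)[OF p_gt_1, of "\<epsilon> powr p / 4"] assms by (simp add: C_def)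
  \<comment> \<open>The minimum with 1 keeps \<open>1 - \<eta>\<close> nonnegative before the root
    is taken.\<close>
  define \<eta> where "\<eta> = min 1 (\<epsilon> powr p / (2 * C))"
  have \<eta>: "0 < \<eta>" "\<eta> \<le> 1" using C assms by (auto simp: \<eta>_def)
  define \<delta> where "\<delta> = 1 - (1 - \<eta>) powr (1 / p)"
  have "(1 - \<eta>) powr (1 / p) < 1"
    using \<eta> p_gt_1 powr_less_mono2[of "1 / p" "1 - \<eta>" 1] by simp
  then have "\<delta> > 0" by (simp add: \<delta>_def)
  moreover have "root_norm ((1/2) *\<^sub>R (x + y)) \<le> 1 - \<delta>"
    if x: "x \<in> X" and y: "y \<in> X" and 1: "root_norm x = 1" "root_norm y = 1" and far: "\<epsilon> \<le> root_norm (x - y)" for x y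
  proof -
    define m where "m = \<Phi> ((1/2) *\<^sub>R (x + y))"
    have "\<Phi> x = 1" "\<Phi> y = 1" using root_norm_powr[of x] root_norm_powr[of y] x y 1 by auto
    then have "\<Phi> (x - y) \<le> \<epsilon> powr p / 4 * 2 + (C - 1) * (1 - m)"
      using uniform[OF x y, of "\<epsilon> powr p / 4"] assms by (simp add: C_def m_def)
    moreover have "m \<le> 1"
      using convex[OF x y, of "1/2"] \<open>\<Phi> x = 1\<close> \<open>\<Phi> y = 1\<close> by (simp add: m_def scaleR_add_right)
    moreover have "\<epsilon> powr p \<le> \<Phi> (x - y)"
      using far assms p_gt_1 powr_mono2[of p \<epsilon> "root_norm (x - y)"] root_norm_powr[OF mem_diff[OF x y]]
      by simp
    ultimately have "\<epsilon> powr p / 2 \<le> C * (1 - m)"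
      by (simp add: algebra_simps)
    then have "\<epsilon> powr p / (2 * C) \<le> 1 - m" using C by (simp add: field_simps)
    then have "m \<le> 1 - \<eta>" by (simp add: \<eta>_def)
    moreover have "0 \<le> m" unfolding m_def by (intro nonneg mem_scale mem_add x y)
    ultimately have "m powr (1 / p) \<le> (1 - \<eta>) powr (1 / p)" using p_gt_1 by (intro powr_mono2) auto
    then show ?thesis by (simp add: m_def \<delta>_def root_norm_def)
  qed
  ultimately show ?thesis by blast
qed

lemma uniformly_convex_on_root_norm: "uniformly_convex_on X root_norm"
  unfolding uniformly_convex_on_def using root_norm_small_diff by blast

end

text \<open>The atoms of the construction: the scalar inequality is applied to \<open>f x\<close>
  and \<open>f y\<close>. Increments of a function give the energies, point evaluations the integral
  part of the norm.\<close>

lemma p_energy_abs_linear: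
  assumes "subspace X" "1 < p"
    and add: "\<And>x y. x \<in> X \<Longrightarrow> y \<in> X \<Longrightarrow> f (x + y) = f x + f y"
    and scale: "\<And>c x. x \<in> X \<Longrightarrow> f (c *\<^sub>R x) = c * (f x :: real)"
  shows "p_energy X p (\<lambda>x. \<bar>f x\<bar> powr p)"
proof
  fix x y assume xy: "x \<in> X" "y \<in> X"
  have diff: "f (x - y) = f x - f y"
    using add[OF xy(1), of "(-1) *\<^sub>R y"] scale[OF xy(2), of "-1"] subspace_scale[OF assms(1) xy(2), of "-1"]
    by simp
  have mid: "f ((1/2) *\<^sub>R (x + y)) = (f x + f y) / 2"
    using scale[OF subspace_add[OF assms(1) xy], of "1/2"] add[OF xy] by simp
  show "\<bar>f (x - y)\<bar> powr p \<le> \<epsilon> * (\<bar>f x\<bar> powr p + \<bar>f y\<bar> powr p) + convexity_const p \<epsilon>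
    * ((\<bar>f x\<bar> powr p + \<bar>f y\<bar> powr p) / 2 - \<bar>f ((1/2) *\<^sub>R (x + y))\<bar> powr p)" if "0 < \<epsilon>" for \<epsilon>
    unfolding diff mid using convexity_const(2)[OF assms(2) that] .
  show "\<bar>f ((1 - t) *\<^sub>R x + t *\<^sub>R y)\<bar> powr p \<le> (1 - t) * \<bar>f x\<bar> powr p + t * \<bar>f y\<bar> powr p"
    if "0 \<le> t" "t \<le> 1" for t
    using abs_powr_convex[OF assms(2) that] xy
    by (simp add: add scale subspace_scale[OF assms(1)])
qed (use assms in \<open>auto simp: abs_mult powr_mult\<close>)

lemma p_energy_sum:
  assumes "subspace X" "1 < p" and "\<And>i. i \<in> I \<Longrightarrow> p_energy X p (\<Phi> i)"
  shows "p_energy X p (\<lambda>x. \<Sum>i\<in>I. \<Phi> i x)"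
proof
  fix x y assume xy: "x \<in> X" "y \<in> X"
  note * = assms(3)[THEN p_energy.uniform, OF _ xy] assms(3)[THEN p_energy.convex, OF _ xy]
    assms(3)[THEN p_energy.homogeneous, OF _ xy(1)] assms(3)[THEN p_energy.nonneg, OF _ xy(1)]
  show "0 \<le> (\<Sum>i\<in>I. \<Phi> i x)" using * by (intro sum_nonneg) auto
  show "(\<Sum>i\<in>I. \<Phi> i (c *\<^sub>R x)) = \<bar>c\<bar> powr p * (\<Sum>i\<in>I. \<Phi> i x)" for c
    using * by (simp add: sum_distrib_left)
  show "(\<Sum>i\<in>I. \<Phi> i ((1 - t) *\<^sub>R x + t *\<^sub>R y)) \<le> (1 - t) * (\<Sum>i\<in>I. \<Phi> i x) + t * (\<Sum>i\<in>I. \<Phi> i y)"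
    if "0 \<le> t" "t \<le> 1" for t
    using sum_mono[of I, OF *(2)] that by (simp add: sum_distrib_left sum.distrib)
  show "(\<Sum>i\<in>I. \<Phi> i (x - y)) \<le> \<epsilon> * ((\<Sum>i\<in>I. \<Phi> i x) + (\<Sum>i\<in>I. \<Phi> i y)) + convexity_const p \<epsilon>
    * (((\<Sum>i\<in>I. \<Phi> i x) + (\<Sum>i\<in>I. \<Phi> i y)) / 2 - (\<Sum>i\<in>I. \<Phi> i ((1/2) *\<^sub>R (x + y))))" if "0 < \<epsilon>" for \<epsilon>
  proof -
    have "(\<Sum>i\<in>I. \<Phi> i (x - y)) \<le> (\<Sum>i\<in>I. \<epsilon> * (\<Phi> i x + \<Phi> i y)
      + convexity_const p \<epsilon> * ((\<Phi> i x + \<Phi> i y) / 2 - \<Phi> i ((1/2) *\<^sub>R (x + y))))"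
      by (intro sum_mono *(1) that)
    then show ?thesis
      by (simp only: sum.distrib sum_subtractf sum_distrib_left[symmetric] sum_divide_distrib[symmetric])
  qed
qed (use assms in auto)

lemma p_energy_cmult:
  assumes "p_energy X p \<Phi>" "0 \<le> k"
  shows "p_energy X p (\<lambda>x. k * \<Phi> x)"
proof -
  interpret p_energy X p \<Phi> by fact
  show ?thesis
  proof
    fix x y assume xy: "x \<in> X" "y \<in> X"
    show "k * \<Phi> ((1 - t) *\<^sub>R x + t *\<^sub>R y) \<le> (1 - t) * (k * \<Phi> x) + t * (k * \<Phi> y)"
      if "0 \<le> t" "t \<le> 1" for t
      using mult_left_mono[OF convex[OF xy that] assms(2)] by (simp add: algebra_simps)
    show "k * \<Phi> (x - y) \<le> \<epsilon> * (k * \<Phi> x + k * \<Phi> y)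
      + convexity_const p \<epsilon> * ((k * \<Phi> x + k * \<Phi> y) / 2 - k * \<Phi> ((1/2) *\<^sub>R (x + y)))" if "0 < \<epsilon>" for \<epsilon>
    proof -
      have "\<epsilon> * (k * \<Phi> x + k * \<Phi> y)
      + convexity_const p \<epsilon> * ((k * \<Phi> x + k * \<Phi> y) / 2 - k * \<Phi> ((1/2) *\<^sub>R (x + y))) =
        k * (\<epsilon> * (\<Phi> x + \<Phi> y) + convexity_const p \<epsilon> * ((\<Phi> x + \<Phi> y) / 2 - \<Phi> ((1/2) *\<^sub>R (x + y))))"
        by (simp add: algebra_simps add_divide_distrib)
      then show ?thesis using mult_left_mono[OF uniform[OF xy that] assms(2)] by presburger
    qed
  qed (use assms subspace p_gt_1 in \<open>auto simp: nonneg homogeneous\<close>)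
qed

lemma p_energy_add:
  assumes "p_energy X p \<Phi>" "p_energy X p \<Psi>"
  shows "p_energy X p (\<lambda>x. \<Phi> x + \<Psi> x)"
proof -
  have "p_energy X p (\<lambda>x. \<Sum>i\<in>UNIV. (if i then \<Phi> else \<Psi>) x)"
    using assms by (intro p_energy_sum) (auto simp: p_energy.subspace p_energy.p_gt_1)
  then show ?thesis by (simp add: UNIV_bool add.commute)
qed

text \<open>Passing to the limit in the uniform inequality requires one constant for all
  \<open>n\<close>; \<open>convexity_const\<close> depends on \<open>p\<close> and
  \<open>\<epsilon>\<close> alone.\<close>

lemma p_energy_limit:
  assumes "\<And>n. p_energy X p (\<Phi> n)" "\<And>x. x \<in> X \<Longrightarrow> (\<lambda>n::nat. \<Phi> n x) \<longlonglongrightarrow> \<Psi> x"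
  shows "p_energy X p \<Psi>"
proof -
  have sub: "subspace X" and p: "1 < p" using assms(1) by (auto simp: p_energy_def)
  show ?thesis
  proof
    fix x y assume xy: "x \<in> X" "y \<in> X"
    note [tendsto_intros] = assms(2)
    show "0 \<le> \<Psi> x" using assms xy by (intro LIMSEQ_le_const[OF assms(2)[of x]]) (auto intro: p_energy.nonneg)
    show "\<Psi> (c *\<^sub>R x) = \<bar>c\<bar> powr p * \<Psi> x" for c
    proof (rule LIMSEQ_unique)
      show "(\<lambda>n. \<Phi> n (c *\<^sub>R x)) \<longlonglongrightarrow> \<Psi> (c *\<^sub>R x)" by (intro assms(2) subspace_scale sub xy)
      show "(\<lambda>n. \<Phi> n (c *\<^sub>R x)) \<longlonglongrightarrow> \<bar>c\<bar> powr p * \<Psi> x"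
        unfolding p_energy.homogeneous[OF assms(1) xy(1)] by (intro tendsto_intros xy)
    qed
    show "\<Psi> ((1 - t) *\<^sub>R x + t *\<^sub>R y) \<le> (1 - t) * \<Psi> x + t * \<Psi> y" if "0 \<le> t" "t \<le> 1" for t
    proof (rule LIMSEQ_le)
      show "(\<lambda>n. \<Phi> n ((1 - t) *\<^sub>R x + t *\<^sub>R y)) \<longlonglongrightarrow> \<Psi> ((1 - t) *\<^sub>R x + t *\<^sub>R y)"
        by (intro assms(2) subspace_add subspace_scale sub xy)
      show "(\<lambda>n. (1 - t) * \<Phi> n x + t * \<Phi> n y) \<longlonglongrightarrow> (1 - t) * \<Psi> x + t * \<Psi> y"
        by (intro tendsto_intros xy)
    qed (use p_energy.convex[OF assms(1) xy that] in auto)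
    show "\<Psi> (x - y) \<le> \<epsilon> * (\<Psi> x + \<Psi> y)
        + convexity_const p \<epsilon> * ((\<Psi> x + \<Psi> y) / 2 - \<Psi> ((1/2) *\<^sub>R (x + y)))" if "0 < \<epsilon>" for \<epsilon>
    proof (rule LIMSEQ_le)
      show "(\<lambda>n. \<Phi> n (x - y)) \<longlonglongrightarrow> \<Psi> (x - y)"
        by (intro assms(2) subspace_diff sub xy)
      show "(\<lambda>n. \<epsilon> * (\<Phi> n x + \<Phi> n y)
        + convexity_const p \<epsilon> * ((\<Phi> n x + \<Phi> n y) / 2 - \<Phi> n ((1/2) *\<^sub>R (x + y)))) \<longlonglongrightarrow>
          \<epsilon> * (\<Psi> x + \<Psi> y)
        + convexity_const p \<epsilon> * ((\<Psi> x + \<Psi> y) / 2 - \<Psi> ((1/2) *\<^sub>R (x + y)))"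
        by (intro tendsto_intros xy subspace_add subspace_scale sub) auto
    qed (use p_energy.uniform[OF assms(1) xy that] in auto)
  qed (use sub p in auto)
qed

lemma p_energy_subspace:
  assumes "p_energy X p \<Phi>" "subspace Y" "Y \<subseteq> X"
  shows "p_energy Y p \<Phi>"
proof -
  interpret p_energy X p \<Phi> by fact
  show ?thesis
    by standard (use assms p_gt_1 nonneg homogeneous convex uniform in \<open>auto simp: subset_iff\<close>)
qed

lemma p_energy_integral:
  assumes "subspace X" "1 < p"
    and "\<And>z. z \<in> space M \<Longrightarrow> p_energy X p (\<lambda>x. \<Phi> x z)"
    and int: "\<And>x. x \<in> X \<Longrightarrow> integrable M (\<Phi> x)"
  shows "p_energy X p (\<lambda>x. \<integral>z. \<Phi> x z \<partial>M)"
proof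
  fix x y assume xy: "x \<in> X" "y \<in> X"
  note * = assms(3)[THEN p_energy.uniform, OF _ xy] assms(3)[THEN p_energy.convex, OF _ xy]
    assms(3)[THEN p_energy.homogeneous, OF _ xy(1)] assms(3)[THEN p_energy.nonneg, OF _ xy(1)]
  note mem = subspace_add[OF assms(1)] subspace_scale[OF assms(1)] subspace_diff[OF assms(1)]
  show "0 \<le> (\<integral>z. \<Phi> x z \<partial>M)" using * by (intro integral_nonneg_AE) auto
  show "(\<integral>z. \<Phi> (c *\<^sub>R x) z \<partial>M) = \<bar>c\<bar> powr p * (\<integral>z. \<Phi> x z \<partial>M)" for c
  proof -
    have "(\<integral>z. \<Phi> (c *\<^sub>R x) z \<partial>M) = (\<integral>z. \<bar>c\<bar> powr p * \<Phi> x z \<partial>M)"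
      using * by (intro Bochner_Integration.integral_cong) auto
    then show ?thesis by simp
  qed
  show "(\<integral>z. \<Phi> ((1 - t) *\<^sub>R x + t *\<^sub>R y) z \<partial>M) \<le> (1 - t) * (\<integral>z. \<Phi> x z \<partial>M) + t * (\<integral>z. \<Phi> y z \<partial>M)"
    if "0 \<le> t" "t \<le> 1" for t
  proof -
    have "(\<integral>z. \<Phi> ((1 - t) *\<^sub>R x + t *\<^sub>R y) z \<partial>M) \<le> (\<integral>z. (1 - t) * \<Phi> x z + t * \<Phi> y z \<partial>M)"
      using that by (intro integral_mono *(2) Bochner_Integration.integrable_add integrable_mult_right int mem xy)
    then show ?thesis using int xy by simp
  qed
  show "(\<integral>z. \<Phi> (x - y) z \<partial>M) \<le> \<epsilon> * ((\<integral>z. \<Phi> x z \<partial>M) + (\<integral>z. \<Phi> y z \<partial>M)) + convexity_const p \<epsilon>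
    * (((\<integral>z. \<Phi> x z \<partial>M) + (\<integral>z. \<Phi> y z \<partial>M)) / 2 - (\<integral>z. \<Phi> ((1/2) *\<^sub>R (x + y)) z \<partial>M))" if "0 < \<epsilon>" for \<epsilon>
  proof -
    have i: "integrable M (\<Phi> x)" "integrable M (\<Phi> y)" "integrable M (\<Phi> ((1/2) *\<^sub>R (x + y)))"
      by (intro int mem xy)+
    have "(\<integral>z. \<Phi> (x - y) z \<partial>M) \<le> (\<integral>z. \<epsilon> * (\<Phi> x z + \<Phi> y z)
      + convexity_const p \<epsilon> * ((\<Phi> x z + \<Phi> y z) / 2 - \<Phi> ((1/2) *\<^sub>R (x + y)) z) \<partial>M)"
      using that i by (intro integral_mono *(1) Bochner_Integration.integrable_add Bochner_Integration.integrable_diff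
          integrable_mult_right integrable_divide int mem xy)
    then show ?thesis using i by simp
  qed
qed (use assms in auto)

section \<open>Uniformly convex Banach spaces\<close>

lemma normed_space_onD:
  assumes "normed_space_on X N"
  shows "subspace X" "x \<in> X \<Longrightarrow> 0 \<le> N x" "x \<in> X \<Longrightarrow> N (c *\<^sub>R x) = \<bar>c\<bar> * N x"
    "x \<in> X \<Longrightarrow> y \<in> X \<Longrightarrow> N (x + y) \<le> N x + N y" "x \<in> X \<Longrightarrow> N x = 0 \<Longrightarrow> x = 0" "N 0 = 0"
    "x \<in> X \<Longrightarrow> y \<in> X \<Longrightarrow> N (x - y) = N (y - x)"
proof -
  show sub: "subspace X" and scale: "\<And>x c. x \<in> X \<Longrightarrow> N (c *\<^sub>R x) = \<bar>c\<bar> * N x"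
    using assms by (auto simp: normed_space_on_def seminorm_on_def)
  show "N 0 = 0" using scale[OF subspace_0[OF sub], of 0] by simp
  show "x \<in> X \<Longrightarrow> y \<in> X \<Longrightarrow> N (x - y) = N (y - x)"
    using scale[of "y - x" "-1"] subspace_diff[OF sub] by simp
qed (use assms in \<open>auto simp: normed_space_on_def seminorm_on_def\<close>)

lemma Metric_space_norm_dist:
  assumes "normed_space_on X N"
  shows "Metric_space X (norm_dist X N)"
proof
  note N = normed_space_onD[OF assms]
  show "0 \<le> norm_dist X N x y" for x y
    using N(2)[OF subspace_diff[OF N(1)]] by (simp add: norm_dist_def)
  show "norm_dist X N x y = norm_dist X N y x" for x y
    using N(7) by (simp add: norm_dist_def)
  show "norm_dist X N x y = 0 \<longleftrightarrow> x = y" if "x \<in> X" "y \<in> X" for x y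
    using that N(5)[OF subspace_diff[OF N(1)], of x y] N(6) by (auto simp: norm_dist_def)
  show "norm_dist X N x z \<le> norm_dist X N x y + norm_dist X N y z" if "x \<in> X" "y \<in> X" "z \<in> X" for x y z
    using that N(4)[OF subspace_diff[OF N(1), of x y] subspace_diff[OF N(1), of y z]]
    by (simp add: norm_dist_def)
qed

text \<open>Restates completeness through \<open>N\<close> alone, free of the value 0 that
  \<open>norm_dist\<close> takes outside the carrier.\<close>

lemma mcomplete_norm_dist_iff:
  assumes "normed_space_on X N"
  shows "Metric_space.mcomplete X (norm_dist X N) \<longleftrightarrow>
    (\<forall>s::nat \<Rightarrow> _. (\<forall>n. s n \<in> X) \<longrightarrow> (\<forall>e>0. \<exists>k. \<forall>m\<ge>k. \<forall>n\<ge>k. N (s m - s n) < e) \<longrightarrow>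
      (\<exists>x\<in>X. \<forall>e>0. \<exists>k. \<forall>n\<ge>k. N (s n - x) < e))"
proof -
  interpret Metric_space X "norm_dist X N" by (rule Metric_space_norm_dist[OF assms])
  have cauchy: "MCauchy s \<longleftrightarrow> (\<forall>n. s n \<in> X) \<and> (\<forall>e>0. \<exists>k. \<forall>m\<ge>k. \<forall>n\<ge>k. N (s m - s n) < e)" for s
    unfolding MCauchy_def by (auto simp: norm_dist_def image_subset_iff)
  have lim: "limitin mtopology s x sequentially \<longleftrightarrow> x \<in> X \<and> (\<forall>e>0. \<exists>k. \<forall>n\<ge>k. N (s n - x) < e)"
    if "\<forall>n. s n \<in> X" for s x
    using that unfolding limit_metric_sequentially by (auto simp: norm_dist_def)
  have "(MCauchy s \<longrightarrow> (\<exists>x. limitin mtopology s x sequentially)) \<longleftrightarrow>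
    ((\<forall>n. s n \<in> X) \<longrightarrow> (\<forall>e>0. \<exists>k. \<forall>m\<ge>k. \<forall>n\<ge>k. N (s m - s n) < e) \<longrightarrow>
      (\<exists>x\<in>X. \<forall>e>0. \<exists>k. \<forall>n\<ge>k. N (s n - x) < e))" for s
  proof (cases "\<forall>n. s n \<in> X")
    case True
    show ?thesis unfolding cauchy lim[OF True] Bex_def using True by simp
  next
    case False
    then show ?thesis unfolding cauchy by blast
  qed
  then show ?thesis unfolding mcomplete_def by (simp only:)
qed

lemma closure_of_norm_topology:
  assumes "normed_space_on X N" "S \<subseteq> X"
  shows "norm_topology X N closure_of S = {x \<in> X. \<forall>e>0. \<exists>y\<in>S. N (x - y) < e}"
proof -
  interpret Metric_space X "norm_dist X N" by (rule Metric_space_norm_dist[OF assms(1)])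
  show ?thesis unfolding norm_topology_def metric_closure_of using assms(2)
    by (auto simp: norm_dist_def subset_iff) 
qed

lemma topspace_norm_topology:
  assumes "normed_space_on X N"
  shows "topspace (norm_topology X N) = X"
proof -
  interpret Metric_space X "norm_dist X N" by (rule Metric_space_norm_dist[OF assms(1)])
  show ?thesis by (simp add: norm_topology_def)
qed

context
  fixes X :: "'v::real_vector set" and N
  assumes normed: "normed_space_on X N"
begin

lemma dual_spaceD:
  assumes "f \<in> dual_space X N"
  shows "x \<in> X \<Longrightarrow> y \<in> X \<Longrightarrow> f (x + y) = f x + f y" "x \<in> X \<Longrightarrow> f (c *\<^sub>R x) = c * f x"
    "x \<in> X \<Longrightarrow> y \<in> X \<Longrightarrow> f (x - y) = f x - f y"
proof -
  show add: "\<And>x y. x \<in> X \<Longrightarrow> y \<in> X \<Longrightarrow> f (x + y) = f x + f y"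
    and scale: "\<And>x c. x \<in> X \<Longrightarrow> f (c *\<^sub>R x) = c * f x"
    using assms by (auto simp: dual_space_def)
  show "x \<in> X \<Longrightarrow> y \<in> X \<Longrightarrow> f (x - y) = f x - f y"
    using add[of x "(-1) *\<^sub>R y"] scale[of y "-1"] subspace_scale[OF normed_space_onD(1)[OF normed], of y "-1"]
    by simp
qed

lemma bdd_above_dual_norm:
  assumes "f \<in> dual_space X N"
  shows "bdd_above ((\<lambda>x. \<bar>f x\<bar>) ` {x \<in> X. N x \<le> 1})"
proof -
  obtain B where B: "\<forall>x\<in>X. \<bar>f x\<bar> \<le> B * N x" using assms by (auto simp: dual_space_def)
  have "\<bar>f x\<bar> \<le> \<bar>B\<bar>" if "x \<in> X" "N x \<le> 1" for x
  proof -
    have "\<bar>f x\<bar> \<le> B * N x" using B that by blast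
    also have "\<dots> \<le> \<bar>B\<bar> * 1" using that normed_space_onD(2)[OF normed] by (intro mult_mono) auto
    finally show ?thesis by simp
  qed
  then show ?thesis by (auto intro!: bdd_aboveI)
qed

lemma dual_norm_nonneg:
  assumes "f \<in> dual_space X N"
  shows "0 \<le> dual_norm X N f"
proof -
  have "0 \<in> {x \<in> X. N x \<le> 1}"
    using subspace_0[OF normed_space_onD(1)[OF normed]] normed_space_onD(6)[OF normed] by simp
  then have "\<bar>f 0\<bar> \<le> dual_norm X N f"
    unfolding dual_norm_def by (intro cSUP_upper bdd_above_dual_norm assms)
  then show ?thesis by linarith
qed

lemma dual_norm_bound:
  assumes "f \<in> dual_space X N" "x \<in> X"
  shows "\<bar>f x\<bar> \<le> dual_norm X N f * N x"
proof (cases "N x = 0")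
  case True
  obtain B where B: "\<forall>x\<in>X. \<bar>f x\<bar> \<le> B * N x" using assms by (auto simp: dual_space_def)
  with True assms have "\<bar>f x\<bar> \<le> 0" by fastforce
  then show ?thesis using True by simp
next
  case False
  then have pos: "N x > 0" using normed_space_onD(2)[OF normed assms(2)] by simp
  have "\<bar>f ((1 / N x) *\<^sub>R x)\<bar> \<le> dual_norm X N f"
    unfolding dual_norm_def
    by (intro cSUP_upper bdd_above_dual_norm assms)
      (use pos normed_space_onD(3)[OF normed assms(2)] subspace_scale[OF normed_space_onD(1)[OF normed]] assms in auto)
  then show ?thesis using pos by (simp add: dual_spaceD(2)[OF assms] field_simps abs_mult)
qed

lemma dual_norm_leI:
  assumes "\<And>x. x \<in> X \<Longrightarrow> N x \<le> 1 \<Longrightarrow> \<bar>f x\<bar> \<le> B"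
  shows "dual_norm X N f \<le> B"
  unfolding dual_norm_def
  by (rule cSUP_least)
    (use assms subspace_0[OF normed_space_onD(1)[OF normed]] normed_space_onD(6)[OF normed] in auto)

text \<open>A vector of norm at most 1 that nearly attains the supremum is rescaled to norm exactly
  1, which only increases the absolute value, and its sign is adjusted. Norm exactly 1 is what
  uniform convexity is stated for.\<close>

lemma dual_norm_near_max:
  assumes f: "f \<in> dual_space X N" and "0 \<le> r" "r < dual_norm X N f"
  obtains x where "x \<in> X" "N x = 1" "r < f x"
proof -
  obtain z where z: "z \<in> X" "N z \<le> 1" "r < \<bar>f z\<bar>"
    using dual_norm_leI[of f r] assms(3) by (meson not_le)
  have "N z > 0"
  proof (rule ccontr)
    assume "\<not> N z > 0"
    then have "z = 0" using normed_space_onD(2,5)[OF normed z(1)] by force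
    then have "f z = 0" using dual_spaceD(2)[OF f z(1), of 0] by simp
    then show False using z assms by simp
  qed
  define x where "x = (sgn (f z) / N z) *\<^sub>R z"
  have "\<bar>f z\<bar> \<le> \<bar>f z\<bar> / N z" using z \<open>N z > 0\<close> by (simp add: divide_simps mult_left_le)
  then have "r < f x" unfolding x_def using z by (simp add: dual_spaceD(2)[OF f] abs_sgn mult.commute)
  moreover have "N x = 1"
    unfolding x_def using \<open>N z > 0\<close> z assms(2) by (auto simp: normed_space_onD(3)[OF normed] sgn_if)
  moreover have "x \<in> X" unfolding x_def using z normed_space_onD(1)[OF normed] by (simp add: subspace_scale)
  ultimately show ?thesis using that by blast
qed

lemma subspace_dual_space: "subspace (dual_space X N)"
proof (rule subspaceI)
  show "0 \<in> dual_space X N"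
    unfolding dual_space_def by (auto intro: exI[of _ 0])
next
  fix f g assume fg: "f \<in> dual_space X N" "g \<in> dual_space X N"
  have "\<bar>(f + g) x\<bar> \<le> (dual_norm X N f + dual_norm X N g) * N x" if "x \<in> X" for x
    using dual_norm_bound[OF fg(1) that] dual_norm_bound[OF fg(2) that] by (simp add: distrib_right)
  then have "\<exists>B. \<forall>x\<in>X. \<bar>f x + g x\<bar> \<le> B * N x" by auto
  then show "f + g \<in> dual_space X N"
    using fg unfolding dual_space_def by (auto simp: distrib_left)
next
  fix f and c :: real assume f: "f \<in> dual_space X N"
  have "\<bar>(c *\<^sub>R f) x\<bar> \<le> (\<bar>c\<bar> * dual_norm X N f) * N x" if "x \<in> X" for x
    using mult_left_mono[OF dual_norm_bound[OF f that], of "\<bar>c\<bar>"] by (simp add: scaleR_fun_def mult.assoc abs_mult)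
  then have "\<exists>B. \<forall>x\<in>X. \<bar>c * f x\<bar> \<le> B * N x" by (auto simp: scaleR_fun_def)
  then show "c *\<^sub>R f \<in> dual_space X N"
    using f unfolding dual_space_def by (auto simp: scaleR_fun_def algebra_simps)
qed

lemma dual_norm_scale:
  assumes "f \<in> dual_space X N"
  shows "dual_norm X N (c *\<^sub>R f) \<le> \<bar>c\<bar> * dual_norm X N f"
proof (rule dual_norm_leI)
  fix x assume "x \<in> X" "N x \<le> 1"
  then have "\<bar>f x\<bar> \<le> dual_norm X N f"
    using dual_norm_bound[OF assms] dual_norm_nonneg[OF assms] by (meson mult_left_le order_trans)
  then show "\<bar>(c *\<^sub>R f) x\<bar> \<le> \<bar>c\<bar> * dual_norm X N f"
    by (simp add: scaleR_fun_def abs_mult mult_left_mono)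
qed

end

text \<open>Milman--Pettis without Hahn--Banach. If \<open>\<Phi>\<close> is a unit functional on the dual, \<open>\<Phi> f\<close> is close
  to \<open>1\<close> and \<open>x\<close> nearly maximises \<open>f\<close>, then comparing with a near-maximiser \<open>y\<close> of \<open>f + t g\<close> gives
  \<open>\<Phi> g \<le> g y + O(\<delta> / t)\<close>, while uniform convexity forces \<open>y\<close> to be close to \<open>x\<close>.\<close>

lemma bidual_unit_approx:
  fixes X :: "'v::real_vector set"
  assumes normed: "normed_space_on X N" and uc: "uniformly_convex_on X N" and "0 < \<epsilon>"
    and add: "\<And>f g. f \<in> dual_space X N \<Longrightarrow> g \<in> dual_space X N \<Longrightarrow> \<Phi> (f + g) = \<Phi> f + \<Phi> g"
    and scale: "\<And>f c. f \<in> dual_space X N \<Longrightarrow> \<Phi> (c *\<^sub>R f) = c * \<Phi> f"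
    and bound: "\<And>f. f \<in> dual_space X N \<Longrightarrow> \<bar>\<Phi> f\<bar> \<le> dual_norm X N f"
    and unit: "\<And>\<delta>. 0 < \<delta> \<Longrightarrow> \<exists>f\<in>dual_space X N. dual_norm X N f \<le> 1 \<and> 1 - \<delta> < \<Phi> f"
  shows "\<exists>x\<in>X. N x = 1 \<and> (\<forall>g\<in>dual_space X N. dual_norm X N g \<le> 1 \<longrightarrow> \<bar>\<Phi> g - g x\<bar> \<le> \<epsilon>)"
proof -
  let ?D = "dual_space X N" and ?n = "dual_norm X N"
  note mem = subspace_add[OF normed_space_onD(1)[OF normed]] subspace_scale[OF normed_space_onD(1)[OF normed]]
    subspace_diff[OF normed_space_onD(1)[OF normed]]
  note Dmem = subspace_add[OF subspace_dual_space[OF normed]] subspace_scale[OF subspace_dual_space[OF normed]]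
  obtain \<delta>0 where \<delta>0: "\<delta>0 > 0" "\<And>x y. x \<in> X \<Longrightarrow> y \<in> X \<Longrightarrow> N x = 1 \<Longrightarrow> N y = 1 \<Longrightarrow>
      \<epsilon> / 2 \<le> N (x - y) \<Longrightarrow> N ((1/2) *\<^sub>R (x + y)) \<le> 1 - \<delta>0"
    using uc \<open>0 < \<epsilon>\<close> half_gt_zero unfolding uniformly_convex_on_def by metis
  \<comment> \<open>Three demands: \<open>(3 * \<delta> + 2 * t) / 2 \<le> \<delta>0\<close> lets
    uniform convexity apply to \<open>x\<close> and \<open>y\<close>;
    \<open>2 * \<delta> \<le> t * (\<epsilon> / 2)\<close> keeps the error small after division by
    \<open>t\<close>; the bounds 1/4 keep the levels to be exceeded by near-maximisers
    nonnegative.\<close>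
  define t where "t = min (1/4) (\<delta>0 / 2)"
  define \<delta> where "\<delta> = min (1/4) (min (\<delta>0 / 3) (t * \<epsilon> / 4))"
  have t: "0 < t" "t \<le> 1/4" "2 * t \<le> \<delta>0" using \<delta>0 by (auto simp: t_def)
  have \<delta>: "0 < \<delta>" "\<delta> \<le> 1/4" "3 * \<delta> \<le> \<delta>0" "2 * \<delta> \<le> t * (\<epsilon> / 2)" using \<delta>0 t \<open>0 < \<epsilon>\<close> by (auto simp: \<delta>_def)
  obtain f where f: "f \<in> ?D" "?n f \<le> 1" "1 - \<delta> < \<Phi> f" using unit[OF \<delta>(1)] by blast
  have "1 - \<delta> < ?n f" using bound[OF f(1)] f(3) by linarith
  then obtain x where x: "x \<in> X" "N x = 1" "1 - \<delta> < f x"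
    using dual_norm_near_max[OF normed f(1), of "1 - \<delta>"] \<delta> by auto
  have upper: "\<Phi> g \<le> g x + \<epsilon>" if g: "g \<in> ?D" "?n g \<le> 1" for g
  proof -
    define h where "h = f + t *\<^sub>R g"
    have h: "h \<in> ?D" unfolding h_def by (intro Dmem f g)
    have \<Phi>h: "\<Phi> h = \<Phi> f + t * \<Phi> g" unfolding h_def using f g by (simp add: add scale Dmem)
    have \<Phi>g: "\<bar>\<Phi> g\<bar> \<le> 1" using bound[OF g(1)] g(2) by linarith
    have "\<bar>t * \<Phi> g\<bar> \<le> t * 1" using \<Phi>g t by (simp only: abs_mult) (intro mult_mono; simp)
    then have tg: "\<bar>t * \<Phi> g\<bar> \<le> t" by simp
    have h_le: "\<Phi> h \<le> ?n h" using bound[OF h] by linarith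
    have "0 \<le> \<Phi> h - \<delta>" using \<Phi>h tg f t \<delta> by linarith
    then obtain y where y: "y \<in> X" "N y = 1" "\<Phi> h - \<delta> < h y"
      using dual_norm_near_max[OF normed h, of "\<Phi> h - \<delta>"] h_le \<delta> by auto
    have hy: "h y = f y + t * g y" by (simp add: h_def scaleR_fun_def)
    have "\<bar>f y\<bar> \<le> 1" using dual_norm_bound[OF normed f(1) y(1)] f(2) y(2) by simp
    have gy: "\<bar>g y\<bar> \<le> 1" using dual_norm_bound[OF normed g(1) y(1)] g(2) y(2) by simp
    have "\<bar>t * g y\<bar> \<le> t * 1" using gy t by (simp only: abs_mult) (intro mult_mono; simp)
    then have tgy: "\<bar>t * g y\<bar> \<le> t" by simp
    \<comment> \<open>The functional \<open>h\<close> is nearly maximal at \<open>y\<close> and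
      \<open>t g\<close> is small, so \<open>f\<close> is nearly maximal at \<open>y\<close> as well
      as at \<open>x\<close>; the midpoint then has norm close to 1.\<close>
    have "1 - 2 * \<delta> - 2 * t < f y" using y(3) hy \<Phi>h f(3) tg tgy by linarith
    then have "1 - \<delta>0 < (f x + f y) / 2" using x(3) \<delta> t by (simp add: field_simps)
    also have "\<dots> = f ((1/2) *\<^sub>R (x + y))"
      using x y by (simp add: dual_spaceD[OF normed f(1)] mem)
    also have "\<dots> \<le> N ((1/2) *\<^sub>R (x + y))"
    proof -
      have "\<bar>f ((1/2) *\<^sub>R (x + y))\<bar> \<le> ?n f * N ((1/2) *\<^sub>R (x + y))"
        by (intro dual_norm_bound[OF normed f(1)] mem x y)
      also have "\<dots> \<le> 1 * N ((1/2) *\<^sub>R (x + y))"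
        by (intro mult_right_mono f normed_space_onD(2)[OF normed] mem x y)
      finally show ?thesis by simp
    qed
    finally have "N (x - y) < \<epsilon> / 2" using \<delta>0(2)[OF x(1) y(1) x(2) y(2)] by linarith
    have "\<bar>g (x - y)\<bar> \<le> ?n g * N (x - y)" by (intro dual_norm_bound[OF normed g(1)] mem x y)
    also have "\<dots> \<le> 1 * N (x - y)" by (intro mult_right_mono g normed_space_onD(2)[OF normed] mem x y)
    finally have "\<bar>g x - g y\<bar> \<le> \<epsilon> / 2"
      using \<open>N (x - y) < \<epsilon> / 2\<close> by (simp add: dual_spaceD(3)[OF normed g(1) x(1) y(1)])
    \<comment> \<open>Since \<open>f y \<le> 1 < \<Phi> f + \<delta>\<close>, the contributions of
      \<open>f\<close> cancel up to \<open>\<delta>\<close>; the second \<open>\<delta>\<close> is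
      the defect of \<open>y\<close> as a maximiser.\<close>
    have "t * \<Phi> g < t * g y + 2 * \<delta>" using y(3) hy \<Phi>h f(3) \<open>\<bar>f y\<bar> \<le> 1\<close> by linarith
    also have "\<dots> \<le> t * (g y + \<epsilon> / 2)" using \<delta>(4) by (simp add: algebra_simps)
    finally have "\<Phi> g < g y + \<epsilon> / 2" using t by simp
    then show ?thesis using \<open>\<bar>g x - g y\<bar> \<le> \<epsilon> / 2\<close> by linarith
  qed
  have "\<bar>\<Phi> g - g x\<bar> \<le> \<epsilon>" if g: "g \<in> ?D" "?n g \<le> 1" for g
  proof -
    have "(-1) *\<^sub>R g \<in> ?D" "?n ((-1) *\<^sub>R g) \<le> 1"
      using Dmem(2)[OF g(1), of "-1"] dual_norm_scale[OF normed g(1), of "-1"] g(2) by auto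
    from upper[OF this] scale[OF g(1), of "-1"] upper[OF g] show ?thesis
      by (simp add: scaleR_fun_def)
  qed
  then show ?thesis using x by blast
qed

text \<open>Approximate representers \<open>s n\<close> with error \<open>1 / Suc n\<close> on the
  dual unit ball form a Cauchy sequence: a single \<open>f\<close> with \<open>\<Phi> f\<close> near
  1 is near 1 at all late \<open>s n\<close>, so their midpoints have norm near 1 and uniform
  convexity brings them together. Completeness supplies the limit.\<close>

lemma bidual_unit_represented:
  fixes X :: "'v::real_vector set"
  assumes banach: "banach_space_on X N" and uc: "uniformly_convex_on X N"
    and add: "\<And>f g. f \<in> dual_space X N \<Longrightarrow> g \<in> dual_space X N \<Longrightarrow> \<Phi> (f + g) = \<Phi> f + \<Phi> g"
    and scale: "\<And>f c. f \<in> dual_space X N \<Longrightarrow> \<Phi> (c *\<^sub>R f) = c * \<Phi> f"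
    and bound: "\<And>f. f \<in> dual_space X N \<Longrightarrow> \<bar>\<Phi> f\<bar> \<le> dual_norm X N f"
    and unit: "\<And>\<delta>. 0 < \<delta> \<Longrightarrow> \<exists>f\<in>dual_space X N. dual_norm X N f \<le> 1 \<and> 1 - \<delta> < \<Phi> f"
  shows "\<exists>x\<in>X. \<forall>f\<in>dual_space X N. \<Phi> f = f x"
proof -
  let ?D = "dual_space X N" and ?n = "dual_norm X N"
  have normed: "normed_space_on X N" and "Metric_space.mcomplete X (norm_dist X N)"
    using banach by (auto simp: banach_space_on_def)
  note complete = mcomplete_norm_dist_iff[OF normed, THEN iffD1, OF this(2), rule_format]
  note mem = subspace_add[OF normed_space_onD(1)[OF normed]] subspace_scale[OF normed_space_onD(1)[OF normed]]
    subspace_diff[OF normed_space_onD(1)[OF normed]]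
  have "\<forall>n. \<exists>x\<in>X. N x = 1 \<and> (\<forall>g\<in>?D. ?n g \<le> 1 \<longrightarrow> \<bar>\<Phi> g - g x\<bar> \<le> 1 / real (Suc n))"
    by (intro allI bidual_unit_approx[OF normed uc _ add scale bound unit]) simp_all
  then obtain s where s: "\<And>n. s n \<in> X" "\<And>n. N (s n) = 1"
    "\<And>n g. g \<in> ?D \<Longrightarrow> ?n g \<le> 1 \<Longrightarrow> \<bar>\<Phi> g - g (s n)\<bar> \<le> 1 / real (Suc n)"
    by metis
  have "\<exists>k. \<forall>m\<ge>k. \<forall>n\<ge>k. N (s m - s n) < e" if "e > 0" for e
  proof -
    obtain \<delta> where \<delta>: "\<delta> > 0" "\<And>x y. x \<in> X \<Longrightarrow> y \<in> X \<Longrightarrow> N x = 1 \<Longrightarrow> N y = 1 \<Longrightarrow>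
      e \<le> N (x - y) \<Longrightarrow> N ((1/2) *\<^sub>R (x + y)) \<le> 1 - \<delta>"
      using uc \<open>0 < e\<close> unfolding uniformly_convex_on_def by metis
    obtain f where f: "f \<in> ?D" "?n f \<le> 1" "1 - \<delta> / 2 < \<Phi> f" using unit[of "\<delta> / 2"] \<delta> by auto
    obtain k where k: "1 / real (Suc k) < \<delta> / 2" using \<delta> nat_approx_posE[of "\<delta> / 2"] by auto
    have near: "1 - \<delta> < f (s n)" if "n \<ge> k" for n
    proof -
      have "1 / real (Suc n) \<le> 1 / real (Suc k)" using that by (intro divide_left_mono) auto
      then show ?thesis using s(3)[OF f(1,2), of n] k f(3) by linarith
    qed
    have "N (s m - s n) < e" if "m \<ge> k" "n \<ge> k" for m n
    proof -
      have "1 - \<delta> < (f (s m) + f (s n)) / 2" using near[OF that(1)] near[OF that(2)] by simp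
      also have "\<dots> = f ((1/2) *\<^sub>R (s m + s n))"
        using s by (simp add: dual_spaceD[OF normed f(1)] mem)
      also have "\<dots> \<le> ?n f * N ((1/2) *\<^sub>R (s m + s n))"
        using dual_norm_bound[OF normed f(1), of "(1/2) *\<^sub>R (s m + s n)"] s by (simp add: mem)
      also have "\<dots> \<le> 1 * N ((1/2) *\<^sub>R (s m + s n))"
        by (intro mult_right_mono f normed_space_onD(2)[OF normed] mem s)
      finally show ?thesis using \<delta>(2)[OF s(1) s(1) s(2) s(2), of m n] by linarith
    qed
    then show ?thesis by blast
  qed
  then obtain x where x: "x \<in> X" "\<And>e. e > 0 \<Longrightarrow> \<exists>k. \<forall>n\<ge>k. N (s n - x) < e"
    using complete[of s] s(1) by metis
  have unit_eq: "\<Phi> g = g x" if g: "g \<in> ?D" "?n g \<le> 1" for g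
  proof -
    have "\<bar>\<Phi> g - g x\<bar> \<le> 0"
    proof (rule field_le_epsilon)
      fix e :: real assume "e > 0"
      obtain k where k: "\<forall>n\<ge>k. N (s n - x) < e / 2" using x(2)[of "e / 2"] \<open>e > 0\<close> by auto
      obtain j where j: "1 / real (Suc j) < e / 2" using \<open>e > 0\<close> nat_approx_posE[of "e / 2"] by auto
      define n where "n = max j k"
      have "1 / real (Suc n) \<le> 1 / real (Suc j)" by (intro divide_left_mono) (auto simp: n_def)
      then have "\<bar>\<Phi> g - g (s n)\<bar> \<le> e / 2" using s(3)[OF g, of n] j by linarith
      moreover have "\<bar>g (s n - x)\<bar> \<le> ?n g * N (s n - x)"
        by (intro dual_norm_bound[OF normed g(1)] mem s x)
      moreover have "?n g * N (s n - x) \<le> 1 * N (s n - x)"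
        by (intro mult_right_mono g normed_space_onD(2)[OF normed] mem s x)
      moreover have "N (s n - x) < e / 2" using k by (simp add: n_def)
      ultimately show "\<bar>\<Phi> g - g x\<bar> \<le> 0 + e"
        unfolding dual_spaceD(3)[OF normed g(1) s(1) x(1)] by linarith
    qed
    then show ?thesis by simp
  qed
  have "\<Phi> f = f x" if f: "f \<in> ?D" for f
  proof -
    \<comment> \<open>Any scaling into the unit ball serves; the added 1 covers functionals of dual
      norm 0.\<close>
    define c where "c = 1 / (?n f + 1)"
    have c: "c > 0" "c * ?n f \<le> 1"
      using dual_norm_nonneg[OF normed f] by (auto simp: c_def field_simps)
    have "?n (c *\<^sub>R f) \<le> 1" using dual_norm_scale[OF normed f, of c] c by simp
    then have "\<Phi> (c *\<^sub>R f) = (c *\<^sub>R f) x"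
      by (intro unit_eq subspace_scale[OF subspace_dual_space[OF normed]] f)
    then have "c * \<Phi> f = c * f x" unfolding scale[OF f] by (simp add: scaleR_fun_def)
    then show ?thesis using c by simp
  qed
  then show ?thesis using x by blast
qed

text \<open>Only normalisation is left: dividing \<open>\<Phi>\<close> by its supremum
  \<open>b\<close> over the dual unit ball gives a unit functional, whose representer is multiplied
  by \<open>b\<close> afterwards. If \<open>b = 0\<close>, then \<open>\<Phi>\<close> vanishes and
  is evaluation at 0.\<close>

theorem Milman_Pettis:
  fixes X :: "'v::real_vector set"
  assumes banach: "banach_space_on X N" and uc: "uniformly_convex_on X N"
  shows "reflexive_on X N"
  unfolding reflexive_on_def
proof
  let ?D = "dual_space X N" and ?n = "dual_norm X N"
  fix \<Phi> assume "\<Phi> \<in> dual_space ?D ?n"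
  then obtain B where add: "\<And>f g. f \<in> ?D \<Longrightarrow> g \<in> ?D \<Longrightarrow> \<Phi> (f + g) = \<Phi> f + \<Phi> g"
    and scale: "\<And>f c. f \<in> ?D \<Longrightarrow> \<Phi> (c *\<^sub>R f) = c * \<Phi> f"
    and B: "\<And>f. f \<in> ?D \<Longrightarrow> \<bar>\<Phi> f\<bar> \<le> B * ?n f"
    by (auto simp: dual_space_def)
  have normed: "normed_space_on X N" using banach by (simp add: banach_space_on_def)
  note Dmem = subspace_0[OF subspace_dual_space[OF normed]] subspace_scale[OF subspace_dual_space[OF normed]]
  note n_nonneg = dual_norm_nonneg[OF normed]
  define U where "U = {f \<in> ?D. ?n f \<le> 1}"
  have U0: "0 \<in> U" unfolding U_def using Dmem dual_norm_leI[OF normed, of 0 1] by simp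
  have bdd: "bdd_above (\<Phi> ` U)"
  proof (rule bdd_aboveI2)
    fix f assume "f \<in> U"
    then have f: "f \<in> ?D" "?n f \<le> 1" by (auto simp: U_def)
    have "\<Phi> f \<le> B * ?n f" using B[OF f(1)] by linarith
    also have "\<dots> \<le> \<bar>B\<bar> * 1" using f n_nonneg[OF f(1)] by (intro mult_mono) auto
    finally show "\<Phi> f \<le> \<bar>B\<bar>" by simp
  qed
  define b where "b = (SUP f\<in>U. \<Phi> f)"
  have b_upper: "\<Phi> f \<le> b" if "f \<in> U" for f unfolding b_def by (intro cSUP_upper bdd that)
  have "\<Phi> 0 = 0" using scale[OF Dmem(1), of 0] by simp
  then have "b \<ge> 0" using b_upper[OF U0] by simp
  have bound: "\<bar>\<Phi> f\<bar> \<le> b * ?n f" if f: "f \<in> ?D" for f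
  proof (cases "?n f = 0")
    case False
    then have pos: "?n f > 0" using n_nonneg[OF f] by simp
    define c where "c = sgn (\<Phi> f) / ?n f"
    have "\<bar>c\<bar> * ?n f \<le> 1" using pos by (auto simp: c_def abs_mult abs_sgn_eq)
    then have "?n (c *\<^sub>R f) \<le> 1" using dual_norm_scale[OF normed f, of c] by linarith
    then have "\<Phi> (c *\<^sub>R f) \<le> b" using Dmem(2)[OF f] by (intro b_upper) (simp add: U_def)
    then have "\<bar>\<Phi> f\<bar> / ?n f \<le> b" using f by (simp add: scale c_def abs_sgn mult.commute)
    then show ?thesis using pos by (simp add: field_simps)
  qed (use B[OF f] in simp)
  show "\<exists>x\<in>X. \<forall>f\<in>?D. \<Phi> f = f x"
  proof (cases "b = 0")
    case True
    have "0 \<in> X" by (rule subspace_0[OF normed_space_onD(1)[OF normed]])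
    moreover have "\<Phi> f = f 0" if "f \<in> ?D" for f
      using bound[OF that] True dual_spaceD(2)[OF normed that \<open>0 \<in> X\<close>, of 0] by simp
    ultimately show ?thesis by blast
  next
    case False
    then have "b > 0" using \<open>b \<ge> 0\<close> by simp
    define \<Psi> where "\<Psi> f = \<Phi> f / b" for f
    have "\<exists>x\<in>X. \<forall>f\<in>?D. \<Psi> f = f x"
    proof (rule bidual_unit_represented[OF banach uc])
      show "\<bar>\<Psi> f\<bar> \<le> ?n f" if "f \<in> ?D" for f
        using bound[OF that] \<open>b > 0\<close> by (simp add: \<Psi>_def field_simps)
      show "\<exists>f\<in>?D. ?n f \<le> 1 \<and> 1 - \<delta> < \<Psi> f" if "\<delta> > 0" for \<delta>
      proof -
        have "b - b * \<delta> < b" using that \<open>b > 0\<close> by simp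
        moreover have "U \<noteq> {}" using U0 by auto
        ultimately obtain f where "f \<in> U" "b - b * \<delta> < \<Phi> f"
          using less_cSUP_iff[OF \<open>U \<noteq> {}\<close> bdd] unfolding b_def[symmetric] by blast
        then show ?thesis using \<open>b > 0\<close> by (intro bexI[of _ f]) (auto simp: U_def \<Psi>_def field_simps)
      qed
    qed (auto simp: \<Psi>_def add scale add_divide_distrib)
    then obtain x where x: "x \<in> X" "\<And>f. f \<in> ?D \<Longrightarrow> \<Phi> f = b * f x"
      using \<open>b > 0\<close> by (auto simp: \<Psi>_def field_simps)
    show ?thesis
      using x by (intro bexI[of _ "b *\<^sub>R x"])
        (auto simp: dual_spaceD(2)[OF normed] intro: subspace_scale[OF normed_space_onD(1)[OF normed]])
  qed
qed

section \<open>Geometry of the Vicsek set\<close>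

text \<open>Half the side of \<open>vicsek_K0\<close>, whose corners lie on the unit circle. Used as
  the unit of length, it turns corners, digits and vertices into integer points.\<close>

definition half_side :: real where
  "half_side = sqrt 2 / 2"

lemma half_side_pos: "half_side > 0"
  by (simp add: half_side_def)

lemma half_side_sq: "half_side * half_side = 1 / 2"
  by (simp add: half_side_def)

lemma vicsek_q_0 [simp]: "vicsek_q 0 = 0"
  by (simp add: vicsek_q_def)

lemma vicsek_q_cis: "j \<noteq> 0 \<Longrightarrow> vicsek_q j = cis ((2 * real j - 1) * pi / 4)"
  unfolding vicsek_q_def cis_conv_exp by (auto intro!: arg_cong[where f = exp])

lemma vicsek_q_1_4:
  "vicsek_q (Suc 0) = Complex half_side half_side" "vicsek_q 2 = Complex (- half_side) half_side"
  "vicsek_q 3 = Complex (- half_side) (- half_side)" "vicsek_q 4 = Complex half_side (- half_side)"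
proof -
  have angles: "3 * pi / 4 = pi - pi / 4" "5 * pi / 4 = pi / 4 + pi" "7 * pi / 4 = 2 * pi - pi / 4" by auto
  have "cos (3 * pi / 4) = - half_side" "sin (3 * pi / 4) = half_side"
    "cos (5 * pi / 4) = - half_side" "sin (5 * pi / 4) = - half_side"
    "cos (7 * pi / 4) = half_side" "sin (7 * pi / 4) = - half_side"
    unfolding angles by (simp_all only: cos_pi_minus sin_pi_minus cos_periodic_pi sin_periodic_pi cos_2pi_minus
      sin_2pi_minus cos_45 sin_45 half_side_def)
  then show "vicsek_q (Suc 0) = Complex half_side half_side" "vicsek_q 2 = Complex (- half_side) half_side"
    "vicsek_q 3 = Complex (- half_side) (- half_side)" "vicsek_q 4 = Complex half_side (- half_side)"
    by (simp_all add: vicsek_q_cis complex_eq_iff cos_45 sin_45 half_side_def)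
qed

lemma atLeastAtMost_1_4: "{Suc 0..4::nat} = {Suc 0, 2, 3, 4}" "{0..4::nat} = {0, Suc 0, 2, 3, 4}"
  by auto

text \<open>Trades the index \<open>j\<close> for a pair of signs, so that later questions about
  corners become integer arithmetic.\<close>

lemma vicsek_q_image: "vicsek_q ` {1..4} =
    {Complex (half_side * of_int a) (half_side * of_int b) | a b. \<bar>a\<bar> = 1 \<and> \<bar>b\<bar> = 1}" (is "?L = ?R")
proof -
  have "(\<bar>a\<bar> = 1) = (a = 1 \<or> a = - 1)" for a :: int by linarith
  then have "?R = {Complex half_side half_side, Complex (- half_side) half_side,
    Complex (- half_side) (- half_side), Complex half_side (- half_side)}"
    by (auto simp: conj_disj_distribL conj_disj_distribR ex_disj_distrib)
  then show ?thesis by (simp add: atLeastAtMost_1_4 vicsek_q_1_4)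
qed

lemma inj_on_vicsek_q: "inj_on vicsek_q {1..4}"
  using half_side_pos by (auto simp: inj_on_def atLeastAtMost_1_4 vicsek_q_1_4)

lemma norm_vicsek_q: "j \<in> {1..4} \<Longrightarrow> norm (vicsek_q j) = 1"
  by (simp add: vicsek_q_cis)

lemma vicsek_K0_eq: "vicsek_K0 = {z. \<bar>Re z\<bar> \<le> half_side \<and> \<bar>Im z\<bar> \<le> half_side}" (is "_ = ?B")
proof (rule antisym)
  have "convex ?B"
  proof (rule convexI)
    fix x y and u v :: real assume xy: "x \<in> ?B" "y \<in> ?B" and uv: "0 \<le> u" "0 \<le> v" "u + v = 1"
    have *: "\<bar>u * a + v * b\<bar> \<le> half_side" if "\<bar>a\<bar> \<le> half_side" "\<bar>b\<bar> \<le> half_side" for a b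
    proof -
      have "\<bar>u * a + v * b\<bar> \<le> u * \<bar>a\<bar> + v * \<bar>b\<bar>"
        using abs_triangle_ineq[of "u * a" "v * b"] uv by (simp add: abs_mult)
      also have "\<dots> \<le> u * half_side + v * half_side" using uv that by (intro add_mono mult_left_mono) auto
      also have "\<dots> = half_side" using uv by (simp add: distrib_right[symmetric])
      finally show ?thesis .
    qed
    show "u *\<^sub>R x + v *\<^sub>R y \<in> ?B" using xy by (auto intro!: *)
  qed
  then show "vicsek_K0 \<subseteq> ?B"
    unfolding vicsek_K0_def using half_side_pos
    by (intro hull_minimal) (auto simp: atLeastAtMost_1_4 vicsek_q_1_4)
  show "?B \<subseteq> vicsek_K0"
  proof
    fix z assume "z \<in> ?B"
    then have z: "\<bar>Re z\<bar> \<le> half_side" "\<bar>Im z\<bar> \<le> half_side" by auto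
    have q: "Complex a b \<in> vicsek_K0" if "a \<in> {half_side, - half_side}" "b \<in> {half_side, - half_side}" for a b
      unfolding vicsek_K0_def using that by (intro hull_inc) (auto simp: atLeastAtMost_1_4 vicsek_q_1_4)
    have "convex vicsek_K0" by (simp add: vicsek_K0_def)
    \<comment> \<open>Two successive interpolations: \<open>t\<close> reaches the abscissa of
      \<open>z\<close> along the two horizontal sides, \<open>r\<close> then moves vertically
      between them.\<close>
    define t where "t = (1 + Re z / half_side) / 2"
    define r where "r = (1 + Im z / half_side) / 2"
    have t: "0 \<le> t" "t \<le> 1" "0 \<le> r" "r \<le> 1"
      using z half_side_pos by (auto simp: t_def r_def divide_simps abs_le_iff)
    have side: "Complex (Re z) b \<in> vicsek_K0" if "b \<in> {half_side, - half_side}" for b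
    proof -
      have "t *\<^sub>R Complex half_side b + (1 - t) *\<^sub>R Complex (- half_side) b \<in> vicsek_K0"
        using t that by (intro convexD[OF \<open>convex vicsek_K0\<close>] q) auto
      moreover have "t *\<^sub>R Complex half_side b + (1 - t) *\<^sub>R Complex (- half_side) b = Complex (Re z) b"
        using half_side_pos by (simp add: t_def complex_eq_iff field_simps)
      ultimately show ?thesis by simp
    qed
    have "r *\<^sub>R Complex (Re z) half_side + (1 - r) *\<^sub>R Complex (Re z) (- half_side) \<in> vicsek_K0"
      using t by (intro convexD[OF \<open>convex vicsek_K0\<close>] side) auto
    moreover have "r *\<^sub>R Complex (Re z) half_side + (1 - r) *\<^sub>R Complex (Re z) (- half_side) = z"
      using half_side_pos by (simp add: r_def complex_eq_iff field_simps)
    ultimately show "z \<in> vicsek_K0" by simp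
  qed
qed

lemma compact_vicsek_K0: "compact vicsek_K0"
  unfolding vicsek_K0_def by (intro compact_convex_hull finite_imp_compact finite_imageI finite_atLeastAtMost)

lemma norm_le_1_vicsek_K0:
  assumes "z \<in> vicsek_K0"
  shows "norm z \<le> 1"
proof -
  have "convex hull (vicsek_q ` {1..4}) \<subseteq> cball 0 1"
    using norm_vicsek_q by (intro hull_minimal) (auto simp del: One_nat_def)
  then show ?thesis using assms by (auto simp: vicsek_K0_def)
qed

text \<open>The multiple \<open>n\<close> merges with the signs of the corner into signed
  coordinates. Equality of the absolute values of \<open>a\<close> and \<open>b\<close> is the cross
  shape, and the source of the parity argument about neighbouring cells.\<close>

lemma vicsek_S_eq:
  assumes "odd L"
  shows "vicsek_S L = {Complex (2 * half_side / real L * of_int a) (2 * half_side / real L * of_int b) | a b :: int.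
    \<bar>a\<bar> = \<bar>b\<bar> \<and> 2 * \<bar>a\<bar> < int L}" (is "_ = ?R")
proof (rule set_eqI)
  fix z
  have le: "n \<le> (L - 1) div 2 \<longleftrightarrow> 2 * int n < int L" for n :: nat
    using assms by (auto elim!: oddE)
  have "z \<in> vicsek_S L \<longleftrightarrow> (\<exists>n. n \<le> (L - 1) div 2 \<and> (\<exists>q\<in>vicsek_q ` {1..4}. z = of_nat (2 * n) / of_nat L * q))"
    unfolding vicsek_S_def by blast
  also have "\<dots> \<longleftrightarrow> (\<exists>n. 2 * int n < int L \<and> (\<exists>a b. \<bar>a\<bar> = 1 \<and> \<bar>b\<bar> = 1 \<and>
      z = of_nat (2 * n) / of_nat L * Complex (half_side * of_int a) (half_side * of_int b)))"
    unfolding vicsek_q_image le by blast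
  also have "\<dots> \<longleftrightarrow> (\<exists>n. 2 * int n < int L \<and> (\<exists>a b. \<bar>a\<bar> = 1 \<and> \<bar>b\<bar> = 1 \<and>
      z = Complex (2 * half_side / real L * of_int (int n * a)) (2 * half_side / real L * of_int (int n * b))))"
    by (simp add: complex_eq_iff ac_simps)
  also have "\<dots> \<longleftrightarrow> z \<in> ?R"
  proof
    assume "\<exists>n. 2 * int n < int L \<and> (\<exists>a b. \<bar>a\<bar> = 1 \<and> \<bar>b\<bar> = 1 \<and>
      z = Complex (2 * half_side / real L * of_int (int n * a)) (2 * half_side / real L * of_int (int n * b)))"
    then obtain n a b where *: "2 * int n < int L" "\<bar>a\<bar> = 1" "\<bar>b\<bar> = 1"
      "z = Complex (2 * half_side / real L * of_int (int n * a)) (2 * half_side / real L * of_int (int n * b))"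
      by blast
    then have "\<bar>int n * a\<bar> = \<bar>int n * b\<bar>" "2 * \<bar>int n * a\<bar> < int L" by (simp_all add: abs_mult)
    then show "z \<in> ?R" using *(4) by blast
  next
    assume "z \<in> ?R"
    then obtain a b where *: "\<bar>a\<bar> = \<bar>b\<bar>" "2 * \<bar>a\<bar> < int L"
      "z = Complex (2 * half_side / real L * of_int a) (2 * half_side / real L * of_int b)" by blast
    have pm: "\<exists>e. \<bar>e\<bar> = 1 \<and> c = int (nat \<bar>a\<bar>) * e" if "\<bar>c\<bar> = \<bar>a\<bar>" for c
      using that by (intro exI[of _ "if c < 0 then -1 else 1"]) auto
    obtain e where e: "\<bar>e\<bar> = 1" "a = int (nat \<bar>a\<bar>) * e" using pm[OF refl] by blast
    obtain e' where e': "\<bar>e'\<bar> = 1" "b = int (nat \<bar>a\<bar>) * e'" using pm[OF *(1)[symmetric]] by blast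
    have "2 * int (nat \<bar>a\<bar>) < int L" using * by simp
    then show "\<exists>n. 2 * int n < int L \<and> (\<exists>a b. \<bar>a\<bar> = 1 \<and> \<bar>b\<bar> = 1 \<and>
      z = Complex (2 * half_side / real L * of_int (int n * a)) (2 * half_side / real L * of_int (int n * b)))"
      using e e' *(3) by metis
  qed
  finally show "z \<in> vicsek_S L \<longleftrightarrow> z \<in> ?R" .
qed

lemma finite_vicsek_S: "finite (vicsek_S L)"
proof -
  have "vicsek_S L \<subseteq> (\<Union>n\<in>{..(L - 1) div 2}. \<Union>j\<in>{1..4}. {of_nat (2 * n) / of_nat L * vicsek_q j})"
    unfolding vicsek_S_def by blast
  then show ?thesis by (rule finite_subset) (intro finite_UN_I; simp)
qed

lemma vicsek_SI: "n \<le> (L - 1) div 2 \<Longrightarrow> j \<in> {1..4} \<Longrightarrow> of_nat (2 * n) / of_nat L * vicsek_q j \<in> vicsek_S L"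
  unfolding vicsek_S_def by blast

lemma zero_in_vicsek_S: "0 \<in> vicsek_S L"
  using vicsek_SI[of 0 L 1] by simp

section \<open>Words, shifted scale sequences and self-similarity\<close>

definition shift_scale :: "(nat \<Rightarrow> nat) \<Rightarrow> nat \<Rightarrow> nat" where
  "shift_scale l k = (if k = 0 then 1 else l (Suc k))"

definition cell_radius :: "(nat \<Rightarrow> nat) \<Rightarrow> nat \<Rightarrow> real" where
  "cell_radius l n = (\<Prod>j=0..n. 1 / real (l j))"

definition energy_weight :: "(nat \<Rightarrow> nat) \<Rightarrow> real \<Rightarrow> nat \<Rightarrow> real" where
  "energy_weight l p n = (\<Prod>j=0..n. real (l j) powr (p - 1))"

definition vicsek_union :: "(nat \<Rightarrow> nat) \<Rightarrow> nat \<Rightarrow> complex set \<Rightarrow> complex set" where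
  "vicsek_union l n A = (\<Union>w\<in>vicsek_words l n. vicsek_map l n w ` A)"

text \<open>The factor at index 0 is \<open>f 1 = 1\<close> for both sequences, which is why
  \<open>shift_scale\<close> resets its value there. Serves radii and energy weights alike.\<close>

lemma prod_shift_scale:
  assumes "f (1::nat) = (1::real)" "l 0 = 1"
  shows "(\<Prod>j=0..Suc n. f (l j)) = f (l 1) * (\<Prod>j=0..n. f (shift_scale l j))"
proof (induction n)
  case 0
  show ?case using assms by (simp add: shift_scale_def)
next
  case (Suc n)
  have "(\<Prod>j=0..Suc (Suc n). f (l j)) = (\<Prod>j=0..Suc n. f (l j)) * f (shift_scale l (Suc n))"
    by (simp add: shift_scale_def)
  then show ?case unfolding Suc by (simp add: ac_simps)
qed

lemma vicsek_map_cong: "(\<And>k. k \<in> {1..n} \<Longrightarrow> w k = w' k) \<Longrightarrow> vicsek_map l n w = vicsek_map l n w'"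
  by (induction n) auto

text \<open>The defining recursion appends the last, finest digit. Splitting off the first digit
  instead leaves a map for the shifted sequence, the form needed for induction over all
  sequences.\<close>

lemma vicsek_map_Suc:
  "vicsek_map l (Suc n) w = vicsek_F (l 1) (w 1) \<circ> vicsek_map (shift_scale l) n (\<lambda>k. w (Suc k))"
proof (induction n)
  case (Suc n)
  have "vicsek_map l (Suc (Suc n)) w = vicsek_map l (Suc n) w \<circ> vicsek_F (l (Suc (Suc n))) (w (Suc (Suc n)))"
    by simp
  moreover have "l (Suc (Suc n)) = shift_scale l (Suc n)" by (simp add: shift_scale_def)
  ultimately show ?case unfolding Suc by (simp only: vicsek_map.simps(2) o_assoc)
qed simp

lemma vicsek_union_0: "vicsek_union l 0 A = A"
  by (simp add: vicsek_union_def vicsek_words_def)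

lemma vicsek_union_Suc:
  "vicsek_union l (Suc n) A = (\<Union>d\<in>vicsek_S (l 1). vicsek_F (l 1) d ` vicsek_union (shift_scale l) n A)"
proof (rule antisym)
  show "vicsek_union l (Suc n) A \<subseteq> (\<Union>d\<in>vicsek_S (l 1). vicsek_F (l 1) d ` vicsek_union (shift_scale l) n A)"
  proof
    fix x assume "x \<in> vicsek_union l (Suc n) A"
    then obtain w a where w: "w \<in> vicsek_words l (Suc n)" "a \<in> A" "x = vicsek_map l (Suc n) w a"
      by (auto simp: vicsek_union_def)
    \<comment> \<open>Words are extensional functions, so the shifted word has to be restricted to
      \<open>{1..n}\<close> again.\<close>
    define w' where "w' = restrict (\<lambda>k. w (Suc k)) {1..n}"
    have "w 1 \<in> vicsek_S (l 1)" using w by (auto simp: vicsek_words_def)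
    moreover have "w' \<in> vicsek_words (shift_scale l) n"
      using w by (auto simp: vicsek_words_def w'_def shift_scale_def)
    moreover have "vicsek_map (shift_scale l) n (\<lambda>k. w (Suc k)) = vicsek_map (shift_scale l) n w'"
      by (rule vicsek_map_cong) (simp add: w'_def)
    then have "x = vicsek_F (l 1) (w 1) (vicsek_map (shift_scale l) n w' a)"
      using w by (simp only: vicsek_map_Suc o_def)
    ultimately show "x \<in> (\<Union>d\<in>vicsek_S (l 1). vicsek_F (l 1) d ` vicsek_union (shift_scale l) n A)"
      using w(2) unfolding vicsek_union_def by blast
  qed
  show "(\<Union>d\<in>vicsek_S (l 1). vicsek_F (l 1) d ` vicsek_union (shift_scale l) n A) \<subseteq> vicsek_union l (Suc n) A"
  proof
    fix x assume "x \<in> (\<Union>d\<in>vicsek_S (l 1). vicsek_F (l 1) d ` vicsek_union (shift_scale l) n A)"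
    then obtain d w' a where d: "d \<in> vicsek_S (l 1)" "w' \<in> vicsek_words (shift_scale l) n" "a \<in> A"
      "x = vicsek_F (l 1) d (vicsek_map (shift_scale l) n w' a)"
      unfolding vicsek_union_def by blast
    define w where "w = restrict (\<lambda>k. if k = 1 then d else w' (k - 1)) {1..Suc n}"
    have "w \<in> vicsek_words l (Suc n)"
      unfolding vicsek_words_def
    proof (rule PiE_I)
      fix k assume k: "k \<in> {1..Suc n}"
      show "w k \<in> vicsek_S (l k)"
      proof (cases "k = 1")
        case False
        then have k': "k - 1 \<in> {1..n}" "shift_scale l (k - 1) = l k" using k by (auto simp: shift_scale_def)
        then have "w' (k - 1) \<in> vicsek_S (shift_scale l (k - 1))"
          using d(2) unfolding vicsek_words_def by blast
        then show ?thesis using k False unfolding k'(2) by (simp add: w_def)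
      qed (use d k in \<open>simp add: w_def\<close>)
    qed (auto simp: w_def)
    moreover have "vicsek_map (shift_scale l) n (\<lambda>k. w (Suc k)) = vicsek_map (shift_scale l) n w'"
      by (rule vicsek_map_cong) (simp add: w_def)
    then have "x = vicsek_map l (Suc n) w a" using d by (simp add: vicsek_map_Suc w_def del: vicsek_map.simps)
    ultimately show "x \<in> vicsek_union l (Suc n) A" using d(3) unfolding vicsek_union_def by blast
  qed
qed

lemma vicsek_set_eq: "vicsek_set l = (\<Inter>n\<in>{1..}. vicsek_union l n vicsek_K0)"
  by (simp add: vicsek_set_def vicsek_union_def)

lemma vicsek_V_eq: "vicsek_V l n = vicsek_union l n (vicsek_q ` {0..4})"
  by (simp add: vicsek_V_def vicsek_union_def)

locale scale =
  fixes l :: "nat \<Rightarrow> nat"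
  assumes scale_sequence: "scale_sequence l"
begin

lemma l_0: "l 0 = 1"
  and l_odd: "1 \<le> k \<Longrightarrow> odd (l k)"
  and l_ge_3: "1 \<le> k \<Longrightarrow> 3 \<le> l k"
  using scale_sequence by (auto simp: scale_sequence_def)

lemma l_pos: "0 < l k"
  using l_0 l_ge_3[of k] by (cases "k = 0") auto

lemma scale_shift: "scale (shift_scale l)"
  using scale_sequence by unfold_locales (auto simp: scale_sequence_def shift_scale_def)

abbreviation "L \<equiv> l 1"
abbreviation "S \<equiv> vicsek_S (l 1)"
abbreviation "F \<equiv> vicsek_F (l 1)"
abbreviation "l' \<equiv> shift_scale l"

lemma L_pos: "0 < real L"
  using l_pos by simp

lemma L_ge_3: "3 \<le> real L"
  using l_ge_3[of 1] by simp

lemma cell_radius_0: "cell_radius l 0 = 1"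
  by (simp add: cell_radius_def l_0)

lemma cell_radius_Suc: "cell_radius l (Suc n) = cell_radius l' n / real L"
  unfolding cell_radius_def using prod_shift_scale[of "\<lambda>j. 1 / real j" l n] l_0 by simp

lemma energy_weight_0: "energy_weight l p 0 = 1"
  by (simp add: energy_weight_def l_0)

lemma energy_weight_Suc: "energy_weight l p (Suc n) = real L powr (p - 1) * energy_weight l' p n"
  unfolding energy_weight_def using prod_shift_scale[of "\<lambda>j. real j powr (p - 1)" l n] l_0 by simp

lemma cell_radius_pos: "0 < cell_radius l n"
  unfolding cell_radius_def using l_pos by (intro prod_pos) auto

lemma energy_weight_nonneg: "0 \<le> energy_weight l p n"
  unfolding energy_weight_def by (intro prod_nonneg) auto

end

lemma cell_radius_le:
  assumes "scale l"
  shows "cell_radius l n \<le> (1/3) ^ n"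
  using assms
proof (induction n arbitrary: l)
  case 0
  then show ?case by (simp add: scale.cell_radius_0)
next
  case (Suc n)
  have "cell_radius (shift_scale l) n * (1 / real (l 1)) \<le> (1/3) ^ n * (1 / 3)"
    using scale.L_ge_3[OF Suc.prems]
    by (intro mult_mono Suc.IH scale.scale_shift Suc.prems divide_left_mono) auto
  then show ?case by (simp add: scale.cell_radius_Suc[OF Suc.prems])
qed

lemma cell_radius_tendsto_0:
  assumes "scale l"
  shows "cell_radius l \<longlonglongrightarrow> 0"
proof (rule tendsto_sandwich[of "\<lambda>_. 0" _ _ "\<lambda>n. (1/3) ^ n"])
  show "(\<lambda>n. (1/3) ^ n :: real) \<longlonglongrightarrow> 0" by (rule LIMSEQ_realpow_zero) auto
qed (use cell_radius_le[OF assms] scale.cell_radius_pos[OF assms] in \<open>auto intro!: always_eventually less_imp_le\<close>)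

lemma Re_vicsek_F: "Re (vicsek_F m d z) = Re d + Re z / real m"
  and Im_vicsek_F: "Im (vicsek_F m d z) = Im d + Im z / real m"
  by (simp_all add: vicsek_F_def)

lemma vicsek_F_eq_iff: "0 < m \<Longrightarrow> vicsek_F m d z = vicsek_F m d z' \<longleftrightarrow> z = z'"
  by (simp add: vicsek_F_def)

lemma continuous_on_vicsek_F: "continuous_on A (vicsek_F m d)"
  unfolding vicsek_F_def divide_inverse by (intro continuous_intros)

lemma vicsek_union_mono: "A \<subseteq> B \<Longrightarrow> vicsek_union l n A \<subseteq> vicsek_union l n B"
  unfolding vicsek_union_def by blast

lemma vicsek_q_in_K0: "j \<in> {0..4} \<Longrightarrow> vicsek_q j \<in> vicsek_K0"
  unfolding vicsek_K0_eq using half_side_pos by (auto simp: atLeastAtMost_1_4 vicsek_q_1_4)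

lemma (in scale) vicsek_S_cases:
  assumes "d \<in> S"
  obtains a b :: int where "\<bar>a\<bar> = \<bar>b\<bar>" "2 * \<bar>a\<bar> < int L"
    "d = Complex (2 * half_side / real L * of_int a) (2 * half_side / real L * of_int b)"
proof -
  have "odd L" by (rule l_odd) simp
  from assms that show ?thesis unfolding vicsek_S_eq[OF \<open>odd L\<close>] by blast
qed

text \<open>Integrality sharpens \<open>2 * \<bar>k\<bar> < L\<close> to
  \<open>2 * \<bar>k\<bar> + 1 \<le> L\<close>: even the outermost digit leaves room for half a
  small cell.\<close>

lemma (in scale) vicsek_S_bound:
  assumes "d \<in> S"
  shows "\<bar>Re d\<bar> \<le> half_side - half_side / real L" "\<bar>Im d\<bar> \<le> half_side - half_side / real L"
proof -
  obtain a b :: int where ab: "\<bar>a\<bar> = \<bar>b\<bar>" "2 * \<bar>a\<bar> < int L"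
    "d = Complex (2 * half_side / real L * of_int a) (2 * half_side / real L * of_int b)"
    by (rule vicsek_S_cases[OF assms])
  have "\<bar>2 * half_side / real L * of_int k\<bar> \<le> half_side - half_side / real L" if "\<bar>k\<bar> = \<bar>a\<bar>" for k :: int
  proof -
    have "2 * \<bar>k\<bar> + 1 \<le> int L" using that ab by simp
    then have "2 * real_of_int \<bar>k\<bar> + 1 \<le> real L" by linarith
    then have "half_side * (2 * real_of_int \<bar>k\<bar> + 1) \<le> half_side * real L"
      using half_side_pos by (intro mult_left_mono) auto
    then show ?thesis using half_side_pos L_pos by (simp add: abs_mult field_simps)
  qed
  then show "\<bar>Re d\<bar> \<le> half_side - half_side / real L" "\<bar>Im d\<bar> \<le> half_side - half_side / real L"
    using ab by auto
qed

lemma (in scale) vicsek_F_K0: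
  assumes "d \<in> S" "z \<in> vicsek_K0"
  shows "F d z \<in> vicsek_K0"
proof -
  have *: "\<bar>a + b / real L\<bar> \<le> half_side" if "\<bar>a\<bar> \<le> half_side - half_side / real L" "\<bar>b\<bar> \<le> half_side" for a b
  proof -
    have "\<bar>b / real L\<bar> \<le> half_side / real L" using that L_pos by (simp add: divide_right_mono)
    then show ?thesis using that by linarith
  qed
  show ?thesis using assms vicsek_S_bound[OF assms(1)] *
    unfolding vicsek_K0_eq by (auto simp: Re_vicsek_F Im_vicsek_F)
qed

lemma vicsek_union_decreasing:
  assumes "scale l"
  shows "vicsek_union l (Suc n) vicsek_K0 \<subseteq> vicsek_union l n vicsek_K0"
  using assms
proof (induction n arbitrary: l)
  case 0
  interpret scale l by (rule 0)
  show ?case using vicsek_F_K0 by (auto simp: vicsek_union_Suc[of l 0] vicsek_union_0)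
next
  case (Suc n)
  interpret scale l by (rule Suc.prems)
  have "vicsek_union l' (Suc n) vicsek_K0 \<subseteq> vicsek_union l' n vicsek_K0" by (rule Suc.IH[OF scale_shift])
  then show ?case unfolding vicsek_union_Suc[of l "Suc n"] vicsek_union_Suc[of l n] by blast
qed

lemma vicsek_set_eq':
  assumes "scale l"
  shows "vicsek_set l = (\<Inter>n. vicsek_union l n vicsek_K0)"
proof -
  have "vicsek_union l 1 vicsek_K0 \<subseteq> vicsek_union l 0 vicsek_K0"
    using vicsek_union_decreasing[OF assms, of 0] by simp
  then have "x \<in> vicsek_union l n vicsek_K0" if "\<And>k. 1 \<le> k \<Longrightarrow> x \<in> vicsek_union l k vicsek_K0" for x n
    using that by (cases "n = 0") (auto simp: Suc_le_eq)
  then show ?thesis unfolding vicsek_set_eq by auto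
qed

text \<open>The substance is that a decreasing intersection commutes with a union over the finite
  set of digits.\<close>

lemma (in scale) vicsek_set_self_similar: "vicsek_set l = (\<Union>d\<in>S. F d ` vicsek_set l')"
proof (rule antisym)
  show "(\<Union>d\<in>S. F d ` vicsek_set l') \<subseteq> vicsek_set l"
  proof
    fix x assume "x \<in> (\<Union>d\<in>S. F d ` vicsek_set l')"
    then obtain d y where d: "d \<in> S" "y \<in> vicsek_set l'" "x = F d y" by auto
    have "x \<in> vicsek_union l n vicsek_K0" for n
    proof -
      have "y \<in> vicsek_union l' n vicsek_K0" using d(2) unfolding vicsek_set_eq'[OF scale_shift] by blast
      then have "x \<in> vicsek_union l (Suc n) vicsek_K0" unfolding vicsek_union_Suc using d by blast
      then show ?thesis using vicsek_union_decreasing[OF scale_axioms] by blast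
    qed
    then show "x \<in> vicsek_set l" unfolding vicsek_set_eq'[OF scale_axioms] by blast
  qed
  show "vicsek_set l \<subseteq> (\<Union>d\<in>S. F d ` vicsek_set l')"
  proof
    fix x assume "x \<in> vicsek_set l"
    then have x: "x \<in> vicsek_union l (Suc n) vicsek_K0" for n
      unfolding vicsek_set_eq'[OF scale_axioms] by blast
    have "\<exists>d\<in>S. \<forall>n. x \<in> F d ` vicsek_union l' n vicsek_K0"
    proof (rule ccontr)
      assume "\<not> ?thesis"
      then obtain n where n: "\<And>d. d \<in> S \<Longrightarrow> x \<notin> F d ` vicsek_union l' (n d) vicsek_K0" by metis
      \<comment> \<open>Were every digit to fail at some level, all would fail at the largest of
        these levels, since the unions decrease.\<close>
      define m where "m = Max (n ` S)"
      have "n d \<le> m" if "d \<in> S" for d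
        unfolding m_def using that finite_vicsek_S by (intro Max_ge) auto
      then have "vicsek_union l' m vicsek_K0 \<subseteq> vicsek_union l' (n d) vicsek_K0" if "d \<in> S" for d
        using that lift_Suc_antimono_le[of "\<lambda>n. vicsek_union l' n vicsek_K0"]
          vicsek_union_decreasing[OF scale_shift] by blast
      then have "x \<notin> F d ` vicsek_union l' m vicsek_K0" if "d \<in> S" for d
        using n that by blast
      then show False using x[of m] unfolding vicsek_union_Suc by blast
    qed
    then obtain d where d: "d \<in> S" "\<And>n. x \<in> F d ` vicsek_union l' n vicsek_K0" by blast
    from d(2)[of 0] obtain y where y: "x = F d y" by blast
    have "y \<in> vicsek_union l' n vicsek_K0" for n
      using d(2)[of n] y vicsek_F_eq_iff[OF l_pos[of 1]] by auto
    then have "y \<in> vicsek_set l'" unfolding vicsek_set_eq'[OF scale_shift] by blast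
    then show "x \<in> (\<Union>d\<in>S. F d ` vicsek_set l')" using d(1) y by blast
  qed
qed

lemma (in scale) vicsek_F_in_set: "d \<in> S \<Longrightarrow> y \<in> vicsek_set l' \<Longrightarrow> F d y \<in> vicsek_set l"
  unfolding vicsek_set_self_similar by blast

lemma vicsek_set_subset_K0:
  assumes "scale l"
  shows "vicsek_set l \<subseteq> vicsek_K0"
  unfolding vicsek_set_eq'[OF assms] using vicsek_union_0 by blast

lemma compact_vicsek_union: "compact A \<Longrightarrow> compact (vicsek_union l n A)"
proof (induction n arbitrary: l)
  case (Suc n)
  then show ?case unfolding vicsek_union_Suc
    by (intro compact_UN finite_vicsek_S compact_continuous_image continuous_on_vicsek_F) auto
qed (simp add: vicsek_union_0)

lemma compact_vicsek_set:
  assumes "scale l"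
  shows "compact (vicsek_set l)"
proof -
  have "closed (vicsek_set l)"
    unfolding vicsek_set_eq'[OF assms]
    by (intro closed_INT ballI compact_imp_closed compact_vicsek_union compact_vicsek_K0)
  then show ?thesis
    using vicsek_set_subset_K0[OF assms] compact_vicsek_K0
    by (metis compact_Int_closed inf.absorb_iff2)
qed

text \<open>The cell at the end of a diagonal, with digit \<open>(L - 1) / L\<close> times the
  corner, keeps that corner in place; oddness of \<open>L\<close> makes this point a digit. The
  central cell fixes 0. Through these fixed points corner values propagate to all levels.\<close>

lemma (in scale) vicsek_q_fixed:
  assumes "j \<in> {0..4}"
  obtains d where "d \<in> S" "F d (vicsek_q j) = vicsek_q j"
proof (cases "j = 0")
  case True
  then show ?thesis using that[OF zero_in_vicsek_S] by (simp add: vicsek_F_def)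
next
  case False
  define d :: complex where "d = of_nat (2 * ((L - 1) div 2)) / of_nat L * vicsek_q j"
  have "d \<in> S" unfolding d_def using False assms by (intro vicsek_SI) auto
  moreover have "2 * ((L - 1) div 2) = L - 1" using l_odd[of 1] by (auto elim!: oddE)
  then have "F d (vicsek_q j) = vicsek_q j"
    using L_pos by (simp add: vicsek_F_def d_def field_simps of_nat_diff)
  ultimately show ?thesis using that by blast
qed

lemma vicsek_q_in_set:
  assumes "scale l" "j \<in> {0..4}"
  shows "vicsek_q j \<in> vicsek_set l"
proof -
  have "vicsek_q j \<in> vicsek_union l n vicsek_K0" for n
    using assms(1)
  proof (induction n arbitrary: l)
    case 0
    show ?case using vicsek_q_in_K0[OF assms(2)] by (simp add: vicsek_union_0)
  next
    case (Suc n)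
    interpret scale l by (rule Suc.prems)
    obtain d where "d \<in> S" "F d (vicsek_q j) = vicsek_q j" by (rule vicsek_q_fixed[OF assms(2)])
    then show ?case unfolding vicsek_union_Suc using Suc.IH[OF scale_shift] by (metis UN_I image_eqI)
  qed
  then show ?thesis unfolding vicsek_set_eq'[OF assms(1)] by blast
qed

lemma vicsek_union_subset_set:
  assumes "scale l" "A \<subseteq> vicsek_q ` {0..4}"
  shows "vicsek_union l n A \<subseteq> vicsek_set l"
  using assms(1)
proof (induction n arbitrary: l)
  case 0
  show ?case using vicsek_q_in_set[OF 0] assms(2) by (auto simp: vicsek_union_0)
next
  case (Suc n)
  interpret scale l by (rule Suc.prems)
  show ?case unfolding vicsek_union_Suc vicsek_set_self_similar using Suc.IH[OF scale_shift] by blast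
qed

lemma vicsek_V_subset: "scale l \<Longrightarrow> vicsek_V l n \<subseteq> vicsek_set l"
  unfolding vicsek_V_eq by (rule vicsek_union_subset_set) auto

lemma finite_vicsek_union: "finite A \<Longrightarrow> finite (vicsek_union l n A)"
proof (induction n arbitrary: l)
  case (Suc n)
  then show ?case unfolding vicsek_union_Suc
    by (intro finite_UN_I finite_vicsek_S finite_imageI) auto
qed (simp add: vicsek_union_0)

text \<open>The two integer coordinates of a digit have the same parity, so two digits cannot be
  neighbours in one coordinate and equal in the other: adjacent cells touch diagonally.\<close>

lemma (in scale) vicsek_S_separated:
  assumes "d \<in> S" "e \<in> S" "d \<noteq> e" "\<bar>Re d - Re e\<bar> \<le> 2 * half_side / real L" "\<bar>Im d - Im e\<bar> \<le> 2 * half_side / real L"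
  shows "\<bar>Re d - Re e\<bar> = 2 * half_side / real L" "\<bar>Im d - Im e\<bar> = 2 * half_side / real L"
proof -
  obtain a b :: int where ab: "\<bar>a\<bar> = \<bar>b\<bar>" 
    "d = Complex (2 * half_side / real L * of_int a) (2 * half_side / real L * of_int b)"
    by (rule vicsek_S_cases[OF assms(1)])
  obtain a' b' :: int where ab': "\<bar>a'\<bar> = \<bar>b'\<bar>"
    "e = Complex (2 * half_side / real L * of_int a') (2 * half_side / real L * of_int b')"
    by (rule vicsek_S_cases[OF assms(2)])
  define h where "h = 2 * half_side / real L"
  have h: "h > 0" using half_side_pos L_pos by (simp add: h_def)
  have eq: "Re d - Re e = h * of_int (a - a')" "Im d - Im e = h * of_int (b - b')"
    unfolding ab(2) ab'(2) h_def[symmetric] complex.sel of_int_diff right_diff_distrib by (rule refl)+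
  have "\<bar>a - a'\<bar> \<le> 1" "\<bar>b - b'\<bar> \<le> 1"
    using assms(4,5) h unfolding eq h_def[symmetric] abs_mult by auto
  moreover have "a \<noteq> a' \<or> b \<noteq> b'" using assms(3) ab ab' by auto
  moreover have "even (a - b)" "even (a' - b')" using ab(1) ab'(1) by (auto simp: abs_if split: if_splits)
  then have "even ((a - a') - (b - b'))" by presburger
  ultimately have "\<bar>a - a'\<bar> = 1 \<and> \<bar>b - b'\<bar> = 1" by presburger
  then show "\<bar>Re d - Re e\<bar> = 2 * half_side / real L" "\<bar>Im d - Im e\<bar> = 2 * half_side / real L"
    using h unfolding eq h_def[symmetric] abs_mult of_int_abs[symmetric] by auto
qed

text \<open>The digits differ by a full cell side in each coordinate, which \<open>y\<close> and
  \<open>z\<close> can bridge only from opposite extremes of the square.\<close>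

lemma (in scale) vicsek_cells_meet:
  assumes "d \<in> S" "e \<in> S" "d \<noteq> e" "y \<in> vicsek_K0" "z \<in> vicsek_K0" "F d y = F e z"
  shows "\<bar>Re y\<bar> = half_side" "\<bar>Im y\<bar> = half_side" "z = - y"
proof -
  have yz: "\<bar>Re y\<bar> \<le> half_side" "\<bar>Im y\<bar> \<le> half_side" "\<bar>Re z\<bar> \<le> half_side" "\<bar>Im z\<bar> \<le> half_side"
    using assms(4,5) by (auto simp: vicsek_K0_eq)
  have eq: "Re d - Re e = (Re z - Re y) / real L" "Im d - Im e = (Im z - Im y) / real L"
    using arg_cong[OF assms(6), of Re] arg_cong[OF assms(6), of Im]
    by (simp_all add: Re_vicsek_F Im_vicsek_F diff_divide_distrib)
  have "\<bar>Re z - Re y\<bar> / real L \<le> 2 * half_side / real L" "\<bar>Im z - Im y\<bar> / real L \<le> 2 * half_side / real L"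
    using yz by (auto intro!: divide_right_mono)
  then have "\<bar>Re d - Re e\<bar> \<le> 2 * half_side / real L" "\<bar>Im d - Im e\<bar> \<le> 2 * half_side / real L"
    unfolding eq by simp_all
  from vicsek_S_separated[OF assms(1-3) this] have "\<bar>Re z - Re y\<bar> = 2 * half_side" "\<bar>Im z - Im y\<bar> = 2 * half_side"
    using L_pos unfolding eq by simp_all
  with yz have "Re z = - Re y" "Im z = - Im y" "\<bar>Re y\<bar> = half_side" "\<bar>Im y\<bar> = half_side" by linarith+
  then show "\<bar>Re y\<bar> = half_side" "\<bar>Im y\<bar> = half_side" "z = - y" by (auto simp: complex_eq_iff)
qed

lemma (in scale) vicsek_cells_meet_corner:
  assumes "d \<in> S" "e \<in> S" "d \<noteq> e" "y \<in> vicsek_K0" "z \<in> vicsek_K0" "F d y = F e z"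
  shows "y \<in> vicsek_q ` {1..4}" "z \<in> vicsek_q ` {1..4}"
proof -
  have corner: "x \<in> vicsek_q ` {1..4}" if "\<bar>Re x\<bar> = half_side" "\<bar>Im x\<bar> = half_side" for x
  proof -
    have "Re x = half_side \<or> Re x = - half_side" "Im x = half_side \<or> Im x = - half_side"
      using that by linarith+
    then show ?thesis by (auto simp: atLeastAtMost_1_4 vicsek_q_1_4 complex_eq_iff)
  qed
  note meet = vicsek_cells_meet[OF assms]
  show "y \<in> vicsek_q ` {1..4}" "z \<in> vicsek_q ` {1..4}"
    by (intro corner; simp add: meet)+
qed

section \<open>Cells as homothetic copies, and the lattice of vertices\<close>

abbreviation vicsek_centers :: "(nat \<Rightarrow> nat) \<Rightarrow> nat \<Rightarrow> complex set" where
  "vicsek_centers l n \<equiv> vicsek_union l n {0}"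

lemma (in scale) vicsek_F_cell: "F d (c + cell_radius l' n *\<^sub>R z) = F d c + cell_radius l (Suc n) *\<^sub>R z"
  by (simp add: vicsek_F_def cell_radius_Suc add_divide_distrib scaleR_conv_of_real)

text \<open>All maps of level \<open>n\<close> have the same linear part
  \<open>cell_radius l n\<close>, so a word may be replaced by the image of 0 under its map. Centres
  then index the cells.\<close>

lemma vicsek_union_eq_centers:
  assumes "scale l"
  shows "vicsek_union l n A = (\<Union>c\<in>vicsek_centers l n. (\<lambda>z. c + cell_radius l n *\<^sub>R z) ` A)"
  using assms
proof (induction n arbitrary: l)
  case 0
  then show ?case by (simp add: vicsek_union_0 scale.cell_radius_0)
next
  case (Suc n)
  interpret scale l by (rule Suc.prems)
  show ?case
    unfolding vicsek_union_Suc Suc.IH[OF scale_shift] image_UN image_image vicsek_F_cell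
    by blast
qed

text \<open>Strictness matters: cells with different first digits share only corners, so no centre
  is counted under two first digits when sums over centres are split.\<close>

lemma vicsek_centers_interior:
  assumes "scale l" "c \<in> vicsek_centers l n"
  shows "\<bar>Re c\<bar> < half_side" "\<bar>Im c\<bar> < half_side"
proof -
  have "\<bar>Re c\<bar> < half_side \<and> \<bar>Im c\<bar> < half_side"
    using assms
  proof (induction n arbitrary: l c)
    case 0
    then show ?case using half_side_pos by (simp add: vicsek_union_0)
  next
    case (Suc n)
    then interpret scale l by simp
    obtain d y where d: "d \<in> S" "y \<in> vicsek_centers l' n" "c = F d y"
      using Suc.prems(2) unfolding vicsek_union_Suc by blast
    have y: "\<bar>Re y\<bar> < half_side" "\<bar>Im y\<bar> < half_side" using Suc.IH[OF scale_shift d(2)] by auto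
    have *: "\<bar>a + b / real L\<bar> < half_side" if "\<bar>a\<bar> \<le> half_side - half_side / real L" "\<bar>b\<bar> < half_side" for a b
    proof -
      have "\<bar>b / real L\<bar> < half_side / real L" using that L_pos by (simp add: divide_strict_right_mono)
      then show ?thesis using that by linarith
    qed
    show ?case unfolding d(3) Re_vicsek_F Im_vicsek_F using vicsek_S_bound[OF d(1)] y by (intro conjI *) 
  qed
  then show "\<bar>Re c\<bar> < half_side" "\<bar>Im c\<bar> < half_side" by auto
qed

lemma (in scale) inverse_cell_radius: "1 / cell_radius l n \<in> \<int>"
  by (simp add: cell_radius_def prod_dividef flip: of_nat_prod)

lemma vicsek_centers_lattice:
  assumes "scale l" "c \<in> vicsek_centers l n"
  shows "\<exists>a b :: int. c = Complex (2 * half_side * cell_radius l n * of_int a) (2 * half_side * cell_radius l n * of_int b)"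
  using assms
proof (induction n arbitrary: l c)
  case 0
  then show ?case by (intro exI[of _ 0]) (auto simp: vicsek_union_0 complex_eq_iff)
next
  case (Suc n)
  then interpret scale l by simp
  obtain d y where d: "d \<in> S" "y \<in> vicsek_centers l' n" "c = F d y"
    using Suc.prems(2) unfolding vicsek_union_Suc by blast
  obtain a b :: int where ab: "y = Complex (2 * half_side * cell_radius l' n * of_int a) (2 * half_side * cell_radius l' n * of_int b)"
    using Suc.IH[OF scale_shift d(2)] by blast
  obtain a' b' :: int where ab': "d = Complex (2 * half_side / real L * of_int a') (2 * half_side / real L * of_int b')"
    by (rule vicsek_S_cases[OF d(1)])
  \<comment> \<open>The coarse spacing \<open>1 / L\<close> is the integer multiple \<open>k\<close>
    of the new radius \<open>cell_radius l' n / L\<close>, so the first digit lies on the finer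
    lattice too.\<close>
  obtain k :: int where k: "1 / cell_radius l' n = of_int k"
    using scale.inverse_cell_radius[OF scale_shift, of n] by (auto elim: Ints_cases)
  have "1 / real L = cell_radius l (Suc n) * of_int k"
    using scale.cell_radius_pos[OF scale_shift, of n] by (simp add: cell_radius_Suc k[symmetric])
  then have "2 * half_side / real L * t = 2 * half_side * cell_radius l (Suc n) * of_int k * t" for t
    by (metis (no_types, opaque_lifting) mult.assoc times_divide_eq_right mult.right_neutral)
  moreover have "2 * half_side * cell_radius l (Suc n) * s = (2 * half_side * cell_radius l' n * s) / real L" for s
    by (simp add: cell_radius_Suc)
  ultimately have "2 * half_side / real L * of_int t + (2 * half_side * cell_radius l' n * of_int s) / real L =
      2 * half_side * cell_radius l (Suc n) * of_int (k * t + s)" for t s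
    unfolding of_int_add of_int_mult distrib_left by (simp only: mult.assoc)
  then have "c = Complex (2 * half_side * cell_radius l (Suc n) * of_int (k * a' + a))
      (2 * half_side * cell_radius l (Suc n) * of_int (k * b' + b))"
    unfolding d(3) ab ab' complex_eq_iff Re_vicsek_F Im_vicsek_F complex.sel by blast
  then show ?case by blast
qed

section \<open>Discrete energies\<close>

text \<open>In units of \<open>half_side * cell_radius l n\<close> an edge has squared length 2,
  because \<open>half_side * half_side = 1 / 2\<close>.\<close>

lemma sum_squares_eq_2_iff:
  fixes m n :: int
  shows "m * m + n * n = 2 \<longleftrightarrow> \<bar>m\<bar> = 1 \<and> \<bar>n\<bar> = 1"
proof
  assume *: "m * m + n * n = 2"
  have small: "\<bar>k\<bar> \<le> 1" if "k * k \<le> 2" for k :: int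
  proof (rule ccontr)
    assume "\<not> \<bar>k\<bar> \<le> 1"
    then have "2 * 2 \<le> \<bar>k\<bar> * \<bar>k\<bar>" by (intro mult_mono) auto
    then show False using that by simp
  qed
  have "m * m \<le> 2" "n * n \<le> 2" using * zero_le_square[of m] zero_le_square[of n] by linarith+
  then have "\<bar>m\<bar> \<le> 1" "\<bar>n\<bar> \<le> 1" using small by auto
  then have "m = - 1 \<or> m = 0 \<or> m = 1" "n = - 1 \<or> n = 0 \<or> n = 1" by linarith+
  then show "\<bar>m\<bar> = 1 \<and> \<bar>n\<bar> = 1" using * by auto
next
  assume "\<bar>m\<bar> = 1 \<and> \<bar>n\<bar> = 1"
  then have "\<bar>m\<bar> * \<bar>m\<bar> + \<bar>n\<bar> * \<bar>n\<bar> = 2" by simp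
  then show "m * m + n * n = 2" by simp
qed

lemma vicsek_q_lattice:
  assumes "j \<in> {0..4}"
  obtains a b :: int where "vicsek_q j = Complex (half_side * of_int a) (half_side * of_int b)"
    "j = 0 \<Longrightarrow> a = 0" "j \<noteq> 0 \<Longrightarrow> odd a"
proof (cases "j = 0")
  case True
  then show ?thesis using that[of 0 0] by (simp add: complex_eq_iff)
next
  case False
  then have "vicsek_q j \<in> vicsek_q ` {1..4}" using assms by auto
  then obtain a b :: int where "vicsek_q j = Complex (half_side * of_int a) (half_side * of_int b)" "\<bar>a\<bar> = 1"
    unfolding vicsek_q_image by blast
  moreover then have "odd a" by presburger
  ultimately show ?thesis using that False by blast
qed

text \<open>Parity of the abscissa tells centres from corners, no matter which cell is used to
  present the vertex.\<close>

lemma vicsek_vertex_lattice: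
  assumes "scale l" "c \<in> vicsek_centers l n" "j \<in> {0..4}"
  obtains a b :: int where
    "c + cell_radius l n *\<^sub>R vicsek_q j =
      Complex (half_side * cell_radius l n * of_int a) (half_side * cell_radius l n * of_int b)"
    "even a \<longleftrightarrow> j = 0"
proof -
  obtain a b :: int where ab: "c = Complex (2 * half_side * cell_radius l n * of_int a) (2 * half_side * cell_radius l n * of_int b)"
    using vicsek_centers_lattice[OF assms(1,2)] by blast
  obtain e f :: int where ef: "vicsek_q j = Complex (half_side * of_int e) (half_side * of_int f)"
    "j = 0 \<Longrightarrow> e = 0" "j \<noteq> 0 \<Longrightarrow> odd e"
    using vicsek_q_lattice[OF assms(3)] by blast
  show ?thesis
    by (rule that[of "2 * a + e" "2 * b + f"]) (use ab ef in \<open>auto simp: complex_eq_iff algebra_simps\<close>)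
qed

lemma vicsek_V_eq_centers:
  assumes "scale l"
  shows "vicsek_V l n = {c + cell_radius l n *\<^sub>R vicsek_q j | c j. c \<in> vicsek_centers l n \<and> j \<in> {0..4}}"
  unfolding vicsek_V_eq vicsek_union_eq_centers[OF assms, of n "vicsek_q ` {0..4}"] by blast

lemma vicsek_VI:
  "scale l \<Longrightarrow> c \<in> vicsek_centers l n \<Longrightarrow> j \<in> {0..4} \<Longrightarrow> c + cell_radius l n *\<^sub>R vicsek_q j \<in> vicsek_V l n"
  unfolding vicsek_V_eq_centers by blast

context scale
begin

definition spokes :: "nat \<Rightarrow> (complex \<times> complex) set" where
  "spokes n = (\<lambda>(c, j). (c, c + cell_radius l n *\<^sub>R vicsek_q j)) ` (vicsek_centers l n \<times> {1..4})"

lemma vicsek_edges_iff: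
  "(x, y) \<in> vicsek_edges l n \<longleftrightarrow> x \<in> vicsek_V l n \<and> y \<in> vicsek_V l n \<and> dist x y = cell_radius l n"
  by (simp add: vicsek_edges_def cell_radius_def)

lemma spokesI:
  "c \<in> vicsek_centers l n \<Longrightarrow> j \<in> {1..4} \<Longrightarrow> (c, c + cell_radius l n *\<^sub>R vicsek_q j) \<in> spokes n"
  unfolding spokes_def by (rule image_eqI[of _ _ "(c, j)"]) auto

lemma spokes_subset: "spokes n \<subseteq> vicsek_edges l n"
proof
  fix e assume "e \<in> spokes n"
  then obtain c j where cj: "c \<in> vicsek_centers l n" "j \<in> {1..4}" "e = (c, c + cell_radius l n *\<^sub>R vicsek_q j)"
    by (auto simp: spokes_def)
  have "c \<in> vicsek_V l n" "c + cell_radius l n *\<^sub>R vicsek_q j \<in> vicsek_V l n"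
    using vicsek_VI[OF scale_axioms cj(1), of 0] vicsek_VI[OF scale_axioms cj(1), of j] cj(2) by auto
  moreover have "dist c (c + cell_radius l n *\<^sub>R vicsek_q j) = cell_radius l n"
  proof -
    have "dist c (c + cell_radius l n *\<^sub>R vicsek_q j) = \<bar>cell_radius l n\<bar> * norm (vicsek_q j)"
      by (simp only: dist_norm norm_minus_commute[of c] add_diff_cancel_left' norm_scaleR)
    then show ?thesis using norm_vicsek_q[OF cj(2)] cell_radius_pos[of n] by simp
  qed
  ultimately show "e \<in> vicsek_edges l n" unfolding cj(3) vicsek_edges_iff by simp
qed

text \<open>A diagonal unit step changes parity, so exactly one end is a centre. The other end may
  have been presented as a corner of a different cell, but its difference from the centre is one of
  the four corner vectors.\<close>

lemma vicsek_edges_subset_spokes: "vicsek_edges l n \<subseteq> spokes n \<union> prod.swap ` spokes n"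
proof clarify
  fix x y assume "(x, y) \<in> vicsek_edges l n" and not_swap: "(x, y) \<notin> prod.swap ` spokes n"
  then have xy: "x \<in> vicsek_V l n" "y \<in> vicsek_V l n" "dist x y = cell_radius l n"
    by (auto simp: vicsek_edges_iff)
  let ?r = "cell_radius l n"
  have r: "?r > 0" by (rule cell_radius_pos)
  obtain c i where ci: "c \<in> vicsek_centers l n" "i \<in> {0..4}" "x = c + ?r *\<^sub>R vicsek_q i"
    using xy(1) unfolding vicsek_V_eq_centers[OF scale_axioms] by blast
  obtain d j where dj: "d \<in> vicsek_centers l n" "j \<in> {0..4}" "y = d + ?r *\<^sub>R vicsek_q j"
    using xy(2) unfolding vicsek_V_eq_centers[OF scale_axioms] by blast
  obtain a b :: int where ab: "x = Complex (half_side * ?r * of_int a) (half_side * ?r * of_int b)" "even a \<longleftrightarrow> i = 0"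
    using vicsek_vertex_lattice[OF scale_axioms ci(1,2)] ci(3) by metis
  obtain e f :: int where ef: "y = Complex (half_side * ?r * of_int e) (half_side * ?r * of_int f)" "even e \<longleftrightarrow> j = 0"
    using vicsek_vertex_lattice[OF scale_axioms dj(1,2)] dj(3) by metis
  have "(dist x y)\<^sup>2 = ?r * ?r" using xy(3) by (simp add: power2_eq_square)
  moreover have "(dist x y)\<^sup>2 = (half_side * half_side) * (?r * ?r) * of_int ((e - a) * (e - a) + (f - b) * (f - b))"
    unfolding ab ef dist_norm cmod_power2 by (simp add: power2_eq_square algebra_simps)
  ultimately have "real_of_int ((e - a) * (e - a) + (f - b) * (f - b)) = 2"
    using r by (simp add: half_side_sq)
  then have "(e - a) * (e - a) + (f - b) * (f - b) = 2" by linarith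
  then have diff: "\<bar>e - a\<bar> = 1" "\<bar>f - b\<bar> = 1" unfolding sum_squares_eq_2_iff by auto
  then have "even a \<noteq> even e" by presburger
  have corner: "\<exists>k\<in>{1..4}. vicsek_q k = Complex (half_side * of_int m) (half_side * of_int n)"
    if "\<bar>m\<bar> = 1" "\<bar>n\<bar> = 1" for m n :: int
  proof -
    have "Complex (half_side * of_int m) (half_side * of_int n) \<in> vicsek_q ` {1..4}"
      unfolding vicsek_q_image using that by blast
    then show ?thesis by (metis imageE)
  qed
  show "(x, y) \<in> spokes n"
  proof (cases "i = 0")
    case True
    then have "x \<in> vicsek_centers l n" using ci by simp
    obtain k where k: "k \<in> {1..4}" "vicsek_q k = Complex (half_side * of_int (e - a)) (half_side * of_int (f - b))"
      using corner[OF diff] by blast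
    have "y = x + ?r *\<^sub>R vicsek_q k" unfolding k ab ef by (simp add: complex_eq_iff algebra_simps)
    then show ?thesis using spokesI[OF \<open>x \<in> vicsek_centers l n\<close> k(1)] by simp
  next
    case False
    then have "j = 0" using ab ef \<open>even a \<noteq> even e\<close> by auto
    then have "y \<in> vicsek_centers l n" using dj by simp
    have "\<bar>a - e\<bar> = 1" "\<bar>b - f\<bar> = 1" using diff by linarith+
    then obtain k where k: "k \<in> {1..4}" "vicsek_q k = Complex (half_side * of_int (a - e)) (half_side * of_int (b - f))"
      using corner by blast
    have "x = y + ?r *\<^sub>R vicsek_q k" unfolding k ab ef by (simp add: complex_eq_iff algebra_simps)
    then have "(y, x) \<in> spokes n" using spokesI[OF \<open>y \<in> vicsek_centers l n\<close> k(1)] by simp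
    then have "(x, y) \<in> prod.swap ` spokes n" by (metis image_eqI swap_simp)
    with not_swap show ?thesis by simp
  qed
qed

text \<open>By parity no vertex is both a centre and a corner, so spokes and reversed spokes are
  disjoint and contribute equally. The 2 cancels the 1/2 in the energy.\<close>

lemma sum_vicsek_edges:
  fixes g :: "complex \<Rightarrow> complex \<Rightarrow> real"
  assumes sym: "\<And>x y. g x y = g y x"
  shows "(\<Sum>(x, y)\<in>vicsek_edges l n. g x y) =
    2 * (\<Sum>c\<in>vicsek_centers l n. \<Sum>j\<in>{1..4}. g c (c + cell_radius l n *\<^sub>R vicsek_q j))"
proof -
  let ?f = "\<lambda>(x, y). g x y" and ?r = "cell_radius l n"
  have fin: "finite (vicsek_centers l n)" by (simp add: finite_vicsek_union)
  then have fin': "finite (spokes n)" by (simp add: spokes_def)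
  have "prod.swap ` spokes n \<subseteq> vicsek_edges l n"
  proof (rule image_subsetI)
    fix e assume "e \<in> spokes n"
    then have "e \<in> vicsek_edges l n" using spokes_subset by blast
    then show "prod.swap e \<in> vicsek_edges l n" by (cases e) (simp add: vicsek_edges_iff dist_commute)
  qed
  then have edges: "vicsek_edges l n = spokes n \<union> prod.swap ` spokes n"
    using spokes_subset vicsek_edges_subset_spokes by blast
  have "spokes n \<inter> prod.swap ` spokes n = {}"
  proof (rule ccontr)
    assume "\<not> ?thesis"
    then obtain x y where "(x, y) \<in> spokes n" "(x, y) \<in> prod.swap ` spokes n" by auto
    then have "(x, y) \<in> spokes n" "(y, x) \<in> spokes n" by auto
    then obtain j where x: "x \<in> vicsek_centers l n" and
      y: "y \<in> vicsek_centers l n" "j \<in> {1..4}" "x = y + ?r *\<^sub>R vicsek_q j"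
      by (auto simp: spokes_def)
    obtain a b :: int where a: "x + ?r *\<^sub>R vicsek_q 0 = Complex (half_side * ?r * of_int a) (half_side * ?r * of_int b)" "even a \<longleftrightarrow> 0 = (0::nat)"
      using vicsek_vertex_lattice[OF scale_axioms x, of 0] by auto
    have "j \<in> {0..4}" using y by auto
    obtain e f :: int where e: "x = Complex (half_side * ?r * of_int e) (half_side * ?r * of_int f)" "even e \<longleftrightarrow> j = 0"
      using vicsek_vertex_lattice[OF scale_axioms y(1) \<open>j \<in> {0..4}\<close>] y(3) by metis
    have "a = e" using a(1) e(1) half_side_pos cell_radius_pos[of n] by simp
    then show False using a e y by auto
  qed
  then have "(\<Sum>e\<in>vicsek_edges l n. ?f e) = (\<Sum>e\<in>spokes n. ?f e) + (\<Sum>e\<in>prod.swap ` spokes n. ?f e)"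
    unfolding edges using fin' by (intro sum.union_disjoint) auto
  also have "(\<Sum>e\<in>prod.swap ` spokes n. ?f e) = (\<Sum>e\<in>spokes n. ?f e)"
    by (subst sum.reindex) (auto intro!: sum.cong simp: sym)
  also have "(\<Sum>e\<in>spokes n. ?f e) = (\<Sum>(c, j)\<in>vicsek_centers l n \<times> {1..4}. g c (c + ?r *\<^sub>R vicsek_q j))"
    unfolding spokes_def
  proof (subst sum.reindex)
    show "inj_on (\<lambda>(c, j). (c, c + ?r *\<^sub>R vicsek_q j)) (vicsek_centers l n \<times> {1..4})"
      using cell_radius_pos[of n] inj_on_vicsek_q by (auto simp: inj_on_def)
  qed (simp add: o_def case_prod_unfold)
  also have "\<dots> = (\<Sum>c\<in>vicsek_centers l n. \<Sum>j\<in>{1..4}. g c (c + ?r *\<^sub>R vicsek_q j))"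
    by (simp add: sum.cartesian_product)
  finally show ?thesis by simp
qed

lemma discrete_energy_eq:
  "discrete_energy l p n u = energy_weight l p n *
    (\<Sum>c\<in>vicsek_centers l n. \<Sum>j\<in>{1..4}. \<bar>u c - u (c + cell_radius l n *\<^sub>R vicsek_q j)\<bar> powr p)"
  unfolding discrete_energy_def energy_weight_def[symmetric]
  by (subst sum_vicsek_edges) (auto simp: abs_minus_commute)

lemma discrete_energy_nonneg: "0 \<le> discrete_energy l p n u"
  unfolding discrete_energy_eq using energy_weight_nonneg by (intro mult_nonneg_nonneg sum_nonneg) auto

lemma discrete_energy_0: "discrete_energy l p 0 u = (\<Sum>j\<in>{1..4}. \<bar>u 0 - u (vicsek_q j)\<bar> powr p)"
  unfolding discrete_energy_eq by (simp add: energy_weight_0 cell_radius_0 vicsek_union_0)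

text \<open>Every spoke is indexed by its centre, and centres under different first digits are
  disjoint, so the sum over spokes splits; the factor is the ratio of the weights.\<close>

lemma discrete_energy_Suc:
  "discrete_energy l p (Suc n) u = real L powr (p - 1) * (\<Sum>d\<in>S. discrete_energy l' p n (\<lambda>z. u (F d z)))"
proof -
  let ?g = "\<lambda>c. \<Sum>j\<in>{1..4}. \<bar>u c - u (c + cell_radius l (Suc n) *\<^sub>R vicsek_q j)\<bar> powr p"
  have fin: "finite (vicsek_centers l' n)" by (simp add: finite_vicsek_union)
  have "(\<Sum>c\<in>vicsek_centers l (Suc n). ?g c) = (\<Sum>d\<in>S. \<Sum>c\<in>F d ` vicsek_centers l' n. ?g c)"
    unfolding vicsek_union_Suc
  proof (intro sum.UNION_disjoint finite_vicsek_S ballI finite_imageI fin impI)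
    fix d e assume de: "d \<in> S" "e \<in> S" "d \<noteq> e"
    show "F d ` vicsek_centers l' n \<inter> F e ` vicsek_centers l' n = {}"
    proof (rule ccontr)
      assume "\<not> ?thesis"
      then obtain y z where yz: "y \<in> vicsek_centers l' n" "z \<in> vicsek_centers l' n" "F d y = F e z" by auto
      have "y \<in> vicsek_K0" "z \<in> vicsek_K0" "\<bar>Re y\<bar> < half_side"
        using vicsek_centers_interior[OF scale_shift yz(1)] vicsek_centers_interior[OF scale_shift yz(2)]
        by (auto simp: vicsek_K0_eq)
      then show False using vicsek_cells_meet(1)[OF de _ _ yz(3)] by simp
    qed
  qed
  also have "\<dots> = (\<Sum>d\<in>S. \<Sum>c\<in>vicsek_centers l' n. ?g (F d c))"
    using vicsek_F_eq_iff[OF l_pos[of 1]] by (intro sum.cong sum.reindex[unfolded o_def] inj_onI) auto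
  finally show ?thesis
    unfolding discrete_energy_eq scale.discrete_energy_eq[OF scale_shift] vicsek_F_cell energy_weight_Suc
    by (simp add: sum_distrib_left mult.assoc)
qed

section \<open>Monotonicity of the energies and oscillation along rays\<close>

definition ray :: "nat \<Rightarrow> nat \<Rightarrow> complex" where
  "ray j i = (real i / real L) *\<^sub>R vicsek_q j"

lemma ray_0: "ray j 0 = 0" and ray_L: "ray j L = vicsek_q j"
  using L_pos by (simp_all add: ray_def)

lemma ray_in_V:
  assumes "j \<in> {1..4}" "i \<le> L"
  shows "ray j i \<in> vicsek_V l 1"
proof -
  \<comment> \<open>The digit at position \<open>2 * (i div 2)\<close>: for even \<open>i\<close>
    the point is the centre of its cell, for odd \<open>i\<close> the corner of that cell pointing
    outward.\<close>
  define d :: complex where "d = of_nat (2 * (i div 2)) / of_nat L * vicsek_q j"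
  have "odd L" using l_odd[of 1] by simp
  show ?thesis
  proof (cases "even i")
    case True
    then have "i < L" using assms \<open>odd L\<close> by (metis le_neq_implies_less)
    have "d \<in> S" unfolding d_def using assms \<open>i < L\<close> by (intro vicsek_SI) linarith+
    moreover have "ray j i = F d (vicsek_q 0)"
      using True by (simp add: ray_def vicsek_F_def d_def scaleR_conv_of_real)
    moreover have "vicsek_q 0 \<in> vicsek_q ` {0..4}" by (rule imageI) simp
    ultimately show ?thesis unfolding vicsek_V_eq One_nat_def vicsek_union_Suc[of l 0] vicsek_union_0 by blast
  next
    case False
    then have i: "i = 2 * (i div 2) + 1" by presburger
    have "d \<in> S" unfolding d_def using assms i by (intro vicsek_SI) linarith+
    moreover have "ray j i = F d (vicsek_q j)"
      unfolding ray_def by (subst i) (simp add: vicsek_F_def d_def scaleR_conv_of_real add_divide_distrib algebra_simps)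
    moreover have "vicsek_q j \<in> vicsek_q ` {0..4}" using assms by (intro imageI) auto
    ultimately show ?thesis unfolding vicsek_V_eq One_nat_def vicsek_union_Suc[of l 0] vicsek_union_0 by blast
  qed
qed

text \<open>The four rays traverse distinct edges of level 1, each counted in both orientations; the
  remaining edges contribute nonnegative terms and are dropped.\<close>

lemma ray_energy_le:
  "real L powr (p - 1) * (\<Sum>j\<in>{1..4}. \<Sum>i<L. \<bar>u (ray j (Suc i)) - u (ray j i)\<bar> powr p) \<le> discrete_energy l p 1 u"
proof -
  let ?f = "\<lambda>(x, y). \<bar>u x - u y\<bar> powr p"
  define A where "A = (\<lambda>(j, i). (ray j i, ray j (Suc i))) ` ({1..4} \<times> {..<L})"
  have norm_ray: "norm (ray j i) = real i / real L" if "j \<in> {1..4}" for i j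
    using norm_vicsek_q[OF that] by (simp add: ray_def)
  have sub: "A \<subseteq> vicsek_edges l 1"
  proof
    fix e assume "e \<in> A"
    then obtain j i where ji: "j \<in> {1..4}" "i < L" "e = (ray j i, ray j (Suc i))" by (auto simp: A_def)
    have "ray j i - ray j (Suc i) = - (1 / real L) *\<^sub>R vicsek_q j"
      by (simp add: ray_def scaleR_diff_left[symmetric] diff_divide_distrib[symmetric])
    then have "dist (ray j i) (ray j (Suc i)) = cell_radius l 1"
      using norm_vicsek_q[OF ji(1)] cell_radius_Suc[of 0] scale.cell_radius_0[OF scale_shift]
      by (simp add: dist_norm)
    then show "e \<in> vicsek_edges l 1" using ji ray_in_V[OF ji(1), of i] ray_in_V[OF ji(1), of "Suc i"]
      by (simp add: vicsek_edges_iff)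
  qed
  have "finite (vicsek_V l 1)" by (simp add: vicsek_V_eq finite_vicsek_union)
  moreover have "vicsek_edges l 1 \<subseteq> vicsek_V l 1 \<times> vicsek_V l 1" by (auto simp: vicsek_edges_iff)
  ultimately have "finite (vicsek_edges l 1)" by (meson finite_SigmaI finite_subset)
  have inj: "inj_on (\<lambda>(j, i). (ray j i, ray j (Suc i))) ({1..4} \<times> {..<L})"
  proof (intro inj_onI, clarify)
    fix j i k m assume *: "j \<in> {1..4::nat}" "k \<in> {1..4::nat}" "ray j i = ray k m" "ray j (Suc i) = ray k (Suc m)"
    then have "real i / real L = real m / real L" using norm_ray by metis
    then have "i = m" using L_pos by simp
    then have "vicsek_q j = vicsek_q k" using *(4) L_pos by (simp add: ray_def)
    then show "j = k \<and> i = m" using *(1,2) \<open>i = m\<close> inj_on_vicsek_q by (auto dest: inj_onD)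
  qed
  \<comment> \<open>Moduli grow outward along a ray, so no pair in \<open>A\<close> is the reverse
    of another.\<close>
  have incr: "norm x < norm y" if "(x, y) \<in> A" for x y
    using that L_pos unfolding A_def by (auto simp: norm_ray divide_strict_right_mono simp del: of_nat_Suc)
  have disj: "A \<inter> prod.swap ` A = {}" using incr by (force dest: incr)
  have "A \<union> prod.swap ` A \<subseteq> vicsek_edges l 1"
    using sub by (auto simp: vicsek_edges_iff dist_commute)
  then have "(\<Sum>e\<in>A \<union> prod.swap ` A. ?f e) \<le> (\<Sum>e\<in>vicsek_edges l 1. ?f e)"
    using \<open>finite (vicsek_edges l 1)\<close> by (intro sum_mono2) auto
  also have "(\<Sum>e\<in>A \<union> prod.swap ` A. ?f e) = (\<Sum>e\<in>A. ?f e) + (\<Sum>e\<in>prod.swap ` A. ?f e)"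
    using disj by (intro sum.union_disjoint) (auto simp: A_def)
  also have "(\<Sum>e\<in>prod.swap ` A. ?f e) = (\<Sum>e\<in>A. ?f e)"
    by (subst sum.reindex) (auto intro!: sum.cong simp: abs_minus_commute)
  also have "(\<Sum>e\<in>A. ?f e) = (\<Sum>(j, i)\<in>{1..4} \<times> {..<L}. \<bar>u (ray j (Suc i)) - u (ray j i)\<bar> powr p)"
    unfolding A_def using inj by (subst sum.reindex) (auto simp: o_def case_prod_unfold abs_minus_commute)
  finally have le: "2 * (\<Sum>j\<in>{1..4}. \<Sum>i<L. \<bar>u (ray j (Suc i)) - u (ray j i)\<bar> powr p) \<le> (\<Sum>e\<in>vicsek_edges l 1. ?f e)"
    by (simp add: sum.cartesian_product)
  have "energy_weight l p 1 = real L powr (p - 1)"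
    using energy_weight_Suc[of p 0] scale.energy_weight_0[OF scale_shift] by simp
  then have "discrete_energy l p 1 u = real L powr (p - 1) * (1 / 2 * (\<Sum>e\<in>vicsek_edges l 1. ?f e))"
    unfolding discrete_energy_def energy_weight_def[symmetric] by simp
  also have "\<dots> \<ge> real L powr (p - 1) * (\<Sum>j\<in>{1..4}. \<Sum>i<L. \<bar>u (ray j (Suc i)) - u (ray j i)\<bar> powr p)"
    using le by (intro mult_left_mono) auto
  finally show ?thesis .
qed

lemma ray_diff_le:
  assumes "1 < p" "m \<le> L"
  shows "\<bar>u (ray j m) - u 0\<bar> powr p \<le> real L powr (p - 1) * (\<Sum>i<L. \<bar>u (ray j (Suc i)) - u (ray j i)\<bar> powr p)"
proof -
  have "u (ray j m) - u 0 = (\<Sum>i<m. u (ray j (Suc i)) - u (ray j i))"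
    using sum_lessThan_telescope[of "\<lambda>i. u (ray j i)" m] by (simp add: ray_0)
  then have "\<bar>u (ray j m) - u 0\<bar> powr p \<le> real m powr (p - 1) * (\<Sum>i<m. \<bar>u (ray j (Suc i)) - u (ray j i)\<bar> powr p)"
    using powr_sum_le[OF assms(1), of "{..<m}" "\<lambda>i. u (ray j (Suc i)) - u (ray j i)"] by simp
  also have "\<dots> \<le> real L powr (p - 1) * (\<Sum>i<L. \<bar>u (ray j (Suc i)) - u (ray j i)\<bar> powr p)"
    using assms by (intro mult_mono powr_mono2 sum_mono2 sum_nonneg) auto
  finally show ?thesis .
qed

text \<open>A spoke of level 0 is cut into \<open>L\<close> edges of level 1, and the Jensen factor
  \<open>L powr (p - 1)\<close> equals the ratio of the weights.\<close>

lemma discrete_energy_0_le_1: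
  assumes "1 < p"
  shows "discrete_energy l p 0 u \<le> discrete_energy l p 1 u"
proof -
  have "discrete_energy l p 0 u = (\<Sum>j\<in>{1..4}. \<bar>u (ray j L) - u 0\<bar> powr p)"
    unfolding discrete_energy_0 ray_L by (simp add: abs_minus_commute)
  also have "\<dots> \<le> (\<Sum>j\<in>{1..4}. real L powr (p - 1) * (\<Sum>i<L. \<bar>u (ray j (Suc i)) - u (ray j i)\<bar> powr p))"
    by (intro sum_mono ray_diff_le assms order_refl)
  also have "\<dots> \<le> discrete_energy l p 1 u" using ray_energy_le by (simp add: sum_distrib_left)
  finally show ?thesis .
qed

text \<open>Every digit sits at an even position on one of the rays, whose energy is part of the
  total.\<close>

lemma center_1_diff_le:
  assumes "1 < p" "d \<in> S"
  shows "\<bar>u d - u 0\<bar> powr p \<le> discrete_energy l p 1 u"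
proof -
  obtain n j where nj: "n \<le> (L - 1) div 2" "j \<in> {1..4}" "d = of_nat (2 * n) / of_nat L * vicsek_q j"
    using assms(2) unfolding vicsek_S_def by blast
  have "d = ray j (2 * n)" using nj by (simp add: ray_def scaleR_conv_of_real)
  moreover have "2 * n \<le> L" using nj by linarith
  ultimately have "\<bar>u d - u 0\<bar> powr p \<le> real L powr (p - 1) * (\<Sum>i<L. \<bar>u (ray j (Suc i)) - u (ray j i)\<bar> powr p)"
    using ray_diff_le[OF assms(1)] by simp
  also have "\<dots> \<le> (\<Sum>j\<in>{1..4}. real L powr (p - 1) * (\<Sum>i<L. \<bar>u (ray j (Suc i)) - u (ray j i)\<bar> powr p))"
    using nj by (intro member_le_sum mult_nonneg_nonneg sum_nonneg) auto
  also have "\<dots> \<le> discrete_energy l p 1 u" using ray_energy_le by (simp add: sum_distrib_left)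
  finally show ?thesis .
qed

end

lemma discrete_energy_mono_Suc:
  assumes "scale l" "1 < p"
  shows "discrete_energy l p n u \<le> discrete_energy l p (Suc n) u"
  using assms
proof (induction n arbitrary: l u)
  case 0
  then show ?case using scale.discrete_energy_0_le_1 by fastforce
next
  case (Suc n)
  then interpret scale l by simp
  show ?case unfolding discrete_energy_Suc[of p n] discrete_energy_Suc[of p "Suc n"]
    by (intro mult_left_mono sum_mono Suc.IH[OF scale_shift assms(2)]) auto
qed

lemma discrete_energy_mono:
  assumes "scale l" "1 < p" "m \<le> n"
  shows "discrete_energy l p m u \<le> discrete_energy l p n u"
  using lift_Suc_mono_le[of "\<lambda>n. discrete_energy l p n u"] discrete_energy_mono_Suc[OF assms(1,2)] assms(3) by blast

text \<open>The sum of the geometric series with ratio \<open>(1/3) powr (1 - 1 / p)\<close>: the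
  root of the energy inside a cell gains a factor \<open>L powr - (1 - 1 / p)\<close>, and
  \<open>L \<ge> 3\<close> makes the bound independent of the sequence.\<close>

definition oscillation_const :: "real \<Rightarrow> real" where
  "oscillation_const p = 1 / (1 - (1/3) powr (1 - 1 / p))"

lemma oscillation_const:
  assumes "1 < p"
  shows "0 < oscillation_const p" "oscillation_const p = 1 + (1/3) powr (1 - 1 / p) * oscillation_const p"
proof -
  have "(1/3::real) powr (1 - 1 / p) < 1 powr (1 - 1 / p)"
    using assms by (intro powr_less_mono2) auto
  then have less: "(1/3::real) powr (1 - 1 / p) < 1" by simp
  have "1 / (1 - t) = 1 + t * (1 / (1 - t))" if "t < 1" for t :: real
    using that by (simp add: field_simps)
  from this[OF less] show "oscillation_const p = 1 + (1/3) powr (1 - 1 / p) * oscillation_const p"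
    unfolding oscillation_const_def .
  show "0 < oscillation_const p" using less by (simp add: oscillation_const_def)
qed

text \<open>Go to the centre of the first-level cell, then on inside it by induction. The identity
  \<open>B = 1 + t * B\<close> satisfied by the constant closes the step.\<close>

lemma center_oscillation:
  assumes "scale l" "1 < p" "c \<in> vicsek_centers l n"
  shows "\<bar>u c - u 0\<bar> \<le> oscillation_const p * discrete_energy l p n u powr (1 / p)"
  using assms
proof (induction n arbitrary: l c u)
  case 0
  then show ?case using oscillation_const(1)[OF assms(2)] by (simp add: vicsek_union_0)
next
  case (Suc n)
  then interpret scale l by simp
  let ?B = "oscillation_const p" and ?E = "discrete_energy l p (Suc n) u" and ?t = "(1/3::real) powr (1 - 1 / p)"
  note E_nonneg = scale.discrete_energy_nonneg[OF scale_shift]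
  obtain d y where d: "d \<in> S" "y \<in> vicsek_centers l' n" "c = F d y"
    using Suc.prems(3) unfolding vicsek_union_Suc by blast
  have root: "a \<le> b powr (1 / p)" if "a powr p \<le> b" "0 \<le> a" for a b
  proof -
    have "(a powr p) powr (1 / p) \<le> b powr (1 / p)" using that assms(2) by (intro powr_mono2) auto
    then show ?thesis using that assms(2) by (simp add: powr_powr)
  qed
  have "\<bar>u d - u 0\<bar> powr p \<le> discrete_energy l p 1 u" by (rule center_1_diff_le[OF assms(2) d(1)])
  also have "\<dots> \<le> ?E" using discrete_energy_mono[OF scale_axioms assms(2), of 1 "Suc n"] by simp
  finally have 1: "\<bar>u d - u 0\<bar> \<le> ?E powr (1 / p)" by (intro root) auto
  let ?e = "discrete_energy l' p n (\<lambda>z. u (F d z))"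
  have "real L powr (p - 1) * ?e \<le> ?E"
    unfolding discrete_energy_Suc using d(1) finite_vicsek_S E_nonneg
    by (intro mult_left_mono member_le_sum) auto
  then have "?e \<le> real L powr - (p - 1) * ?E"
  proof -
    define w where "w = real L powr (p - 1)"
    have "w > 0" using L_pos by (simp add: w_def)
    moreover have "w * ?e \<le> ?E" using \<open>real L powr (p - 1) * ?e \<le> ?E\<close> by (simp add: w_def)
    ultimately have "?e \<le> inverse w * ?E" by (simp add: field_simps)
    then show ?thesis by (simp only: w_def powr_minus)
  qed
  also have "\<dots> \<le> 3 powr - (p - 1) * ?E"
    using L_ge_3 assms(2) discrete_energy_nonneg by (intro mult_right_mono powr_mono2') auto
  finally have "?e powr (1 / p) \<le> (3 powr - (p - 1) * ?E) powr (1 / p)"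
    using E_nonneg assms(2) by (intro powr_mono2) auto
  also have "\<dots> = ?t * ?E powr (1 / p)"
  proof -
    have "- (p - 1) * (1 / p) = - (1 - 1 / p)" using assms(2) by (simp add: field_simps)
    then have "(3 powr - (p - 1)) powr (1 / p) = 3 powr - (1 - 1 / p)" by (simp only: powr_powr)
    moreover have "?t = 3 powr - (1 - 1 / p)"
      by (simp only: powr_divide powr_one_eq_one powr_minus_divide)
    ultimately show ?thesis by (simp only: powr_mult)
  qed
  finally have "?B * ?e powr (1 / p) \<le> ?B * (?t * ?E powr (1 / p))"
    using oscillation_const(1)[OF assms(2)] by (intro mult_left_mono) auto
  moreover have "\<bar>u (F d y) - u (F d 0)\<bar> \<le> ?B * ?e powr (1 / p)"
    by (rule Suc.IH[OF scale_shift assms(2) d(2)])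
  moreover have "F d 0 = d" by (simp add: vicsek_F_def)
  ultimately have "\<bar>u c - u 0\<bar> \<le> (1 + ?t * ?B) * ?E powr (1 / p)"
    using 1 d(3) by (simp add: algebra_simps)
  then show ?case using oscillation_const(2)[OF assms(2)] by simp
qed

section \<open>The Sobolev space\<close>

lemma tendsto_abs_powr:
  fixes f :: "'a \<Rightarrow> real"
  assumes "(f \<longlongrightarrow> a) F" "0 < p"
  shows "((\<lambda>x. \<bar>f x\<bar> powr p) \<longlongrightarrow> \<bar>a\<bar> powr p) F"
  using assms by (intro tendsto_powr2 tendsto_rabs tendsto_const) auto

lemma powr_inverse_le_iff:
  fixes a b p :: real
  assumes "0 < p" "0 \<le> a" "0 \<le> b"
  shows "a \<le> b powr (1 / p) \<longleftrightarrow> a powr p \<le> b"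
proof
  assume "a \<le> b powr (1 / p)"
  then have "a powr p \<le> (b powr (1 / p)) powr p" using assms by (intro powr_mono2) auto
  then show "a powr p \<le> b" using assms by (simp add: powr_powr)
next
  assume "a powr p \<le> b"
  then have "(a powr p) powr (1 / p) \<le> b powr (1 / p)" using assms by (intro powr_mono2) auto
  then show "a \<le> b powr (1 / p)" using assms by (simp add: powr_powr)
qed

lemma subspace_cont_space: "subspace (cont_space K)"
  unfolding cont_space_def
  by (rule subspaceI) (auto simp: scaleR_fun_def plus_fun_def zero_fun_def intro!: continuous_intros)

lemma cont_space_bounded:
  assumes "compact K" "u \<in> cont_space K"
  shows "bdd_above ((\<lambda>x. \<bar>u x\<bar>) ` K)"
proof -
  have "compact ((\<lambda>x. \<bar>u x\<bar>) ` K)"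
    using assms by (intro compact_continuous_image continuous_intros) (auto simp: cont_space_def)
  then show ?thesis by (intro bounded_imp_bdd_above compact_imp_bounded)
qed

lemma abs_le_sup_norm:
  assumes "compact K" "u \<in> cont_space K" "K \<noteq> {}"
  shows "\<bar>u x\<bar> \<le> sup_norm K u"
proof -
  have *: "\<bar>u x\<bar> \<le> sup_norm K u" if "x \<in> K" for x
    unfolding sup_norm_def by (intro cSUP_upper that cont_space_bounded assms)
  show ?thesis
  proof (cases "x \<in> K")
    case False
    obtain y where "y \<in> K" using assms(3) by blast
    then have "0 \<le> sup_norm K u" using *[of y] by linarith
    then show ?thesis using False assms(2) by (simp add: cont_space_def)
  qed (rule *)
qed

lemma p_energy_discrete_energy:
  assumes "1 < p"
  shows "p_energy UNIV p (discrete_energy l p n)"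
proof -
  have "p_energy UNIV p (\<lambda>u. \<bar>u x - u y\<bar> powr p)" for x y :: complex
    using assms by (intro p_energy_abs_linear) (auto simp: scaleR_fun_def algebra_simps)
  then have "p_energy UNIV p (\<lambda>u. \<Sum>e\<in>vicsek_edges l n. (case e of (x, y) \<Rightarrow> \<bar>u x - u y\<bar> powr p))"
    using assms by (intro p_energy_sum) (auto split: prod.split)
  then have "p_energy UNIV p (\<lambda>u. (1/2 * (\<Prod>j=0..n. real (l j) powr (p - 1))) *
      (\<Sum>e\<in>vicsek_edges l n. (case e of (x, y) \<Rightarrow> \<bar>u x - u y\<bar> powr p)))"
    by (intro p_energy_cmult) (auto intro!: prod_nonneg)
  then show ?thesis unfolding discrete_energy_def .
qed

lemma discrete_energy_tendsto:
  assumes "0 < p" "\<And>x. x \<in> vicsek_V l k \<Longrightarrow> (\<lambda>n. s n x) \<longlonglongrightarrow> u x"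
  shows "(\<lambda>n. discrete_energy l p k (s n)) \<longlonglongrightarrow> discrete_energy l p k u"
  unfolding discrete_energy_def case_prod_unfold
  by (intro tendsto_mult tendsto_const tendsto_sum tendsto_abs_powr tendsto_diff assms)
    (auto simp: vicsek_edges_def)

text \<open>Turns pointwise bounds on increments into bounds on energies; sums, products and
  Lipschitz images are all handled through it.\<close>

lemma discrete_energy_le:
  assumes "scale l" "\<And>x y. x \<in> vicsek_set l \<Longrightarrow> y \<in> vicsek_set l \<Longrightarrow> \<bar>u x - u y\<bar> powr p \<le>
    a * \<bar>v x - v y\<bar> powr p + b * \<bar>w x - w y\<bar> powr p"
  shows "discrete_energy l p n u \<le> a * discrete_energy l p n v + b * discrete_energy l p n w"
proof -
  let ?c = "1/2 * (\<Prod>j=0..n. real (l j) powr (p - 1))"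
  have "(\<Sum>(x, y)\<in>vicsek_edges l n. \<bar>u x - u y\<bar> powr p) \<le>
      (\<Sum>(x, y)\<in>vicsek_edges l n. a * \<bar>v x - v y\<bar> powr p + b * \<bar>w x - w y\<bar> powr p)"
    using assms(2) vicsek_V_subset[OF assms(1)] by (intro sum_mono) (auto simp: vicsek_edges_def subset_iff)
  then have "?c * (\<Sum>(x, y)\<in>vicsek_edges l n. \<bar>u x - u y\<bar> powr p) \<le>
      ?c * (\<Sum>(x, y)\<in>vicsek_edges l n. a * \<bar>v x - v y\<bar> powr p + b * \<bar>w x - w y\<bar> powr p)"
    by (intro mult_left_mono) (auto intro!: prod_nonneg)
  also have "\<dots> = a * discrete_energy l p n v + b * discrete_energy l p n w"
    unfolding discrete_energy_def
    by (simp add: case_prod_unfold sum.distrib sum_distrib_left[symmetric] algebra_simps)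
  finally show ?thesis unfolding discrete_energy_def .
qed

locale vicsek = scale +
  fixes p :: real
  assumes p: "1 < p"
begin

abbreviation "K \<equiv> vicsek_set l"

lemma vicsek_shift: "vicsek (shift_scale l) p"
  using scale_shift p by (simp add: vicsek_def vicsek_axioms_def)

lemma compact_K: "compact K"
  by (rule compact_vicsek_set[OF scale_axioms])

lemma zero_in_K: "0 \<in> K"
  using vicsek_q_in_set[OF scale_axioms, of 0] by simp

lemma K_not_empty: "K \<noteq> {}"
  using zero_in_K by blast

lemma discrete_energy_add_le:
  "discrete_energy l p n (u + v) \<le> 2 powr (p - 1) * (discrete_energy l p n u + discrete_energy l p n v)"
proof -
  have "\<bar>(u + v) x - (u + v) y\<bar> powr p \<le>
      2 powr (p - 1) * \<bar>u x - u y\<bar> powr p + 2 powr (p - 1) * \<bar>v x - v y\<bar> powr p" for x y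
    using powr_add_le[OF p, of "u x - u y" "v x - v y"] by (simp add: algebra_simps)
  then show ?thesis
    using discrete_energy_le[OF scale_axioms, of "u + v" p "2 powr (p - 1)" u "2 powr (p - 1)" v n]
    by (simp add: algebra_simps)
qed

lemma sobolev_spaceI:
  assumes "u \<in> cont_space K" "\<And>n. discrete_energy l p n u \<le> B"
  shows "u \<in> sobolev_space l p" "energy l p u \<le> B"
  using assms unfolding sobolev_space_def energy_def by (auto intro!: bdd_aboveI cSUP_least)

lemma sobolev_space_cont: "u \<in> sobolev_space l p \<Longrightarrow> u \<in> cont_space K"
  by (simp add: sobolev_space_def)

lemma discrete_energy_le_energy:
  "u \<in> sobolev_space l p \<Longrightarrow> discrete_energy l p n u \<le> energy l p u"
  unfolding energy_def by (intro cSUP_upper) (auto simp: sobolev_space_def)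

lemma discrete_energy_tendsto_energy:
  assumes "u \<in> sobolev_space l p"
  shows "(\<lambda>n. discrete_energy l p n u) \<longlonglongrightarrow> energy l p u"
  unfolding energy_def
  by (rule LIMSEQ_incseq_SUP)
    (use assms discrete_energy_mono[OF scale_axioms p] in \<open>auto simp: sobolev_space_def incseq_def\<close>)

lemma subspace_sobolev_space: "subspace (sobolev_space l p)"
proof (rule subspaceI)
  interpret D: p_energy UNIV p "discrete_energy l p n" for n by (rule p_energy_discrete_energy[OF p])
  have "discrete_energy l p n 0 = 0" for n using D.homogeneous[of 0 _ 0] p by simp
  then show "0 \<in> sobolev_space l p"
    using subspace_0[OF subspace_cont_space] by (intro sobolev_spaceI[of 0 0]) auto
  show "u + v \<in> sobolev_space l p" if "u \<in> sobolev_space l p" "v \<in> sobolev_space l p" for u v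
  proof (rule sobolev_spaceI)
    show "u + v \<in> cont_space K" using that by (intro subspace_add[OF subspace_cont_space] sobolev_space_cont)
    show "discrete_energy l p n (u + v) \<le> 2 powr (p - 1) * (energy l p u + energy l p v)" for n
      by (rule order_trans[OF discrete_energy_add_le])
        (intro mult_left_mono add_mono discrete_energy_le_energy that; simp)
  qed
  show "c *\<^sub>R u \<in> sobolev_space l p" if "u \<in> sobolev_space l p" for c u
  proof (rule sobolev_spaceI)
    show "c *\<^sub>R u \<in> cont_space K" using that by (intro subspace_scale[OF subspace_cont_space] sobolev_space_cont)
    show "discrete_energy l p n (c *\<^sub>R u) \<le> \<bar>c\<bar> powr p * energy l p u" for n
      using that by (simp add: D.homogeneous mult_left_mono discrete_energy_le_energy)
  qed
qed

lemma p_energy_energy: "p_energy (sobolev_space l p) p (energy l p)"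
  by (rule p_energy_limit[where \<Phi> = "\<lambda>n. discrete_energy l p n", OF p_energy_subspace[OF p_energy_discrete_energy[OF p]]])
    (auto simp: subspace_sobolev_space discrete_energy_tendsto_energy)

sublocale E: p_energy "sobolev_space l p" p "energy l p"
  by (rule p_energy_energy)

text \<open>Centres of cells containing \<open>x\<close> converge to \<open>x\<close>, and
  continuity carries the bound over from the centres.\<close>

lemma oscillation:
  assumes "u \<in> sobolev_space l p" "x \<in> K"
  shows "\<bar>u x - u 0\<bar> \<le> oscillation_const p * energy l p u powr (1 / p)"
proof -
  have "\<exists>c. c \<in> vicsek_centers l n \<and> c \<in> K \<and> dist c x \<le> cell_radius l n" for n
  proof -
    have "x \<in> vicsek_union l n vicsek_K0" using assms(2) unfolding vicsek_set_eq'[OF scale_axioms] by blast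
    then obtain c z where cz: "c \<in> vicsek_centers l n" "z \<in> vicsek_K0" "x = c + cell_radius l n *\<^sub>R z"
      unfolding vicsek_union_eq_centers[OF scale_axioms, of n vicsek_K0] by blast
    have "dist c x \<le> cell_radius l n"
      using cz norm_le_1_vicsek_K0[OF cz(2)] cell_radius_pos[of n] by (simp add: dist_norm mult_left_le)
    moreover have "vicsek_centers l n \<subseteq> K"
      using vicsek_q_0 by (intro vicsek_union_subset_set[OF scale_axioms]) force
    ultimately show ?thesis using cz by blast
  qed
  then obtain c where c: "\<And>n. c n \<in> vicsek_centers l n" "\<And>n. c n \<in> K" "\<And>n. dist (c n) x \<le> cell_radius l n"
    by metis
  have "(\<lambda>n. dist (c n) x) \<longlonglongrightarrow> 0"
    by (rule tendsto_sandwich[OF _ _ tendsto_const cell_radius_tendsto_0[OF scale_axioms]]) (use c in auto)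
  then have "c \<longlonglongrightarrow> x" using tendsto_dist_iff by blast
  then have "(\<lambda>n. u (c n)) \<longlonglongrightarrow> u x"
    using assms c(2) sobolev_space_cont[OF assms(1)] unfolding cont_space_def continuous_on_sequentially
    by (auto simp: o_def)
  then have lim: "(\<lambda>n. \<bar>u (c n) - u 0\<bar>) \<longlonglongrightarrow> \<bar>u x - u 0\<bar>" by (intro tendsto_intros)
  have "\<bar>u (c n) - u 0\<bar> \<le> oscillation_const p * energy l p u powr (1 / p)" for n
    using center_oscillation[OF scale_axioms p c(1), of u n] p oscillation_const(1)[OF p]
      discrete_energy_le_energy[OF assms(1), of n] discrete_energy_nonneg[of p n u]
    by (meson less_imp_le mult_left_mono order_trans powr_mono2 zero_le_divide_1_iff zero_less_one)
  then show ?thesis using lim by (intro LIMSEQ_le_const2[OF lim]) auto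
qed

end

section \<open>The Sobolev norm: sup-norm bound, completeness and convexity\<close>

locale vicsek_prob = vicsek +
  fixes M :: "complex measure"
  assumes sets_M: "sets M = sets (restrict_space borel (vicsek_set l))"
    and emeasure_M: "emeasure M (space M) = 1"
begin

lemma space_M: "space M = K"
  using sets_eq_imp_space_eq[OF sets_M] by (simp add: space_restrict_space)

lemma measure_K: "measure M K = 1"
  using emeasure_M by (simp add: space_M measure_def)

sublocale M: finite_measure M
  by standard (simp add: emeasure_M)

lemma integrable_continuous:
  assumes "continuous_on K f"
  shows "integrable M (f :: complex \<Rightarrow> real)"
proof -
  have "bounded (f ` K)" using assms compact_K by (intro compact_imp_bounded compact_continuous_image)
  then obtain B where B: "\<forall>x\<in>K. norm (f x) \<le> B" by (auto simp: bounded_iff)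
  have "f \<in> borel_measurable (restrict_space borel K)"
    by (rule borel_measurable_continuous_on_restrict[OF assms])
  then have "f \<in> borel_measurable M" using measurable_cong_sets[OF sets_M refl] by blast
  then show ?thesis
    using B by (intro M.integrable_const_bound[of _ B]) (auto simp: space_M)
qed

lemma integrable_abs_powr:
  assumes "u \<in> cont_space K"
  shows "integrable M (\<lambda>x. \<bar>u x\<bar> powr p)"
  using assms p by (intro integrable_continuous continuous_on_powr' continuous_intros) (auto simp: cont_space_def)

definition Lp_energy :: "(complex \<Rightarrow> real) \<Rightarrow> real" where
  "Lp_energy u = (\<integral>x. \<bar>u x\<bar> powr p \<partial>M) + energy l p u"

lemma p_energy_Lp_energy: "p_energy (sobolev_space l p) p Lp_energy"
  unfolding Lp_energy_def
proof (intro p_energy_add p_energy_energy p_energy_integral subspace_sobolev_space p)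
  show "p_energy (sobolev_space l p) p (\<lambda>u. \<bar>u z\<bar> powr p)" for z
    by (intro p_energy_abs_linear subspace_sobolev_space p) (auto simp: scaleR_fun_def)
qed (rule integrable_abs_powr[OF sobolev_space_cont])

sublocale N: p_energy "sobolev_space l p" p Lp_energy
  by (rule p_energy_Lp_energy)

lemma sobolev_norm_eq: "sobolev_norm l M p = N.root_norm"
  by (simp add: fun_eq_iff sobolev_norm_def N.root_norm_def Lp_energy_def)

abbreviation "N \<equiv> sobolev_norm l M p"

lemma integral_powr_le:
  assumes "0 \<le> a" "\<And>x. x \<in> K \<Longrightarrow> \<bar>u x\<bar> \<le> a"
  shows "(\<integral>x. \<bar>u x\<bar> powr p \<partial>M) \<le> a powr p"
\<comment> \<open>A non-integrable function has Bochner integral 0, so the bound holds in that case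
  too.\<close>
proof (cases "integrable M (\<lambda>x. \<bar>u x\<bar> powr p)")
  case True
  have "(\<integral>x. \<bar>u x\<bar> powr p \<partial>M) \<le> (\<integral>x. a powr p \<partial>M)"
    using True assms p by (intro integral_mono powr_mono2) (auto simp: space_M)
  then show ?thesis by (simp add: measure_K space_M)
qed (simp add: not_integrable_integral_eq)

lemma powr_le_integral:
  assumes "u \<in> cont_space K" "0 \<le> a" "\<And>x. x \<in> K \<Longrightarrow> a \<le> \<bar>u x\<bar>"
  shows "a powr p \<le> (\<integral>x. \<bar>u x\<bar> powr p \<partial>M)"
proof -
  have "(\<integral>x. a powr p \<partial>M) \<le> (\<integral>x. \<bar>u x\<bar> powr p \<partial>M)"
    using integrable_abs_powr[OF assms(1)] assms p by (intro integral_mono powr_mono2) (auto simp: space_M)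
  then show ?thesis by (simp add: measure_K space_M)
qed

lemma energy_le_Lp_energy: "energy l p u \<le> Lp_energy u"
  unfolding Lp_energy_def by (simp add: integral_nonneg_AE)

lemma integral_le_Lp_energy: "u \<in> sobolev_space l p \<Longrightarrow> (\<integral>x. \<bar>u x\<bar> powr p \<partial>M) \<le> Lp_energy u"
  unfolding Lp_energy_def using E.nonneg by simp

text \<open>If the absolute value at 0 were large, it would be large on all of \<open>K\<close> up
  to the oscillation, and with total mass 1 so would the integral. Norm convergence therefore
  implies uniform convergence.\<close>

lemma abs_le_sobolev_norm:
  assumes u: "u \<in> sobolev_space l p"
  shows "\<bar>u x\<bar> \<le> (2 * oscillation_const p + 1) * N u"
proof (cases "x \<in> K")
  case True
  define osc where "osc = oscillation_const p * energy l p u powr (1 / p)"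
  have "energy l p u powr (1 / p) \<le> N u"
    unfolding sobolev_norm_eq N.root_norm_def using p E.nonneg[OF u] energy_le_Lp_energy by (intro powr_mono2) auto
  then have osc: "osc \<le> oscillation_const p * N u"
    unfolding osc_def using oscillation_const(1)[OF p] by (intro mult_left_mono) auto
  \<comment> \<open>The truncation keeps \<open>m\<close> nonnegative, as comparing powers
    requires.\<close>
  define m where "m = max 0 (\<bar>u 0\<bar> - osc)"
  have "m powr p \<le> (\<integral>x. \<bar>u x\<bar> powr p \<partial>M)"
  proof (rule powr_le_integral[OF sobolev_space_cont[OF u]])
    fix y assume "y \<in> K"
    then have "\<bar>u y - u 0\<bar> \<le> osc" unfolding osc_def by (rule oscillation[OF u])
    then show "m \<le> \<bar>u y\<bar>" unfolding m_def by linarith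
  qed (simp add: m_def)
  also have "\<dots> \<le> Lp_energy u" by (rule integral_le_Lp_energy[OF u])
  finally have "m \<le> N u"
    unfolding sobolev_norm_eq N.root_norm_def using p N.nonneg[OF u]
    by (subst powr_inverse_le_iff) (auto simp: m_def)
  then have "\<bar>u 0\<bar> \<le> osc + N u" unfolding m_def by linarith
  moreover have "\<bar>u x - u 0\<bar> \<le> osc" unfolding osc_def by (rule oscillation[OF u True])
  ultimately have "\<bar>u x\<bar> \<le> 2 * osc + N u" by linarith
  also have "\<dots> \<le> (2 * oscillation_const p + 1) * N u" using osc by (simp add: algebra_simps)
  finally show ?thesis .
next
  case False
  then have "u x = 0" using sobolev_space_cont[OF u] by (simp add: cont_space_def)
  then show ?thesis using oscillation_const(1)[OF p] by (simp add: sobolev_norm_eq N.root_norm_def)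
qed

lemma normed_space_sobolev: "normed_space_on (sobolev_space l p) N"
  unfolding normed_space_on_def
proof (intro conjI ballI impI)
  show "seminorm_on (sobolev_space l p) N" unfolding sobolev_norm_eq by (rule N.seminorm_on_root_norm)
  show "u = 0" if "u \<in> sobolev_space l p" "N u = 0" for u
    using abs_le_sobolev_norm[OF that(1)] that(2) by (simp add: fun_eq_iff)
qed

lemma sobolev_norm_le:
  assumes "u \<in> sobolev_space l p" "0 \<le> a" "\<And>x. x \<in> K \<Longrightarrow> \<bar>u x\<bar> \<le> a" "energy l p u \<le> a powr p"
  shows "N u \<le> 2 powr (1 / p) * a"
proof -
  have "Lp_energy u \<le> 2 * a powr p"
    unfolding Lp_energy_def using integral_powr_le[of a u, OF assms(2,3)] assms(4) by simp
  also have "\<dots> = (2 powr (1 / p) * a) powr p" using p by (simp add: powr_mult powr_powr)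
  finally show ?thesis
    unfolding sobolev_norm_eq using N.root_norm_le_iff[OF assms(1)] assms(2) by simp
qed

text \<open>A Cauchy sequence has a uniform limit \<open>u\<close>. Each discrete energy involves
  finitely many values, so its bound for \<open>s m - s n\<close> passes to \<open>s m - u\<close>;
  a bound uniform in the level is then a bound on the energy.\<close>

lemma mcomplete_sobolev: "Metric_space.mcomplete (sobolev_space l p) (norm_dist (sobolev_space l p) N)"
  unfolding mcomplete_norm_dist_iff[OF normed_space_sobolev]
proof (intro allI impI)
  fix s :: "nat \<Rightarrow> complex \<Rightarrow> real"
  assume s: "\<forall>n. s n \<in> sobolev_space l p" and cauchy: "\<forall>e>0. \<exists>k. \<forall>m\<ge>k. \<forall>n\<ge>k. N (s m - s n) < e"
  define C where "C = 2 * oscillation_const p + 1"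
  have C: "C > 0" using oscillation_const(1)[OF p] by (simp add: C_def)
  note diff = subspace_diff[OF subspace_sobolev_space]
  have bound: "\<bar>s m x - s n x\<bar> \<le> C * N (s m - s n)" for m n x
    using abs_le_sobolev_norm[OF diff, of "s m" "s n" x] s by (simp add: C_def)
  have "uniformly_Cauchy_on UNIV s"
  proof (rule uniformly_Cauchy_onI)
    fix e :: real assume "e > 0"
    then obtain k where k: "\<And>m n. m \<ge> k \<Longrightarrow> n \<ge> k \<Longrightarrow> N (s m - s n) < e / C"
      using cauchy C by (metis divide_pos_pos)
    have "dist (s m x) (s n x) < e" if "m \<ge> k" "n \<ge> k" for m n x
      using bound[of m x n] k[OF that] C by (simp add: dist_real_def field_simps)
    then show "\<exists>M. \<forall>x\<in>UNIV. \<forall>m\<ge>M. \<forall>n\<ge>M. dist (s m x) (s n x) < e" by blast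
  qed
  then obtain u where unif: "uniform_limit UNIV s u sequentially"
    using Cauchy_uniformly_convergent unfolding uniformly_convergent_on_def by blast
  then have lim: "(\<lambda>n. s n x) \<longlonglongrightarrow> u x" for x by (rule tendsto_uniform_limitI) simp
  have u_cont: "u \<in> cont_space K"
    unfolding cont_space_def
  proof (intro CollectI conjI allI impI)
    show "continuous_on K u"
      using s unif
      by (intro uniform_limit_theorem[OF _ uniform_limit_on_subset[OF unif]])
        (auto simp: sobolev_space_def cont_space_def)
    fix x assume "x \<notin> K"
    then have "s n x = 0" for n using s by (auto simp: sobolev_space_def cont_space_def)
    then show "u x = 0" using lim[of x] by (simp add: LIMSEQ_const_iff)
  qed
  have small: "s m - u \<in> sobolev_space l p \<and> N (s m - u) \<le> 2 powr (1 / p) * (max 1 C * e)"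
    if k: "\<And>m n. m \<ge> k \<Longrightarrow> n \<ge> k \<Longrightarrow> N (s m - s n) < e" and "m \<ge> k" "0 < e" for m k e
  proof -
    have E: "discrete_energy l p j (s m - u) \<le> e powr p" for j
    proof (rule LIMSEQ_le_const2)
      show "(\<lambda>n. discrete_energy l p j (s m - s n)) \<longlonglongrightarrow> discrete_energy l p j (s m - u)"
        using p by (intro discrete_energy_tendsto) (auto intro!: tendsto_diff lim)
      have "discrete_energy l p j (s m - s n) \<le> e powr p" if "n \<ge> k" for n
      proof -
        have mem: "s m - s n \<in> sobolev_space l p" using s by (intro diff) auto
        have "discrete_energy l p j (s m - s n) \<le> Lp_energy (s m - s n)"
          using discrete_energy_le_energy[OF mem, of j] energy_le_Lp_energy[of "s m - s n"] by linarith
        also have "\<dots> \<le> e powr p"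
          using k[OF \<open>m \<ge> k\<close> that] \<open>0 < e\<close> N.root_norm_le_iff[OF mem, of e] by (simp add: sobolev_norm_eq)
        finally show ?thesis .
      qed
      then show "\<exists>N. \<forall>n\<ge>N. discrete_energy l p j (s m - s n) \<le> e powr p" by blast
    qed
    have "s m - u \<in> cont_space K"
      using s by (intro subspace_diff[OF subspace_cont_space sobolev_space_cont u_cont]) auto
    note mem = sobolev_spaceI[OF this E]
    have "\<bar>(s m - u) x\<bar> \<le> C * e" for x
    proof (rule LIMSEQ_le_const2)
      show "(\<lambda>n. \<bar>s m x - s n x\<bar>) \<longlonglongrightarrow> \<bar>(s m - u) x\<bar>"
        by (auto intro!: tendsto_intros lim)
      have "\<bar>s m x - s n x\<bar> \<le> C * e" if "n \<ge> k" for n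
        using bound[of m x n] k[OF \<open>m \<ge> k\<close> that] C by (meson less_imp_le mult_left_mono order_trans)
      then show "\<exists>N. \<forall>n\<ge>N. \<bar>s m x - s n x\<bar> \<le> C * e" by blast
    qed
    moreover have le: "C * e \<le> max 1 C * e" "e \<le> max 1 C * e"
      using \<open>0 < e\<close> mult_right_mono[of _ "max 1 C" e] by (auto simp: mult_right_mono)
    ultimately have "\<bar>(s m - u) x\<bar> \<le> max 1 C * e" for x by (meson order_trans)
    moreover have "e powr p \<le> (max 1 C * e) powr p"
      using \<open>0 < e\<close> p le by (intro powr_mono2) auto
    ultimately have "N (s m - u) \<le> 2 powr (1 / p) * (max 1 C * e)"
      using mem \<open>0 < e\<close> by (intro sobolev_norm_le) (auto intro: order_trans[OF mem(2)])
    then show ?thesis using mem by blast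
  qed
  show "\<exists>u\<in>sobolev_space l p. \<forall>e>0. \<exists>k. \<forall>n\<ge>k. N (s n - u) < e"
  proof (intro bexI[of _ u] allI impI)
    fix e :: real assume "e > 0"
    define d where "d = e / (2 * (2 powr (1 / p) * max 1 C))"
    have "d > 0" using \<open>e > 0\<close> by (simp add: d_def)
    then obtain k where k: "\<And>m n. m \<ge> k \<Longrightarrow> n \<ge> k \<Longrightarrow> N (s m - s n) < d"
      using cauchy by metis
    have "2 powr (1 / p) * (max 1 C * d) = e / 2" by (simp add: d_def)
    then have "N (s n - u) < e" if "n \<ge> k" for n
      using small[OF k that \<open>d > 0\<close>] \<open>e > 0\<close> by auto
    then show "\<exists>k. \<forall>n\<ge>k. N (s n - u) < e" by blast
  next
    obtain k where k: "\<And>m n. m \<ge> k \<Longrightarrow> n \<ge> k \<Longrightarrow> N (s m - s n) < 1" using cauchy by (metis zero_less_one)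
    have "s k - u \<in> sobolev_space l p" using small[OF k, of k] by auto
    then show "u \<in> sobolev_space l p" using diff[of "s k" "s k - u"] s by simp
  qed
qed

lemma banach_space_sobolev: "banach_space_on (sobolev_space l p) N"
  unfolding banach_space_on_def using normed_space_sobolev mcomplete_sobolev by blast

lemma uniformly_convex_sobolev: "uniformly_convex_on (sobolev_space l p) N"
  unfolding sobolev_norm_eq by (rule N.uniformly_convex_on_root_norm)

end

lemma zero_in_V:
  assumes "scale l"
  shows "0 \<in> vicsek_V l n"
proof -
  have "0 \<in> vicsek_union l n {0}"
    using assms
  proof (induction n arbitrary: l)
    case (Suc n)
    interpret scale l by (rule Suc.prems)
    have "0 = F 0 0" by (simp add: vicsek_F_def)
    then show ?case unfolding vicsek_union_Suc using zero_in_vicsek_S Suc.IH[OF scale_shift] by blast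
  qed (simp add: vicsek_union_0)
  moreover have "{0} \<subseteq> vicsek_q ` {0..4}" using vicsek_q_0 by force
  ultimately show ?thesis unfolding vicsek_V_eq using vicsek_union_mono by blast
qed

section \<open>Functions close in energy, products, contractions and locality\<close>

context vicsek
begin

text \<open>A quantitative Radon-Riesz property. Nearness to \<open>u\<close> on a fine
  \<open>vicsek_V l n\<close> bounds the energy of the midpoint from below, while the hypothesis on
  \<open>energy l p v\<close> bounds the mean of the two energies from above; with so small a gap
  \<open>uniform\<close> makes the energy of \<open>u - v\<close> small.\<close>

lemma energy_near:
  assumes u: "u \<in> sobolev_space l p" and "0 < \<eta>"
  shows "\<exists>n. \<exists>\<delta>>0. \<forall>v\<in>sobolev_space l p. (\<forall>x\<in>vicsek_V l n. \<bar>v x - u x\<bar> < \<delta>) \<longrightarrow>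
    energy l p v < energy l p u + \<delta> \<longrightarrow> energy l p (u - v) < \<eta>"
proof -
  note mem = E.mem_scale E.mem_add E.mem_diff
  define E where "E = energy l p u"
  have "0 \<le> E" unfolding E_def by (rule E.nonneg[OF u])
  \<comment> \<open>The budget: the two energies add up to at most \<open>2 * E + 1\<close>, so the
    \<open>\<epsilon>\<close> term costs at most \<open>\<eta> / 4\<close>; the gap will be at most
    \<open>3 * \<kappa>\<close>, which costs \<open>3 * (\<eta> / 8)\<close>.\<close>
  define \<epsilon> where "\<epsilon> = \<eta> / (4 * (2 * E + 1))"
  have \<epsilon>: "0 < \<epsilon>" "\<epsilon> * (2 * E + 1) = \<eta> / 4"
  proof -
    define k where "k = 2 * E + 1"
    have "k > 0" using \<open>0 \<le> E\<close> by (simp add: k_def)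
    then show "0 < \<epsilon>" "\<epsilon> * (2 * E + 1) = \<eta> / 4"
      using \<open>0 < \<eta>\<close> unfolding \<epsilon>_def k_def[symmetric] by auto
  qed
  define C where "C = convexity_const p \<epsilon> + 1"
  have C: "0 < C" "convexity_const p \<epsilon> \<le> C" "0 \<le> convexity_const p \<epsilon>"
    using convexity_const(1)[OF p \<epsilon>(1)] by (auto simp: C_def)
  define \<kappa> where "\<kappa> = \<eta> / (8 * C)"
  have \<kappa>: "0 < \<kappa>" "C * \<kappa> = \<eta> / 8" using C \<open>0 < \<eta>\<close> by (auto simp: \<kappa>_def)
  obtain n where n: "E - \<kappa> < discrete_energy l p n u"
    using order_tendstoD(1)[OF discrete_energy_tendsto_energy[OF u], of "E - \<kappa>"] \<kappa>(1)
    by (auto simp: E_def eventually_sequentially)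
  have "\<exists>\<delta>>0. \<forall>v. (\<forall>x\<in>vicsek_V l n. \<bar>v x - u x\<bar> < \<delta>) \<longrightarrow>
    discrete_energy l p n u - \<kappa> < discrete_energy l p n ((1/2) *\<^sub>R (u + v))"
  proof (rule ccontr)
    assume "\<not> ?thesis"
    \<comment> \<open>Continuity in the values on \<open>vicsek_V l n\<close> is used through
      sequences: counterexamples with tolerance \<open>1 / Suc k\<close> converge to
      \<open>u\<close> there, and so do their midpoints with \<open>u\<close>.\<close>
    then have "\<forall>k. \<exists>v. (\<forall>x\<in>vicsek_V l n. \<bar>v x - u x\<bar> < 1 / real (Suc k)) \<and>
      discrete_energy l p n ((1/2) *\<^sub>R (u + v)) \<le> discrete_energy l p n u - \<kappa>"
      by (metis not_less of_nat_0_less_iff zero_less_Suc zero_less_divide_1_iff)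
    then obtain v where v: "\<And>k x. x \<in> vicsek_V l n \<Longrightarrow> \<bar>v k x - u x\<bar> < 1 / real (Suc k)"
      "\<And>k. discrete_energy l p n ((1/2) *\<^sub>R (u + v k)) \<le> discrete_energy l p n u - \<kappa>"
      by metis
    have "(\<lambda>k. v k x) \<longlonglongrightarrow> u x" if "x \<in> vicsek_V l n" for x
    proof -
      have "(\<lambda>k. v k x - u x) \<longlonglongrightarrow> 0"
        by (rule Lim_null_comparison[OF _ lim_1_over_n[THEN LIMSEQ_Suc]])
          (use v(1)[OF that] in \<open>auto intro!: always_eventually less_imp_le\<close>)
      then show ?thesis by (simp add: LIM_zero_iff)
    qed
    then have *: "(\<lambda>k. (1/2) * (u x + v k x)) \<longlonglongrightarrow> (1/2) * (u x + u x)" if "x \<in> vicsek_V l n" for x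
      using that by (intro tendsto_intros) auto
    have "(\<lambda>k. discrete_energy l p n ((1/2) *\<^sub>R (u + v k))) \<longlonglongrightarrow> discrete_energy l p n u"
      using p *  by (intro discrete_energy_tendsto) (auto simp: scaleR_fun_def)
    then have "discrete_energy l p n u \<le> discrete_energy l p n u - \<kappa>"
      by (rule LIMSEQ_le_const2) (use v in auto)
    then show False using \<kappa>(1) by simp
  qed
  then obtain \<delta> where \<delta>: "\<delta> > 0" "\<And>v. (\<forall>x\<in>vicsek_V l n. \<bar>v x - u x\<bar> < \<delta>) \<Longrightarrow>
    discrete_energy l p n u - \<kappa> < discrete_energy l p n ((1/2) *\<^sub>R (u + v))"
    by blast
  define \<delta>' where "\<delta>' = min \<delta> (min 1 \<kappa>)"
  have \<delta>': "0 < \<delta>'" "\<delta>' \<le> \<delta>" "\<delta>' \<le> 1" "\<delta>' \<le> \<kappa>" using \<delta> \<kappa> by (auto simp: \<delta>'_def)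
  have "energy l p (u - v) < \<eta>"
    if v: "v \<in> sobolev_space l p" and near: "\<forall>x\<in>vicsek_V l n. \<bar>v x - u x\<bar> < \<delta>'"
      and small: "energy l p v < E + \<delta>'" for v
  proof -
    let ?m = "energy l p ((1/2) *\<^sub>R (u + v))"
    have "discrete_energy l p n u - \<kappa> < discrete_energy l p n ((1/2) *\<^sub>R (u + v))"
      using near \<delta>'(2) by (intro \<delta>(2)) force
    also have "\<dots> \<le> ?m" by (intro discrete_energy_le_energy mem u v)
    finally have mid: "E - 2 * \<kappa> < ?m" using n by simp
    have gap: "0 \<le> (E + energy l p v) / 2 - ?m"
      using E.convex[OF u v, of "1/2"] by (simp add: E_def scaleR_add_right)
    have "energy l p (u - v) \<le> \<epsilon> * (E + energy l p v) + convexity_const p \<epsilon> * ((E + energy l p v) / 2 - ?m)"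
      unfolding E_def by (rule E.uniform[OF u v \<epsilon>(1)])
    also have "\<dots> \<le> \<epsilon> * (2 * E + 1) + C * (3 * \<kappa>)"
    proof (rule add_mono[OF mult_left_mono mult_mono])
      show "E + energy l p v \<le> 2 * E + 1" using small \<delta>' by linarith
      show "(E + energy l p v) / 2 - ?m \<le> 3 * \<kappa>" using small mid \<delta>' by (simp add: field_simps)
    qed (use gap \<epsilon>(1) C \<open>0 \<le> E\<close> E.nonneg[OF v] in auto)
    also have "\<dots> = \<eta> / 4 + 3 * (\<eta> / 8)" unfolding \<epsilon>(2) \<kappa>(2)[symmetric] by simp
    also have "\<dots> < \<eta>" using \<open>0 < \<eta>\<close> by simp
    finally show ?thesis .
  qed
  then show ?thesis using \<delta>'(1) unfolding E_def by blast
qed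

text \<open>The increment splits by the Leibniz rule
  \<open>u x * (v x - v y) + v y * (u x - u y)\<close>; the factor \<open>2 powr (p - 1)\<close> is
  the price of separating the two terms.\<close>

lemma sobolev_space_mult:
  assumes u: "u \<in> sobolev_space l p" and v: "v \<in> sobolev_space l p"
  shows "u * v \<in> sobolev_space l p"
    and "energy l p (u * v) \<le> 2 powr (p - 1) *
      (sup_norm K u powr p * energy l p v + sup_norm K v powr p * energy l p u)"
proof -
  let ?a = "sup_norm K u" and ?b = "sup_norm K v"
  have ab: "\<bar>u x\<bar> \<le> ?a" "\<bar>v x\<bar> \<le> ?b" for x
    by (intro abs_le_sup_norm compact_K K_not_empty sobolev_space_cont u v)+
  have ab0: "0 \<le> ?a" "0 \<le> ?b" using ab[of 0] by linarith+
  have diff: "\<bar>(u * v) x - (u * v) y\<bar> powr p \<le>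
      (2 powr (p - 1) * ?a powr p) * \<bar>v x - v y\<bar> powr p + (2 powr (p - 1) * ?b powr p) * \<bar>u x - u y\<bar> powr p" for x y
  proof -
    have "(u * v) x - (u * v) y = u x * (v x - v y) + v y * (u x - u y)" by (simp add: algebra_simps)
    then have "\<bar>(u * v) x - (u * v) y\<bar> powr p \<le>
      2 powr (p - 1) * (\<bar>u x * (v x - v y)\<bar> powr p + \<bar>v y * (u x - u y)\<bar> powr p)"
      using powr_add_le[OF p] by simp
    also have "\<dots> \<le> 2 powr (p - 1) * ((?a * \<bar>v x - v y\<bar>) powr p + (?b * \<bar>u x - u y\<bar>) powr p)"
      using ab p unfolding abs_mult by (intro mult_left_mono add_mono powr_mono2 mult_right_mono) auto
    finally show ?thesis by (simp add: powr_mult algebra_simps)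
  qed
  have "u * v \<in> cont_space K"
    using sobolev_space_cont[OF u] sobolev_space_cont[OF v]
    unfolding cont_space_def by (auto simp: times_fun_def intro!: continuous_intros)
  moreover have "discrete_energy l p n (u * v) \<le> 2 powr (p - 1) * (?a powr p * energy l p v + ?b powr p * energy l p u)" for n
  proof -
    have "discrete_energy l p n (u * v) \<le> (2 powr (p - 1) * ?a powr p) * discrete_energy l p n v +
        (2 powr (p - 1) * ?b powr p) * discrete_energy l p n u"
      by (rule discrete_energy_le[OF scale_axioms diff])
    also have "\<dots> \<le> (2 powr (p - 1) * ?a powr p) * energy l p v + (2 powr (p - 1) * ?b powr p) * energy l p u"
      by (intro add_mono mult_left_mono discrete_energy_le_energy u v) auto
    finally show ?thesis by (simp add: algebra_simps)
  qed
  ultimately show "u * v \<in> sobolev_space l p" and "energy l p (u * v) \<le> 2 powr (p - 1) *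
      (?a powr p * energy l p v + ?b powr p * energy l p u)"
    by (rule sobolev_spaceI)+
qed

lemma sobolev_space_Lipschitz:
  assumes u: "u \<in> sobolev_space l p" and \<phi>: "1-lipschitz_on UNIV \<phi>"
  shows "comp_on K \<phi> u \<in> sobolev_space l p" "energy l p (comp_on K \<phi> u) \<le> energy l p u"
proof -
  have "continuous_on K u" using sobolev_space_cont[OF u] by (simp add: cont_space_def)
  then have "continuous_on K (\<lambda>x. \<phi> (u x))"
    by (rule continuous_on_compose2[OF lipschitz_on_continuous_on[OF \<phi>]]) simp
  then have "continuous_on K (comp_on K \<phi> u)"
    by (rule continuous_on_eq) (simp add: comp_on_def)
  then have "comp_on K \<phi> u \<in> cont_space K" by (simp add: cont_space_def comp_on_def)
  moreover have "discrete_energy l p n (comp_on K \<phi> u) \<le> energy l p u" for n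
  proof -
    \<comment> \<open>The zero term only fits the two-term shape of
      \<open>discrete_energy_le\<close>.\<close>
    have "\<bar>comp_on K \<phi> u x - comp_on K \<phi> u y\<bar> powr p \<le> 1 * \<bar>u x - u y\<bar> powr p + 0 * \<bar>u x - u y\<bar> powr p"
      if "x \<in> K" "y \<in> K" for x y
      using that lipschitz_onD[OF \<phi>, of "u x" "u y"] p
      by (auto simp: comp_on_def dist_real_def intro!: powr_mono2)
    then have "discrete_energy l p n (comp_on K \<phi> u) \<le> 1 * discrete_energy l p n u + 0 * discrete_energy l p n u"
      by (rule discrete_energy_le[OF scale_axioms])
    then show ?thesis using discrete_energy_le_energy[OF u, of n] by simp
  qed
  ultimately show "comp_on K \<phi> u \<in> sobolev_space l p" "energy l p (comp_on K \<phi> u) \<le> energy l p u"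
    by (rule sobolev_spaceI)+
qed

lemma in_supp_on: "x \<in> K \<Longrightarrow> w x \<noteq> 0 \<Longrightarrow> x \<in> supp_on K w"
  unfolding supp_on_def using closure_of_subset[of "{x \<in> K. w x \<noteq> 0}" "top_of_set K"] by auto

lemma compact_supp_on: "compact (supp_on K w)"
proof -
  have "closedin (top_of_set K) (supp_on K w)" unfolding supp_on_def by (rule closedin_closure_of)
  then show ?thesis by (rule closedin_compact[OF compact_K])
qed

text \<open>Disjoint compact supports are a positive distance \<open>d\<close> apart. Along any edge
  shorter than \<open>d\<close>, either \<open>u\<close> vanishes at both ends or \<open>v\<close>
  equals \<open>a\<close> at both, so discrete energies are additive at all fine levels and the
  limit inherits this.\<close>

lemma energy_local:
  assumes u: "u \<in> sobolev_space l p" and v: "v \<in> sobolev_space l p"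
    and disjoint: "supp_on K u \<inter> supp_on K (v - a *\<^sub>R indicat_real K) = {}"
  shows "energy l p (u + v) = energy l p u + energy l p v"
proof -
  let ?w = "v - a *\<^sub>R indicat_real K"
  obtain d where d: "d > 0" "\<And>x y. x \<in> supp_on K u \<Longrightarrow> y \<in> supp_on K ?w \<Longrightarrow> d \<le> dist x y"
    using separate_compact_closed[OF compact_supp_on compact_imp_closed[OF compact_supp_on] disjoint] by auto
  have const: "v x = a" if "x \<in> K" "x \<notin> supp_on K ?w" for x
    using in_supp_on[of x ?w] that by (auto simp: scaleR_fun_def)
  have u0: "u x = 0" if "x \<in> K" "x \<notin> supp_on K u" for x using in_supp_on that by blast
  have far: "u x = 0 \<and> u y = 0 \<or> v x = a \<and> v y = a" if "x \<in> K" "y \<in> K" "dist x y < d" for x y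
  proof (cases "x \<in> supp_on K u \<or> y \<in> supp_on K u")
    case True
    then have "x \<notin> supp_on K ?w" "y \<notin> supp_on K ?w"
      using d(2)[of x y] d(2)[of y x] d(2)[of x x] d(2)[of y y] d(1) that by (auto simp: dist_commute)
    then show ?thesis using const that by blast
  qed (use u0 that in blast)
  have eq: "discrete_energy l p n (u + v) = discrete_energy l p n u + discrete_energy l p n v"
    if "cell_radius l n < d" for n
  proof -
    have "\<bar>(u + v) x - (u + v) y\<bar> powr p = \<bar>u x - u y\<bar> powr p + \<bar>v x - v y\<bar> powr p"
      if "(x, y) \<in> vicsek_edges l n" for x y
    proof -
      have "x \<in> K" "y \<in> K" "dist x y < d"
        using that \<open>cell_radius l n < d\<close> vicsek_V_subset[OF scale_axioms, of n]
        unfolding vicsek_edges_iff by auto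
      from far[OF this] show ?thesis by (elim disjE conjE) simp_all
    qed
    then have "(\<Sum>(x, y)\<in>vicsek_edges l n. \<bar>(u + v) x - (u + v) y\<bar> powr p) =
        (\<Sum>(x, y)\<in>vicsek_edges l n. \<bar>u x - u y\<bar> powr p + \<bar>v x - v y\<bar> powr p)"
      by (intro sum.cong) auto
    then show ?thesis
      unfolding discrete_energy_def by (simp add: case_prod_unfold sum.distrib distrib_left)
  qed
  have "eventually (\<lambda>n. cell_radius l n < d) sequentially"
    using order_tendstoD(2)[OF cell_radius_tendsto_0[OF scale_axioms]] d(1) by simp
  then have "eventually (\<lambda>n. discrete_energy l p n u + discrete_energy l p n v = discrete_energy l p n (u + v)) sequentially"
    by eventually_elim (simp add: eq)
  moreover have "(\<lambda>n. discrete_energy l p n u + discrete_energy l p n v) \<longlonglongrightarrow> energy l p u + energy l p v"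
    by (intro tendsto_add discrete_energy_tendsto_energy u v)
  ultimately have "(\<lambda>n. discrete_energy l p n (u + v)) \<longlonglongrightarrow> energy l p u + energy l p v"
    by (blast intro: Lim_transform_eventually)
  then show ?thesis
    using discrete_energy_tendsto_energy[OF E.mem_add[OF u v]] LIMSEQ_unique by blast
qed

end

section \<open>Separability and the spectral gap\<close>

context vicsek_prob
begin

text \<open>A test \<open>(n, q, d, e)\<close> asks for values within \<open>d\<close> of the
  rational values \<open>q\<close> on \<open>vicsek_V l n\<close> and for energy below
  \<open>e\<close>. The set \<open>D\<close> selects one function per test that can be passed. If
  \<open>d\<close> is small and \<open>e\<close> barely exceeds the energy of \<open>u\<close>, the
  selected function is close to \<open>u\<close> by \<open>energy_near\<close>.\<close>

lemma separable_sobolev: "separable_space (norm_topology (sobolev_space l p) N)"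
proof -
  define I where "I = (SIGMA n:UNIV. (vicsek_V l n \<rightarrow>\<^sub>E (\<rat> :: real set)) \<times> (\<rat> :: real set) \<times> (\<rat> :: real set))"
  define P where "P = (\<lambda>(n, q, d, e) u. u \<in> sobolev_space l p \<and> (\<forall>x\<in>vicsek_V l n. \<bar>u x - q x\<bar> < d) \<and> energy l p u < (e :: real))"
  define D where "D = (\<lambda>i. SOME u. P i u) ` {i \<in> I. \<exists>u. P i u}"
  have fin: "finite (vicsek_V l n)" for n by (simp add: vicsek_V_eq finite_vicsek_union)
  have "countable I"
    unfolding I_def by (intro countable_SIGMA countable_PiE fin countable_rat) auto
  then have "countable D"
    unfolding D_def by (intro countable_image) (rule countable_subset[rotated], auto)
  have some: "P i (SOME u. P i u)" if "P i u" for i u using someI[of "P i", OF that] .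
  have D_sub: "D \<subseteq> sobolev_space l p"
  proof
    fix v assume "v \<in> D"
    then obtain i u where "v = (SOME u. P i u)" "P i u" by (auto simp: D_def)
    then have "P i v" using some by metis
    then show "v \<in> sobolev_space l p" by (cases i) (simp add: P_def)
  qed
  have dense: "\<exists>v\<in>D. N (u - v) < r" if u: "u \<in> sobolev_space l p" and "r > 0" for u r
  proof -
    define A where "A = 2 powr (1 / p) * (1 + oscillation_const p)"
    have A: "A > 0" using oscillation_const(1)[OF p] by (simp add: A_def)
    define t where "t = r / (2 * A)"
    have t: "t > 0" "A * t < r" using A \<open>r > 0\<close> by (auto simp: t_def)
    obtain n \<delta> where n: "\<delta> > 0" "\<And>v. v \<in> sobolev_space l p \<Longrightarrow> (\<forall>x\<in>vicsek_V l n. \<bar>v x - u x\<bar> < \<delta>) \<Longrightarrow>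
      energy l p v < energy l p u + \<delta> \<Longrightarrow> energy l p (u - v) < t powr p"
      using energy_near[OF u, of "t powr p"] t(1) by auto
    \<comment> \<open>Half of the tolerance, since \<open>u\<close> and \<open>v\<close> are
      compared through a rational value.\<close>
    obtain d where d: "d \<in> \<rat>" "0 < d" "d < min t \<delta> / 2"
      using Rats_dense_in_real[of 0 "min t \<delta> / 2"] n(1) t(1) by auto
    obtain e where e: "e \<in> \<rat>" "energy l p u < e" "e < energy l p u + \<delta>"
      using Rats_dense_in_real[of "energy l p u" "energy l p u + \<delta>"] n(1) by auto
    have "\<forall>x. \<exists>y\<in>\<rat>. \<bar>u x - y\<bar> < d"
    proof
      fix x
      obtain y where "y \<in> \<rat>" "u x - d < y" "y < u x + d"
        using Rats_dense_in_real[of "u x - d" "u x + d"] d(2) by auto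
      then show "\<exists>y\<in>\<rat>. \<bar>u x - y\<bar> < d" by (intro bexI[of _ y]) (auto simp: abs_less_iff)
    qed
    then obtain q' where q': "\<And>x. q' x \<in> \<rat>" "\<And>x. \<bar>u x - q' x\<bar> < d" by metis
    define q where "q = restrict q' (vicsek_V l n)"
    define i where "i = (n, q, d, e)"
    have "i \<in> I" unfolding i_def I_def q_def using q' d e by auto
    have "P i u" unfolding i_def P_def q_def using u q' e by auto
    define v where "v = (SOME u. P i u)"
    have "P i v" unfolding v_def by (rule some[OF \<open>P i u\<close>])
    then have v: "v \<in> sobolev_space l p" "\<And>x. x \<in> vicsek_V l n \<Longrightarrow> \<bar>v x - q' x\<bar> < d" "energy l p v < e"
      by (auto simp: i_def P_def q_def)
    have "v \<in> D" unfolding D_def v_def using \<open>i \<in> I\<close> \<open>P i u\<close> by blast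
    have near: "\<bar>v x - u x\<bar> < min t \<delta>" if "x \<in> vicsek_V l n" for x
      using v(2)[OF that] q'(2)[of x] d(3) by linarith
    then have E: "energy l p (u - v) < t powr p" using n(2)[OF v(1)] v(3) e by simp
    have mem: "u - v \<in> sobolev_space l p" by (rule E.mem_diff[OF u v(1)])
    have root: "energy l p (u - v) powr (1 / p) \<le> t"
      using E t(1) p E.nonneg[OF mem] powr_mono2[of "1 / p" "energy l p (u - v)" "t powr p"]
      by (simp add: powr_powr)
    \<comment> \<open>Energy does not see constants; as 0 is a vertex, the test controls the value
      at 0, and the oscillation bound extends this to \<open>K\<close>.\<close>
    have "N (u - v) \<le> 2 powr (1 / p) * ((1 + oscillation_const p) * t)"
    proof (rule sobolev_norm_le[OF mem])
      show "\<bar>(u - v) x\<bar> \<le> (1 + oscillation_const p) * t" if "x \<in> K" for x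
      proof -
        have "\<bar>(u - v) x - (u - v) 0\<bar> \<le> oscillation_const p * energy l p (u - v) powr (1 / p)"
          by (rule oscillation[OF mem that])
        also have "\<dots> \<le> oscillation_const p * t"
          using root oscillation_const(1)[OF p] by (intro mult_left_mono) auto
        finally show ?thesis using near[OF zero_in_V[OF scale_axioms]] by (simp add: algebra_simps abs_if split: if_splits)
      qed
      have "t \<le> (1 + oscillation_const p) * t" using t(1) oscillation_const(1)[OF p] by simp
      then have "t powr p \<le> ((1 + oscillation_const p) * t) powr p" using t(1) p by (intro powr_mono2) auto
      then show "energy l p (u - v) \<le> ((1 + oscillation_const p) * t) powr p" using E by linarith
    qed (use t oscillation_const(1)[OF p] in auto)
    also have "\<dots> < r" using t(2) by (simp add: A_def mult.assoc)
    finally show ?thesis using \<open>v \<in> D\<close> by blast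
  qed
  show ?thesis
    unfolding separable_space_def topspace_norm_topology[OF normed_space_sobolev]
    using \<open>countable D\<close> D_sub dense
    by (intro exI[of _ D]) (auto simp: closure_of_norm_topology[OF normed_space_sobolev])
qed

lemma diameter_K_ge_1: "1 \<le> diameter K"
proof -
  have "dist 0 (vicsek_q 1) \<le> diameter K"
    using vicsek_q_in_set[OF scale_axioms, of 1] zero_in_K compact_imp_bounded[OF compact_K]
    by (intro diameter_bounded_bound) auto
  then show ?thesis using norm_vicsek_q[of 1] by simp
qed

text \<open>Both \<open>u x\<close> and the mean of \<open>u\<close> lie within the oscillation
  bound of \<open>u 0\<close>. The diameter is at least 1, so its power only enlarges the right
  side.\<close>

lemma spectral_gap:
  assumes u: "u \<in> sobolev_space l p"
  shows "(\<integral>x. \<bar>u x - 1 / measure M K * (\<integral>y. u y \<partial>M)\<bar> powr p \<partial>M)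
    \<le> max 1 ((2 * oscillation_const p) powr p) * diameter K powr (p - 1) * energy l p u"
proof -
  define osc where "osc = oscillation_const p * energy l p u powr (1 / p)"
  have "osc \<ge> 0" using oscillation_const(1)[OF p] by (simp add: osc_def)
  have osc: "\<bar>u x - u 0\<bar> \<le> osc" if "x \<in> K" for x unfolding osc_def by (rule oscillation[OF u that])
  have int: "integrable M u"
    using sobolev_space_cont[OF u] by (intro integrable_continuous) (simp add: cont_space_def)
  define m where "m = (\<integral>y. u y \<partial>M)"
  have "m - u 0 = (\<integral>y. u y - u 0 \<partial>M)" using int by (simp add: m_def measure_K space_M)
  also have "\<bar>\<dots>\<bar> \<le> (\<integral>y. \<bar>u y - u 0\<bar> \<partial>M)" by (rule integral_abs_bound)
  also have "\<dots> \<le> (\<integral>y. osc \<partial>M)" using int osc by (intro integral_mono) (auto simp: space_M)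
  finally have m: "\<bar>m - u 0\<bar> \<le> osc" by (simp add: measure_K space_M)
  have "(\<integral>x. \<bar>u x - m\<bar> powr p \<partial>M) \<le> (2 * osc) powr p"
    using integral_powr_le[of "2 * osc" "\<lambda>x. u x - m"] osc m \<open>osc \<ge> 0\<close> by fastforce
  also have "\<dots> = (2 * oscillation_const p) powr p * 1 * energy l p u"
    using p E.nonneg[OF u] oscillation_const(1)[OF p] by (simp add: osc_def powr_mult powr_powr)
  also have "\<dots> \<le> max 1 ((2 * oscillation_const p) powr p) * diameter K powr (p - 1) * energy l p u"
    using E.nonneg[OF u] diameter_K_ge_1 p by (intro mult_mono ge_one_powr_ge_zero) auto
  finally show ?thesis by (simp add: m_def measure_K)
qed

end

section \<open>Density in the continuous functions\<close>

text \<open>The second argument \<open>l 1 * (x - d)\<close> inverts \<open>F d\<close>. The choice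
  of \<open>d\<close> is ambiguous where two cells meet, which is harmless for compatible families
  \<open>h\<close>.\<close>

definition glue :: "(nat \<Rightarrow> nat) \<Rightarrow> (complex \<Rightarrow> complex \<Rightarrow> real) \<Rightarrow> complex \<Rightarrow> real" where
  "glue l h x = (if x \<in> vicsek_set l
    then let d = SOME d. d \<in> vicsek_S (l 1) \<and> x \<in> vicsek_F (l 1) d ` vicsek_set (shift_scale l)
      in h d (of_nat (l 1) * (x - d))
    else 0)"

context scale
begin

abbreviation "K' \<equiv> vicsek_set l'"

definition compatible :: "(complex \<Rightarrow> complex \<Rightarrow> real) \<Rightarrow> bool" where
  "compatible h \<longleftrightarrow> (\<forall>d\<in>S. \<forall>e\<in>S. d \<noteq> e \<longrightarrow> (\<forall>y\<in>K'. \<forall>z\<in>K'. F d y = F e z \<longrightarrow> h d y = h e z))"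

text \<open>Distinct cells meet only at corners, and the common point is \<open>y\<close> in one and
  \<open>- y\<close> in the other; so agreement has to be checked at corner values only.\<close>

lemma compatibleI:
  assumes "\<And>d e y z. d \<in> S \<Longrightarrow> e \<in> S \<Longrightarrow> d \<noteq> e \<Longrightarrow> F d y = F e z \<Longrightarrow>
    y \<in> vicsek_q ` {1..4} \<Longrightarrow> z = - y \<Longrightarrow> z \<in> vicsek_q ` {1..4} \<Longrightarrow> h d y = h e z"
  shows "compatible h"
  unfolding compatible_def
proof (intro ballI impI)
  fix d e y z assume *: "d \<in> S" "e \<in> S" "d \<noteq> e" "y \<in> K'" "z \<in> K'" "F d y = F e z"
  then have "y \<in> vicsek_K0" "z \<in> vicsek_K0" using vicsek_set_subset_K0[OF scale_shift] by auto
  then show "h d y = h e z"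
    using * vicsek_cells_meet(3) vicsek_cells_meet_corner by (intro assms) blast+
qed

lemma glue_F:
  assumes "compatible h" "d \<in> S" "y \<in> K'"
  shows "glue l h (F d y) = h d y"
proof -
  define e where "e = (SOME e. e \<in> S \<and> F d y \<in> F e ` K')"
  have "e \<in> S \<and> F d y \<in> F e ` K'"
    unfolding e_def by (rule someI[of _ d]) (use assms in blast)
  then obtain z where z: "e \<in> S" "z \<in> K'" "F d y = F e z" by blast
  have "of_nat L * (F e z - e) = z" using L_pos by (simp add: vicsek_F_def)
  moreover have "h d y = h e z"
  proof (cases "d = e")
    case True
    then show ?thesis using z(3) vicsek_F_eq_iff[OF l_pos[of 1]] by simp
  next
    case False
    then show ?thesis using assms z unfolding compatible_def by blast
  qed
  ultimately show ?thesis
    using vicsek_F_in_set[OF assms(2,3)] z(3) unfolding glue_def e_def[symmetric] Let_def by simp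
qed

text \<open>Pasting over the finite closed cover by first-level cells.\<close>

lemma glue_cont:
  assumes "compatible h" "\<And>d. d \<in> S \<Longrightarrow> continuous_on K' (h d)"
  shows "glue l h \<in> cont_space (vicsek_set l)"
proof -
  have "continuous_on (F d ` K') (glue l h)" if "d \<in> S" for d
  proof -
    have "continuous_on (F d ` K') (\<lambda>x. h d (of_nat L * (x - d)))"
    proof (rule continuous_on_compose2[OF assms(2)[OF that]])
      show "continuous_on (F d ` K') (\<lambda>x. of_nat L * (x - d))" by (intro continuous_intros)
      show "(\<lambda>x. of_nat L * (x - d)) ` F d ` K' \<subseteq> K'" using L_pos by (auto simp: vicsek_F_def)
    qed
    then show ?thesis
    proof (rule continuous_on_eq)
      fix x assume "x \<in> F d ` K'"
      then obtain y where y: "y \<in> K'" "x = F d y" by blast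
      have "of_nat L * (x - d) = y" using L_pos y by (simp add: vicsek_F_def)
      then show "h d (of_nat L * (x - d)) = glue l h x" using glue_F[OF assms(1) that y(1)] y(2) by simp
    qed
  qed
  moreover have "closed (F d ` K')" for d
    by (intro compact_imp_closed compact_continuous_image continuous_on_vicsek_F compact_vicsek_set scale_shift)
  ultimately have "continuous_on (\<Union>d\<in>S. F d ` K') (glue l h)"
    by (intro continuous_on_closed_Union finite_vicsek_S) auto
  then show ?thesis
    unfolding cont_space_def vicsek_set_self_similar[symmetric] by (simp add: glue_def)
qed

end

lemma discrete_energy_cong:
  assumes "scale l" "\<And>x. x \<in> vicsek_set l \<Longrightarrow> u x = v x"
  shows "discrete_energy l p n u = discrete_energy l p n v"
proof -
  have "(\<Sum>(x, y)\<in>vicsek_edges l n. \<bar>u x - u y\<bar> powr p) = (\<Sum>(x, y)\<in>vicsek_edges l n. \<bar>v x - v y\<bar> powr p)"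
    using assms(2) vicsek_V_subset[OF assms(1), of n]
    by (intro sum.cong refl) (auto simp: vicsek_edges_def subset_iff)
  then show ?thesis by (simp add: discrete_energy_def)
qed

lemma (in vicsek) glue_sobolev:
  assumes "compatible h" "\<And>d. d \<in> S \<Longrightarrow> h d \<in> sobolev_space l' p"
  shows "glue l h \<in> sobolev_space l p"
proof -
  have cont: "glue l h \<in> cont_space K"
    using assms(2) by (intro glue_cont assms(1)) (simp add: sobolev_space_def cont_space_def)
  define B where "B = real L powr (p - 1) * (\<Sum>d\<in>S. energy l' p (h d))"
  have Suc: "discrete_energy l p (Suc n) (glue l h) \<le> B" for n
  proof -
    have "discrete_energy l' p n (\<lambda>z. glue l h (F d z)) = discrete_energy l' p n (h d)" if "d \<in> S" for d
      by (rule discrete_energy_cong[OF scale_shift glue_F[OF assms(1) that]])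
    then show ?thesis
      unfolding discrete_energy_Suc B_def using assms(2)
      by (intro mult_left_mono sum_mono) (auto intro: vicsek.discrete_energy_le_energy[OF vicsek_shift])
  qed
  \<comment> \<open>Monotonicity brings in level 0, which the recursion does not reach.\<close>
  have "discrete_energy l p n (glue l h) \<le> B" for n
    using Suc[of n] discrete_energy_mono_Suc[OF scale_axioms p, of n "glue l h"] by linarith
  then show ?thesis by (rule sobolev_spaceI(1)[OF cont])
qed

text \<open>The tree retraction of the Vicsek set onto the diagonal through the corner \<open>vicsek_q j\<close>, in the
  coordinate of that diagonal, as a limit: cells off the diagonal are collapsed.\<close>

definition on_diagonal :: "nat \<Rightarrow> complex \<Rightarrow> bool" where
  "on_diagonal j d \<longleftrightarrow> d = 0 \<or> d \<bullet> vicsek_q j \<noteq> 0"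

text \<open>An off-diagonal digit is orthogonal to \<open>vicsek_q j\<close>, so its whole cell
  receives the value 0, the coordinate of the centre of the cross.\<close>

primrec retraction_approx :: "nat \<Rightarrow> nat \<Rightarrow> (nat \<Rightarrow> nat) \<Rightarrow> complex \<Rightarrow> real" where
  "retraction_approx j 0 l = (\<lambda>x. if x \<in> vicsek_set l then x \<bullet> vicsek_q j else 0)"
| "retraction_approx j (Suc n) l = glue l (\<lambda>d y. d \<bullet> vicsek_q j
    + (if on_diagonal j d then retraction_approx j n (shift_scale l) y / real (l 1) else 0))"

lemma inner_vicsek_F: "vicsek_F m d y \<bullet> w = d \<bullet> w + (y \<bullet> w) / real m"
  by (simp add: inner_complex_def Re_vicsek_F Im_vicsek_F algebra_simps add_divide_distrib)

lemma inner_vicsek_q: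
  assumes "j \<in> {1..4}" "k \<in> {1..4}"
  shows "vicsek_q k \<bullet> vicsek_q j = (if k = j then 1 else if vicsek_q k = - vicsek_q j then -1 else 0)"
proof -
  have "j = Suc 0 \<or> j = 2 \<or> j = 3 \<or> j = 4" "k = Suc 0 \<or> k = 2 \<or> k = 3 \<or> k = 4" using assms by auto
  then show ?thesis
    using half_side_sq half_side_pos by (elim disjE) (simp_all add: vicsek_q_1_4 inner_complex_def complex_eq_iff)
qed

lemma vicsek_q_collinear:
  assumes "j \<in> {1..4}" "k \<in> {1..4}"
  shows "vicsek_q k \<bullet> vicsek_q j = 0 \<or> vicsek_q k = (vicsek_q k \<bullet> vicsek_q j) *\<^sub>R vicsek_q j"
  using inner_vicsek_q[OF assms] by (auto split: if_splits)

lemma (in scale) vicsek_S_collinear: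
  assumes "d \<in> S" "j \<in> {1..4}"
  shows "d \<bullet> vicsek_q j = 0 \<or> d = (d \<bullet> vicsek_q j) *\<^sub>R vicsek_q j"
proof -
  obtain n k where nk: "k \<in> {1..4}" "d = of_nat (2 * n) / of_nat L * vicsek_q k"
    using assms(1) unfolding vicsek_S_def by blast
  have d: "d = (real (2 * n) / real L) *\<^sub>R vicsek_q k" using nk by (simp add: scaleR_conv_of_real)
  show ?thesis
    using vicsek_q_collinear[OF assms(2) nk(1)] unfolding d inner_scaleR_left
    by (metis mult_zero_right scaleR_scaleR)
qed

lemma inner_vicsek_q_le:
  assumes "y \<in> vicsek_K0" "j \<in> {1..4}"
  shows "\<bar>y \<bullet> vicsek_q j\<bar> \<le> 1"
proof -
  have "\<bar>y \<bullet> vicsek_q j\<bar> \<le> norm y * norm (vicsek_q j)" by (rule Cauchy_Schwarz_ineq2)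
  also have "\<dots> \<le> 1" using norm_le_1_vicsek_K0[OF assms(1)] norm_vicsek_q[OF assms(2)] by simp
  finally show ?thesis .
qed

text \<open>At a shared corner \<open>e = d + (2 / L) y\<close>. If \<open>y\<close> is orthogonal
  to the diagonal, both sides reduce to the same digit coordinate; otherwise \<open>y\<close> is
  parallel to it, both digits lie on the diagonal, and there the formula is the linear
  coordinate.\<close>

lemma (in scale) retraction_step_compatible:
  assumes j: "j \<in> {1..4}" and r: "\<And>k. k \<in> {0..4} \<Longrightarrow> r (vicsek_q k) = vicsek_q k \<bullet> vicsek_q j"
  shows "compatible (\<lambda>d y. d \<bullet> vicsek_q j + (if on_diagonal j d then r y / real L else 0))"
proof (rule compatibleI)
  fix d e y z assume *: "d \<in> S" "e \<in> S" "d \<noteq> e" "F d y = F e z"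
    and yz: "y \<in> vicsek_q ` {1..4}" "z = - y" "z \<in> vicsek_q ` {1..4}"
  let ?q = "vicsek_q j" and ?h = "\<lambda>d y. d \<bullet> vicsek_q j + (if on_diagonal j d then r y / real L else 0)"
  have r': "r x = x \<bullet> ?q" if "x \<in> vicsek_q ` {1..4}" for x
  proof -
    from that obtain k where "k \<in> {1..4}" "x = vicsek_q k" by blast
    then show ?thesis using r[of k] by simp
  qed
  have ry: "r y = y \<bullet> ?q" "r z = - (y \<bullet> ?q)" using r'[OF yz(1)] r'[OF yz(3)] yz(2) by simp_all
  have e: "e = d + (2 / real L) *\<^sub>R y"
    using *(4) yz(2) L_pos by (simp add: vicsek_F_def scaleR_conv_of_real field_simps)
  then have ed: "e \<bullet> ?q = d \<bullet> ?q + 2 * (y \<bullet> ?q) / real L" by (simp add: inner_add_left)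
  show "?h d y = ?h e z"
  proof (cases "y \<bullet> ?q = 0")
    case True
    then show ?thesis using ry ed by simp
  next
    case False
    obtain k where k: "k \<in> {1..4}" "y = vicsek_q k" using yz(1) by blast
    have yq: "y = (y \<bullet> ?q) *\<^sub>R ?q" using vicsek_q_collinear[OF j k(1)] False k(2) by simp
    \<comment> \<open>A nonzero digit orthogonal to the diagonal cannot be moved along it onto
      another digit; two digits differing by a nonzero multiple of \<open>?q\<close> therefore both
      lie on the diagonal.\<close>
    have off: "x = 0" if "w \<in> S" "x \<bullet> ?q = 0" "w = x + t *\<^sub>R ?q" "t \<noteq> 0" for w x t
    proof -
      have "?q \<bullet> ?q = 1" using inner_vicsek_q[OF j j] by simp
      then have "w \<bullet> ?q = t" using that by (simp add: inner_add_left)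
      then show ?thesis using vicsek_S_collinear[OF that(1) j] that by auto
    qed
    have t: "2 / real L * (y \<bullet> ?q) \<noteq> 0" using False L_pos by simp
    have e': "e = d + (2 / real L * (y \<bullet> ?q)) *\<^sub>R ?q" using e yq by (metis scaleR_scaleR)
    then have d': "d = e + (- (2 / real L * (y \<bullet> ?q))) *\<^sub>R ?q" by simp
    have "on_diagonal j d"
      unfolding on_diagonal_def using off[OF *(2) _ e' t] by blast
    moreover have "on_diagonal j e"
      unfolding on_diagonal_def using off[OF *(1) _ d'] t by force
    ultimately show ?thesis using ry ed by (simp add: field_simps)
  qed
qed

text \<open>The corner values are what makes the next gluing compatible, hence the joint induction
  with continuity.\<close>

lemma retraction_approx:
  assumes "scale l" "j \<in> {1..4}"
  shows "retraction_approx j n l \<in> cont_space (vicsek_set l)"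
    and "k \<in> {0..4} \<Longrightarrow> retraction_approx j n l (vicsek_q k) = vicsek_q k \<bullet> vicsek_q j"
proof -
  have "retraction_approx j n l \<in> cont_space (vicsek_set l) \<and>
    (\<forall>k\<in>{0..4}. retraction_approx j n l (vicsek_q k) = vicsek_q k \<bullet> vicsek_q j)"
    using assms(1)
  proof (induction n arbitrary: l)
    case 0
    have "continuous_on (vicsek_set l) (retraction_approx j 0 l)"
      by (rule continuous_on_eq[of _ "\<lambda>x. x \<bullet> vicsek_q j"]) (auto intro!: continuous_intros)
    then show ?case using vicsek_q_in_set[OF 0] by (auto simp: cont_space_def)
  next
    case (Suc n)
    interpret scale l by (rule Suc.prems)
    let ?r = "retraction_approx j n l'"
    let ?h = "\<lambda>d y. d \<bullet> vicsek_q j + (if on_diagonal j d then ?r y / real L else 0)"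
    note IH = Suc.IH[OF scale_shift]
    have comp: "compatible ?h" using IH by (intro retraction_step_compatible assms(2)) auto
    have "continuous_on K' (?h d)" for d
      using IH L_pos by (cases "on_diagonal j d") (auto simp: cont_space_def intro!: continuous_intros)
    then have cont: "retraction_approx j (Suc n) l \<in> cont_space (vicsek_set l)"
      using glue_cont[OF comp] by simp
    have "retraction_approx j (Suc n) l (vicsek_q k) = vicsek_q k \<bullet> vicsek_q j" if k: "k \<in> {0..4}" for k
    proof -
      obtain d where d: "d \<in> S" "F d (vicsek_q k) = vicsek_q k" by (rule vicsek_q_fixed[OF k])
      have "retraction_approx j (Suc n) l (vicsek_q k) = ?h d (vicsek_q k)"
        using glue_F[OF comp d(1) vicsek_q_in_set[OF scale_shift k]] d(2) by simp
      also have "\<dots> = vicsek_q k \<bullet> vicsek_q j"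
      proof -
        have q: "vicsek_q k \<bullet> vicsek_q j = d \<bullet> vicsek_q j + (vicsek_q k \<bullet> vicsek_q j) / real L"
          using arg_cong[OF d(2), of "\<lambda>x. x \<bullet> vicsek_q j"]
          by (simp add: inner_vicsek_F)
        \<comment> \<open>The corner is fixed by \<open>F d\<close>, so for orthogonal
          \<open>d\<close> its coordinate equals itself divided by \<open>L\<close>.\<close>
        have "vicsek_q k \<bullet> vicsek_q j = 0" if "\<not> on_diagonal j d"
        proof -
          have "(vicsek_q k \<bullet> vicsek_q j) * real L = vicsek_q k \<bullet> vicsek_q j"
            using q that L_pos by (simp add: on_diagonal_def field_simps)
          then have "(vicsek_q k \<bullet> vicsek_q j) * (real L - 1) = 0" by (simp add: algebra_simps)
          then show ?thesis using L_ge_3 by simp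
        qed
        then show ?thesis using IH k q by (auto simp: on_diagonal_def)
      qed
      finally show ?thesis .
    qed
    then show ?case using cont by blast
  qed
  then show "retraction_approx j n l \<in> cont_space (vicsek_set l)"
    and "k \<in> {0..4} \<Longrightarrow> retraction_approx j n l (vicsek_q k) = vicsek_q k \<bullet> vicsek_q j" by auto
qed

lemma (in scale) retraction_approx_F:
  assumes "j \<in> {1..4}" "d \<in> S" "y \<in> K'"
  shows "retraction_approx j (Suc n) l (F d y) =
    d \<bullet> vicsek_q j + (if on_diagonal j d then retraction_approx j n l' y / real L else 0)"
  unfolding retraction_approx.simps
  by (rule glue_F[OF retraction_step_compatible assms(2,3)])
    (use assms(1) retraction_approx(2)[OF scale_shift] in auto)

text \<open>The first refinement alters only collapsed cells, by at most 1; each further level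
  divides the change by some \<open>L \<ge> 3\<close>.\<close>

lemma retraction_approx_diff:
  assumes "scale l" "j \<in> {1..4}" "x \<in> vicsek_set l"
  shows "\<bar>retraction_approx j (Suc n) l x - retraction_approx j n l x\<bar> \<le> (1/3) ^ n"
  using assms(1,3)
proof (induction n arbitrary: l x)
  case 0
  interpret scale l by (rule 0)
  obtain d y where d: "d \<in> S" "y \<in> K'" "x = F d y" using 0(2) unfolding vicsek_set_self_similar by blast
  have y: "\<bar>y \<bullet> vicsek_q j\<bar> \<le> 1" using vicsek_set_subset_K0[OF scale_shift] d(2) assms(2) by (intro inner_vicsek_q_le) auto
  have "x \<bullet> vicsek_q j = d \<bullet> vicsek_q j + (y \<bullet> vicsek_q j) / real L"
    unfolding d(3) by (rule inner_vicsek_F)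
  then have "\<bar>retraction_approx j (Suc 0) l x - retraction_approx j 0 l x\<bar> \<le> \<bar>y \<bullet> vicsek_q j\<bar> / real L"
    using retraction_approx_F[OF assms(2) d(1,2), of 0] 0(2) d by (auto simp del: retraction_approx.simps(2))
  also have "\<dots> \<le> 1 / 1" using y L_ge_3 by (intro frac_le) auto
  finally show ?case by simp
next
  case (Suc n)
  interpret scale l by (rule Suc.prems)
  obtain d y where d: "d \<in> S" "y \<in> K'" "x = F d y" using Suc.prems(2) unfolding vicsek_set_self_similar by blast
  have "\<bar>retraction_approx j (Suc (Suc n)) l x - retraction_approx j (Suc n) l x\<bar>
      \<le> \<bar>retraction_approx j (Suc n) l' y - retraction_approx j n l' y\<bar> / real L"
    unfolding d(3) retraction_approx_F[OF assms(2) d(1,2)]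
    by (simp add: diff_divide_distrib[symmetric] del: retraction_approx.simps(2))
  also have "\<dots> \<le> (1/3) ^ n / 3"
    using L_ge_3 Suc.IH[OF scale_shift d(2)] by (intro frac_le) auto
  finally show ?case by simp
qed

definition retraction :: "nat \<Rightarrow> (nat \<Rightarrow> nat) \<Rightarrow> complex \<Rightarrow> real" where
  "retraction j l x = lim (\<lambda>n. retraction_approx j n l x)"

lemma retraction_uniform_limit:
  assumes "scale l" "j \<in> {1..4}"
  shows "uniform_limit UNIV (\<lambda>n. retraction_approx j n l) (retraction j l) sequentially"
proof -
  let ?r = "\<lambda>n. retraction_approx j n l"
  have "uniform_limit UNIV (\<lambda>n x. \<Sum>i<n. ?r (Suc i) x - ?r i x) (\<lambda>x. \<Sum>i. ?r (Suc i) x - ?r i x) sequentially"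
  proof (rule Weierstrass_m_test)
    show "summable (\<lambda>n. (1/3) ^ n :: real)" by (rule summable_geometric) simp
    show "norm (?r (Suc n) x - ?r n x) \<le> (1/3) ^ n" for n x
    proof (cases "x \<in> vicsek_set l")
      case True
      then show ?thesis using retraction_approx_diff[OF assms] by (simp del: retraction_approx.simps)
    next
      case False
      then have "?r n x = 0" for n using retraction_approx(1)[OF assms, of n] by (simp add: cont_space_def)
      then show ?thesis by (simp del: retraction_approx.simps)
    qed
  qed
  then have "uniform_limit UNIV (\<lambda>n x. (\<Sum>i<n. ?r (Suc i) x - ?r i x) + ?r 0 x)
      (\<lambda>x. (\<Sum>i. ?r (Suc i) x - ?r i x) + ?r 0 x) sequentially"
    by (intro uniform_limit_add uniform_limit_const)
  then have unif: "uniform_limit UNIV ?r (\<lambda>x. (\<Sum>i. ?r (Suc i) x - ?r i x) + ?r 0 x) sequentially"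
    unfolding sum_lessThan_telescope[of "\<lambda>i. ?r i x" for x] by (simp del: retraction_approx.simps)
  moreover have "retraction j l x = (\<Sum>i. ?r (Suc i) x - ?r i x) + ?r 0 x" for x
    unfolding retraction_def by (intro limI tendsto_uniform_limitI[OF unif]) simp
  ultimately show ?thesis by (simp add: fun_eq_iff[symmetric] cong: uniform_limit_cong')
qed

lemma retraction_tendsto:
  assumes "scale l" "j \<in> {1..4}"
  shows "(\<lambda>n. retraction_approx j n l x) \<longlonglongrightarrow> retraction j l x"
  by (rule tendsto_uniform_limitI[OF retraction_uniform_limit[OF assms]]) simp

lemma retraction_cont_space:
  assumes "scale l" "j \<in> {1..4}"
  shows "retraction j l \<in> cont_space (vicsek_set l)"
  unfolding cont_space_def
proof (intro CollectI conjI allI impI)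
  show "continuous_on (vicsek_set l) (retraction j l)"
    by (rule uniform_limit_theorem[OF _ uniform_limit_on_subset[OF retraction_uniform_limit[OF assms]]])
      (use retraction_approx(1)[OF assms] in \<open>auto simp: cont_space_def\<close>)
  fix x assume "x \<notin> vicsek_set l"
  then have "retraction_approx j n l x = 0" for n
    using retraction_approx(1)[OF assms, of n] by (simp add: cont_space_def)
  then show "retraction j l x = 0" using retraction_tendsto[OF assms, of x] by (simp add: LIMSEQ_const_iff)
qed

lemma retraction_q:
  assumes "scale l" "j \<in> {1..4}" "k \<in> {0..4}"
  shows "retraction j l (vicsek_q k) = vicsek_q k \<bullet> vicsek_q j"
  using retraction_tendsto[OF assms(1,2), of "vicsek_q k"]
  unfolding retraction_approx(2)[OF assms] by (simp add: LIMSEQ_const_iff)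

lemma (in scale) retraction_F:
  assumes "j \<in> {1..4}" "d \<in> S" "y \<in> K'"
  shows "retraction j l (F d y) =
    d \<bullet> vicsek_q j + (if on_diagonal j d then retraction j l' y / real L else 0)"
proof (rule LIMSEQ_unique)
  show "(\<lambda>n. retraction_approx j (Suc n) l (F d y)) \<longlonglongrightarrow> retraction j l (F d y)"
    by (rule LIMSEQ_Suc[OF retraction_tendsto[OF scale_axioms assms(1)]])
  show "(\<lambda>n. retraction_approx j (Suc n) l (F d y)) \<longlonglongrightarrow>
    d \<bullet> vicsek_q j + (if on_diagonal j d then retraction j l' y / real L else 0)"
    unfolding retraction_approx_F[OF assms] using L_pos
    by (cases "on_diagonal j d") (auto intro!: tendsto_intros retraction_tendsto[OF scale_shift assms(1)])
qed

text \<open>With \<open>m = (L - 1) div 2\<close> the digits on the diagonal are among the multiples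
  from \<open>-m\<close> to \<open>m\<close> of one step, and \<open>2 * m + 1 = L\<close> by
  oddness.\<close>

lemma (in scale) card_on_diagonal:
  assumes j: "j \<in> {1..4}"
  shows "real (card {d \<in> S. on_diagonal j d}) \<le> real L"
proof -
  define m where "m = int ((L - 1) div 2)"
  define f where "f k = (2 * real_of_int k / real L) *\<^sub>R vicsek_q j" for k :: int
  have "{d \<in> S. on_diagonal j d} \<subseteq> f ` {-m..m}"
  proof
    fix d assume "d \<in> {d \<in> S. on_diagonal j d}"
    then have d: "d \<in> S" "on_diagonal j d" by auto
    obtain n k where nk: "n \<le> (L - 1) div 2" "k \<in> {1..4}" "d = of_nat (2 * n) / of_nat L * vicsek_q k"
      using d(1) unfolding vicsek_S_def by blast
    have d': "d = (2 * real n / real L) *\<^sub>R vicsek_q k" using nk by (simp add: scaleR_conv_of_real)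
    show "d \<in> f ` {-m..m}"
    proof (cases "d = 0")
      case True
      then have "d = f 0" by (simp add: f_def)
      then show ?thesis by (rule image_eqI) (simp add: m_def)
    next
      case False
      then have "vicsek_q k \<bullet> vicsek_q j \<noteq> 0" using d(2) d' by (auto simp: on_diagonal_def)
      then consider "k = j" | "vicsek_q k = - vicsek_q j"
        using inner_vicsek_q[OF j nk(2)] by (auto split: if_splits)
      then show ?thesis
      proof cases
        case 1
        then have "d = f (int n)" using d' by (simp add: f_def)
        then show ?thesis by (rule image_eqI) (use nk(1) in \<open>simp add: m_def\<close>)
      next
        case 2
        then have "d = f (- int n)" using d' by (simp add: f_def)
        then show ?thesis by (rule image_eqI) (use nk(1) in \<open>simp add: m_def\<close>)
      qed
    qed
  qed
  then have "card {d \<in> S. on_diagonal j d} \<le> card {-m..m}"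
    by (intro surj_card_le) auto
  also have "\<dots> = L" using l_odd[of 1] by (auto simp: m_def elim!: oddE)
  finally show ?thesis by simp
qed

text \<open>The bound does not grow with the level: at most \<open>L\<close> cells carry a copy
  scaled by \<open>1 / L\<close>, and \<open>L powr (p - 1) * L * L powr - p = 1\<close>. The 4
  comes from level 0, four spokes with increments at most 1.\<close>

lemma retraction_energy:
  assumes "scale l" "1 < p" "j \<in> {1..4}"
  shows "discrete_energy l p n (retraction j l) \<le> 4"
  using assms(1)
proof (induction n arbitrary: l)
  case 0
  interpret scale l by (rule 0)
  have "\<bar>retraction j l 0 - retraction j l (vicsek_q k)\<bar> powr p \<le> 1" if "k \<in> {1..4}" for k
  proof -
    have "retraction j l 0 = 0" using retraction_q[OF 0 assms(3), of 0] by simp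
    moreover have "\<bar>retraction j l (vicsek_q k)\<bar> \<le> 1"
      using retraction_q[OF 0 assms(3), of k] inner_vicsek_q[OF assms(3) that] that by auto
    ultimately show ?thesis using assms(2) powr_mono2[of p "\<bar>retraction j l (vicsek_q k)\<bar>" 1] by simp
  qed
  then have "discrete_energy l p 0 (retraction j l) \<le> (\<Sum>k\<in>{1..4::nat}. 1)"
    unfolding discrete_energy_0 by (intro sum_mono)
  then show ?case by simp
next
  case (Suc n)
  interpret scale l by (rule Suc.prems)
  interpret D: p_energy UNIV p "discrete_energy l' p n" by (rule p_energy_discrete_energy[OF assms(2)])
  have cell: "discrete_energy l' p n (\<lambda>z. retraction j l (F d z)) \<le>
      (if on_diagonal j d then 4 / real L powr p else 0)" if "d \<in> S" for d
  proof (cases "on_diagonal j d")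
    case True
    let ?r = "(1 / real L) *\<^sub>R retraction j l'"
    have "discrete_energy l' p n (\<lambda>z. retraction j l (F d z)) = discrete_energy l' p n (\<lambda>z. d \<bullet> vicsek_q j + ?r z)"
      using True by (intro discrete_energy_cong[OF scale_shift]) (simp add: retraction_F[OF assms(3) that] scaleR_fun_def del: One_nat_def)
    also have "\<dots> = discrete_energy l' p n ?r" by (simp add: discrete_energy_def)
    also have "\<dots> = discrete_energy l' p n (retraction j l') / real L powr p"
      by (simp add: D.homogeneous powr_divide)
    also have "\<dots> \<le> 4 / real L powr p"
      using Suc.IH[OF scale_shift] by (intro divide_right_mono) auto
    finally show ?thesis using True by simp
  next
    case False
    then have "discrete_energy l' p n (\<lambda>z. retraction j l (F d z)) = discrete_energy l' p n (\<lambda>z. d \<bullet> vicsek_q j)"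
      by (intro discrete_energy_cong[OF scale_shift]) (simp add: retraction_F[OF assms(3) that] del: One_nat_def)
    also have "\<dots> = 0" by (simp add: discrete_energy_def)
    finally show ?thesis using False by simp
  qed
  have "discrete_energy l p (Suc n) (retraction j l) \<le>
      real L powr (p - 1) * (\<Sum>d\<in>S. if on_diagonal j d then 4 / real L powr p else 0)"
    unfolding discrete_energy_Suc by (intro mult_left_mono sum_mono cell) auto
  also have "(\<Sum>d\<in>S. if on_diagonal j d then 4 / real L powr p else 0) =
      real (card {d \<in> S. on_diagonal j d}) * (4 / real L powr p)"
    using finite_vicsek_S by (simp add: sum.If_cases Int_def)
  also have "real L powr (p - 1) * \<dots> \<le> real L powr (p - 1) * (real L * (4 / real L powr p))"
    by (intro mult_left_mono mult_right_mono card_on_diagonal assms(3)) auto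
  also have "\<dots> = 4"
  proof -
    have "real L powr p = real L * real L powr (p - 1)" using L_pos by (simp add: powr_mult_base)
    moreover have "real L powr (p - 1) \<noteq> 0" using L_pos by simp
    ultimately show ?thesis using L_pos by simp
  qed
  finally show ?case .
qed

section \<open>Tent functions and approximation of continuous functions\<close>

lemma sum_fun_apply: "(\<Sum>i\<in>A. g i) x = (\<Sum>i\<in>A. g i x)"
  by (induction A rule: infinite_finite_induct) auto

lemma lipschitz_clamp: "1-lipschitz_on UNIV (\<lambda>t::real. max 0 (min 1 t))"
  by (rule lipschitz_onI) (auto simp: dist_real_def)

context vicsek
begin

text \<open>The retraction is 1 at its own corner and 0 or -1 at the others. Clipping to values
  between 0 and 1 removes the -1 and, being 1-Lipschitz, does not raise the energy.\<close>

definition tent :: "nat \<Rightarrow> complex \<Rightarrow> real" where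
  "tent j = comp_on K (\<lambda>t. max 0 (min 1 t)) (retraction j l)"

lemma tent_sobolev: "j \<in> {1..4} \<Longrightarrow> tent j \<in> sobolev_space l p"
  unfolding tent_def
  by (intro sobolev_space_Lipschitz(1) lipschitz_clamp sobolev_spaceI(1)[OF retraction_cont_space retraction_energy]
      scale_axioms p)

lemma tent_bounds: "0 \<le> tent j x" "tent j x \<le> 1"
  by (auto simp: tent_def comp_on_def)

lemma tent_q:
  assumes "j \<in> {1..4}" "k \<in> {1..4}"
  shows "tent j (vicsek_q k) = (if k = j then 1 else 0)"
proof -
  have "k \<in> {0..4}" using assms by simp
  then show ?thesis
    using retraction_q[OF scale_axioms assms(1), of k] inner_vicsek_q[OF assms] vicsek_q_in_set[OF scale_axioms, of k]
    by (auto simp: tent_def comp_on_def)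
qed

lemma indicator_sobolev: "indicat_real K \<in> sobolev_space l p"
proof (rule sobolev_spaceI)
  have "continuous_on K (indicat_real K)" by (rule continuous_on_eq[of _ "\<lambda>_. 1"]) auto
  then show "indicat_real K \<in> cont_space K" by (simp add: cont_space_def)
  have "discrete_energy l p n (indicat_real K) = discrete_energy l p n (\<lambda>_. 1)" for n
    by (rule discrete_energy_cong[OF scale_axioms]) simp
  moreover have "discrete_energy l p n (\<lambda>_. 1) = 0" for n by (simp add: discrete_energy_def)
  ultimately show "discrete_energy l p n (indicat_real K) \<le> 0" for n by (simp only: order_refl)
qed

text \<open>Tents are dual to evaluation at the corners and lie between 0 and 1, so correcting the
  constant \<open>f 0\<close> costs at most the sum of the corner deviations.\<close>

lemma corner_interpolation:
  obtains h where "h \<in> sobolev_space l p" "\<And>k. k \<in> {1..4} \<Longrightarrow> h (vicsek_q k) = f (vicsek_q k)"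
    "\<And>x. x \<in> K \<Longrightarrow> \<bar>h x - f 0\<bar> \<le> (\<Sum>k\<in>{1..4}. \<bar>f (vicsek_q k) - f 0\<bar>)"
proof -
  define c where "c k = f (vicsek_q k) - f 0" for k
  define h where "h = f 0 *\<^sub>R indicat_real K + (\<Sum>j\<in>{1..4}. c j *\<^sub>R tent j)"
  have h: "h x = f 0 + (\<Sum>j\<in>{1..4}. c j * tent j x)" if "x \<in> K" for x
    using that by (simp add: h_def sum_fun_apply scaleR_fun_def)
  show ?thesis
  proof
    show "h \<in> sobolev_space l p"
      unfolding h_def by (intro E.mem_add E.mem_scale indicator_sobolev subspace_sum[OF subspace_sobolev_space] tent_sobolev)
    show "h (vicsek_q k) = f (vicsek_q k)" if k: "k \<in> {1..4}" for k
    proof -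
      have "vicsek_q k \<in> K" using k by (intro vicsek_q_in_set scale_axioms) auto
      moreover have "(\<Sum>j\<in>{1..4}. c j * tent j (vicsek_q k)) = (\<Sum>j\<in>{1..4}. if k = j then c j else 0)"
      proof (rule sum.cong[OF refl])
        fix j :: nat assume j: "j \<in> {1..4}"
        show "c j * tent j (vicsek_q k) = (if k = j then c j else 0)" using tent_q[OF j k] by simp
      qed
      ultimately show ?thesis using h k by (simp add: c_def)
    qed
    show "\<bar>h x - f 0\<bar> \<le> (\<Sum>k\<in>{1..4}. \<bar>f (vicsek_q k) - f 0\<bar>)" if "x \<in> K" for x
    proof -
      have "\<bar>h x - f 0\<bar> \<le> (\<Sum>j\<in>{1..4}. \<bar>c j * tent j x\<bar>)"
        unfolding h[OF that] by simp
      also have "\<dots> \<le> (\<Sum>j\<in>{1..4}. \<bar>c j\<bar>)"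
        using tent_bounds by (intro sum_mono) (simp add: abs_mult mult_left_le)
      finally show ?thesis by (simp add: c_def)
    qed
  qed
qed

end

text \<open>Exact agreement with \<open>f\<close> at the corners is part of the claim because it
  makes the approximants on neighbouring cells compatible. The 5 counts one \<open>e\<close> for
  \<open>f x - f 0\<close> and four for the corner deviations at level 0; gluing adds
  nothing.\<close>

lemma sobolev_approximation:
  assumes "vicsek l p"
    and "\<And>x y. x \<in> vicsek_set l \<Longrightarrow> y \<in> vicsek_set l \<Longrightarrow> dist x y \<le> cell_radius l n \<Longrightarrow> \<bar>f x - f y\<bar> \<le> e"
  shows "\<exists>h\<in>sobolev_space l p. (\<forall>k\<in>{1..4}. h (vicsek_q k) = f (vicsek_q k)) \<and>
    (\<forall>x\<in>vicsek_set l. \<bar>h x - f x\<bar> \<le> 5 * e)"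
  using assms
proof (induction n arbitrary: l f)
  case 0
  interpret vicsek l p by (rule 0)
  obtain h where h: "h \<in> sobolev_space l p" "\<And>k. k \<in> {1..4} \<Longrightarrow> h (vicsek_q k) = f (vicsek_q k)"
    "\<And>x. x \<in> K \<Longrightarrow> \<bar>h x - f 0\<bar> \<le> (\<Sum>k\<in>{1..4}. \<bar>f (vicsek_q k) - f 0\<bar>)"
    using corner_interpolation by blast
  have f0: "\<bar>f x - f 0\<bar> \<le> e" if "x \<in> K" for x
    using that vicsek_set_subset_K0[OF scale_axioms] norm_le_1_vicsek_K0[of x]
    by (intro 0(2) zero_in_K) (auto simp: cell_radius_0)
  have "\<bar>h x - f x\<bar> \<le> 5 * e" if "x \<in> K" for x
  proof -
    have "(\<Sum>k\<in>{1..4}. \<bar>f (vicsek_q k) - f 0\<bar>) \<le> (\<Sum>k\<in>{1..4::nat}. e)"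
      by (intro sum_mono f0 vicsek_q_in_set scale_axioms) auto
    then show ?thesis using h(3)[OF that] f0[OF that] by simp
  qed
  then show ?case using h by blast
next
  case (Suc n)
  interpret vicsek l p by (rule Suc.prems)
  have "\<exists>h\<in>sobolev_space l' p. (\<forall>k\<in>{1..4}. h (vicsek_q k) = f (F d (vicsek_q k))) \<and>
    (\<forall>y\<in>K'. \<bar>h y - f (F d y)\<bar> \<le> 5 * e)" if "d \<in> S" for d
  proof (rule Suc.IH[OF vicsek_shift])
    fix x y assume xy: "x \<in> K'" "y \<in> K'" "dist x y \<le> cell_radius l' n"
    have "dist (F d x) (F d y) = dist x y / real L"
      by (simp add: vicsek_F_def dist_norm diff_divide_distrib[symmetric] norm_divide)
    also have "\<dots> \<le> cell_radius l (Suc n)"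
      using xy(3) unfolding cell_radius_Suc by (intro divide_right_mono) auto
    finally show "\<bar>f (F d x) - f (F d y)\<bar> \<le> e"
      using xy that by (intro Suc.prems(2) vicsek_F_in_set)
  qed
  then obtain h where h: "\<And>d. d \<in> S \<Longrightarrow> h d \<in> sobolev_space l' p"
    "\<And>d k. d \<in> S \<Longrightarrow> k \<in> {1..4} \<Longrightarrow> h d (vicsek_q k) = f (F d (vicsek_q k))"
    "\<And>d y. d \<in> S \<Longrightarrow> y \<in> K' \<Longrightarrow> \<bar>h d y - f (F d y)\<bar> \<le> 5 * e"
    by metis
  have comp: "compatible h"
  proof (rule compatibleI)
    fix d e y z assume *: "d \<in> S" "e \<in> S" "F d y = F e z" "y \<in> vicsek_q ` {1..4}" "z \<in> vicsek_q ` {1..4}"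
    have "h d y = f (F d y)" "h e z = f (F e z)" using * h(2) by blast+
    then show "h d y = h e z" using * by simp
  qed
  show ?case
  proof (intro bexI[of _ "glue l h"] conjI ballI)
    show "glue l h \<in> sobolev_space l p" by (rule glue_sobolev[OF comp h(1)])
    show "glue l h (vicsek_q k) = f (vicsek_q k)" if k: "k \<in> {1..4}" for k
    proof -
      have k': "k \<in> {0..4}" using k by simp
      obtain d where d: "d \<in> S" "F d (vicsek_q k) = vicsek_q k" by (rule vicsek_q_fixed[OF k'])
      show ?thesis using glue_F[OF comp d(1) vicsek_q_in_set[OF scale_shift k']] h(2)[OF d(1) k] d(2) by simp
    qed
    show "\<bar>glue l h x - f x\<bar> \<le> 5 * e" if x: "x \<in> K" for x
    proof -
      obtain d y where d: "d \<in> S" "y \<in> K'" "x = F d y" using x unfolding vicsek_set_self_similar by blast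
      show ?thesis using h(3)[OF d(1,2)] unfolding d(3) glue_F[OF comp d(1,2)] .
    qed
  qed
qed

lemma normed_space_cont_space:
  assumes "compact K" "K \<noteq> {}"
  shows "normed_space_on (cont_space K) (sup_norm K)"
proof -
  note le = abs_le_sup_norm[OF assms(1) _ assms(2)]
  have le_sup: "sup_norm K u \<le> a" if "\<And>x. x \<in> K \<Longrightarrow> \<bar>u x\<bar> \<le> a" for u a
    unfolding sup_norm_def using assms(2) that by (rule cSUP_least)
  have nonneg: "0 \<le> sup_norm K u" if "u \<in> cont_space K" for u using le[OF that, of 0] by linarith
  have scale_le: "sup_norm K (c *\<^sub>R u) \<le> \<bar>c\<bar> * sup_norm K u" if "u \<in> cont_space K" for c u
    using le[OF that] by (intro le_sup) (simp add: scaleR_fun_def abs_mult mult_left_mono)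
  have scale: "sup_norm K (c *\<^sub>R u) = \<bar>c\<bar> * sup_norm K u" if u: "u \<in> cont_space K" for c u
  proof (cases "c = 0")
    case True
    then show ?thesis using scale_le[OF u, of c] nonneg[OF subspace_scale[OF subspace_cont_space u, of c]] by simp
  next
    case False
    \<comment> \<open>The reverse inequality is the same bound applied to the factor
      \<open>1 / c\<close>.\<close>
    have "sup_norm K u \<le> \<bar>1 / c\<bar> * sup_norm K (c *\<^sub>R u)"
      using scale_le[OF subspace_scale[OF subspace_cont_space u, of c], of "1 / c"] False by simp
    then have "\<bar>c\<bar> * sup_norm K u \<le> sup_norm K (c *\<^sub>R u)" using False by (simp add: field_simps)
    then show ?thesis using scale_le[OF u, of c] by simp
  qed
  have add: "sup_norm K (u + v) \<le> sup_norm K u + sup_norm K v" if "u \<in> cont_space K" "v \<in> cont_space K" for u v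
  proof (rule le_sup)
    show "\<bar>(u + v) x\<bar> \<le> sup_norm K u + sup_norm K v" for x
      using le[OF that(1), of x] le[OF that(2), of x] by simp
  qed
  have zero: "u = 0" if "u \<in> cont_space K" "sup_norm K u = 0" for u
    using le[OF that(1)] that(2) by (simp add: fun_eq_iff)
  show ?thesis
    unfolding normed_space_on_def seminorm_on_def using subspace_cont_space nonneg scale add zero by blast
qed

lemma (in vicsek) sobolev_dense:
  "norm_topology (cont_space K) (sup_norm K) closure_of (sobolev_space l p) = cont_space K"
proof -
  have normed: "normed_space_on (cont_space K) (sup_norm K)"
    by (rule normed_space_cont_space[OF compact_K K_not_empty])
  have sub: "sobolev_space l p \<subseteq> cont_space K" using sobolev_space_cont by blast
  have "\<exists>h\<in>sobolev_space l p. sup_norm K (u - h) < e" if u: "u \<in> cont_space K" and "e > 0" for u e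
  proof -
    have "uniformly_continuous_on K u"
      using u compact_K by (intro compact_uniformly_continuous) (simp_all add: cont_space_def)
    \<comment> \<open>The choice \<open>e / 10\<close> gives the error
      \<open>5 * (e / 10) = e / 2\<close>, so the final inequality is strict.\<close>
    then obtain d where d: "d > 0" "\<And>x y. x \<in> K \<Longrightarrow> y \<in> K \<Longrightarrow> dist x y < d \<Longrightarrow> dist (u x) (u y) < e / 10"
      using \<open>e > 0\<close> unfolding uniformly_continuous_on_def by (metis dist_commute divide_pos_pos zero_less_numeral)
    obtain n where n: "cell_radius l n < d"
      using order_tendstoD(2)[OF cell_radius_tendsto_0[OF scale_axioms] d(1)] by (auto simp: eventually_sequentially)
    have "\<bar>u x - u y\<bar> \<le> e / 10" if "x \<in> K" "y \<in> K" "dist x y \<le> cell_radius l n" for x y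
      using d(2)[OF that(1,2)] that(3) n by (simp add: dist_real_def)
    then obtain h where h: "h \<in> sobolev_space l p" "\<And>x. x \<in> K \<Longrightarrow> \<bar>h x - u x\<bar> \<le> 5 * (e / 10)"
      using sobolev_approximation[OF vicsek_axioms] by blast
    have "sup_norm K (u - h) \<le> 5 * (e / 10)"
      unfolding sup_norm_def using h(2) by (intro cSUP_least K_not_empty) (simp add: abs_minus_commute)
    then show ?thesis using h(1) \<open>e > 0\<close> by (intro bexI[of _ h]) auto
  qed
  then show ?thesis unfolding closure_of_norm_topology[OF normed sub] by blast
qed

theorem theorem1p1:
  fixes l :: "nat \<Rightarrow> nat" and M :: "complex measure" and p :: real
  assumes "scale_sequence l"
    and "vicsek_measure l M"
    and "1 < p"
  defines "K \<equiv> vicsek_set l"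
    and "F \<equiv> sobolev_space l p"
    and "E \<equiv> energy l p"
    and "N \<equiv> sobolev_norm l M p"
  shows "normed_space_on F N
    \<and> (\<forall>u\<in>F. 0 \<le> E u) \<and> seminorm_on F (\<lambda>u. E u powr (1 / p))
    \<and> \<comment> \<open>(1)\<close>
      (uniformly_convex_on F N \<and> separable_space (norm_topology F N) \<and>
       reflexive_on F N \<and> banach_space_on F N)
    \<and> \<comment> \<open>(2)\<close>
      (\<forall>u\<in>F. \<forall>v\<in>F. u * v \<in> F \<and>
         E (u * v) \<le> 2 powr (p - 1) *
           (sup_norm K u powr p * E v + sup_norm K v powr p * E u))
    \<and> \<comment> \<open>(3)\<close>
      (subspace F \<and> F \<subseteq> cont_space K \<and>
       norm_topology (cont_space K) (sup_norm K) closure_of F = cont_space K)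
    \<and> \<comment> \<open>(4)\<close>
      (\<forall>u\<in>F. \<forall>\<phi>. 1-lipschitz_on UNIV \<phi> \<longrightarrow>
         comp_on K \<phi> u \<in> F \<and> E (comp_on K \<phi> u) \<le> E u)
    \<and> \<comment> \<open>(5)\<close>
      (\<exists>C\<ge>1. \<forall>u\<in>F.
         (\<integral>x. \<bar>u x - 1 / measure M K * (\<integral>y. u y \<partial>M)\<bar> powr p \<partial>M)
           \<le> C * diameter K powr (p - 1) * E u)
    \<and> \<comment> \<open>(6)\<close>
      (\<forall>u\<in>F. \<forall>v\<in>F.
         (\<exists>a. supp_on K u \<inter> supp_on K (v - a *\<^sub>R indicat_real K) = {}) \<longrightarrow>
           E (u + v) = E u + E v)"
proof -
  interpret V: vicsek_prob l p M
    using assms(1-3) by unfold_locales (auto simp: vicsek_measure_def)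
  have gap: "\<exists>C\<ge>1. \<forall>u\<in>F. (\<integral>x. \<bar>u x - 1 / measure M K * (\<integral>y. u y \<partial>M)\<bar> powr p \<partial>M)
      \<le> C * diameter K powr (p - 1) * E u"
    unfolding F_def E_def K_def
    by (intro exI[of _ "max 1 ((2 * oscillation_const p) powr p)"] conjI ballI V.spectral_gap) auto
  have local: "\<forall>u\<in>F. \<forall>v\<in>F. (\<exists>a. supp_on K u \<inter> supp_on K (v - a *\<^sub>R indicat_real K) = {}) \<longrightarrow>
      E (u + v) = E u + E v"
    unfolding F_def E_def K_def using V.energy_local by blast
  show ?thesis
  proof (intro conjI gap local)
    show "normed_space_on F N" "banach_space_on F N" "uniformly_convex_on F N"
      "separable_space (norm_topology F N)" "subspace F"
      unfolding F_def N_def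
      by (rule V.normed_space_sobolev V.banach_space_sobolev V.uniformly_convex_sobolev
          V.separable_sobolev V.subspace_sobolev_space)+
    show "reflexive_on F N"
      unfolding F_def N_def by (rule Milman_Pettis[OF V.banach_space_sobolev V.uniformly_convex_sobolev])
    show "seminorm_on F (\<lambda>u. E u powr (1 / p))"
      using V.E.seminorm_on_root_norm unfolding V.E.root_norm_def F_def E_def .
    show "\<forall>u\<in>F. 0 \<le> E u"
      unfolding F_def E_def by (intro ballI V.E.nonneg)
    show "F \<subseteq> cont_space K"
      unfolding F_def K_def using V.sobolev_space_cont by blast
    show "norm_topology (cont_space K) (sup_norm K) closure_of F = cont_space K"
      unfolding F_def K_def by (rule V.sobolev_dense)
  next
    show "\<forall>u\<in>F. \<forall>v\<in>F. u * v \<in> F \<and> E (u * v) \<le> 2 powr (p - 1) *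
        (sup_norm K u powr p * E v + sup_norm K v powr p * E u)"
      unfolding F_def E_def K_def by (intro ballI conjI V.sobolev_space_mult)
    show "\<forall>u\<in>F. \<forall>\<phi>. 1-lipschitz_on UNIV \<phi> \<longrightarrow> comp_on K \<phi> u \<in> F \<and> E (comp_on K \<phi> u) \<le> E u"
      unfolding F_def E_def K_def by (intro ballI allI impI conjI V.sobolev_space_Lipschitz)
  qed
qed

end
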